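(* Let $m\geq 1$, let $\epsilon>0$ be sufficiently small, and let $s,k$ be natural numbers with $s \geq k(k+1)$ and $k \geq 2$. Suppose that $A$ is a finite, well-spaced subset of $\mathbb{R}\setminus\{0\}$ such that $|A|$ is sufficiently large and $X_A \leq |A|^m$. Let $\alpha \leq 1$ be any (positive) real number such that \[ \log{\alpha^{-1}} \leq \frac{\epsilon k(k+1)}{43200}\log{|A|} \quad \text{and} \quad J_{s,k}(A) = \alpha |A|^{2s-k(k+1)/2}. \] Then \[ |A/A| \gg |A|^{1+\delta-\epsilon k^2} \quad \text{and} \quad |AA| \gg |A|^{1+\delta/2 - 4\epsilon k^2}, \] where $\delta = 1/(k(k+1)-1)$.
   Context: For a finite set $A\subseteq\mathbb{R}$ and natural numbers $s,k$, $J_{s,k}(A)$ denotes the number of solutions $(x_1,\dots,x_s,y_1,\dots,y_s)\in A^{2s}$ of the system $\sum_{i=1}^s x_i^j = \sum_{i=1}^s y_i^j$ for $1\le j\le k$. The diameter of $A$ is $X_A = |\sup A - \inf A|$. A finite set $A\subseteq \mathbb{R}$ is well-spaced if $|A\cap (j,j+1]|\le 1$ for all integers $j\in[\inf A - 1,\sup A]$. $AA=\{a_1a_2: a_1,a_2\in A\}$, $A/A=\{a_2/a_1: a_1,a_2\in A\}$. $X\ll Y$ (or $Y\gg X$) means $|X|\le C|Y|$ for some constant $C>0$. *)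

theory Defs
  imports "HOL-Analysis.Analysis"
begin

definition vinogradov_J :: "nat \<Rightarrow> nat \<Rightarrow> real set \<Rightarrow> nat" where
  "vinogradov_J s k A =
     card {(x, y). x \<in> {1..s} \<rightarrow>\<^sub>E A \<and> y \<in> {1..s} \<rightarrow>\<^sub>E A \<and>
             (\<forall>j\<in>{1..k}. (\<Sum>i=1..s. x i ^ j) = (\<Sum>i=1..s. y i ^ j))}"

definition diam :: "real set \<Rightarrow> real" where
  "diam A = \<bar>Sup A - Inf A\<bar>"

definition well_spaced :: "real set \<Rightarrow> bool" where
  "well_spaced A \<longleftrightarrow> finite A \<and>
     (\<forall>j::int. Inf A - 1 \<le> of_int j \<and> of_int j \<le> Sup A \<longrightarrow>
        card (A \<inter> {of_int j<..of_int j + 1}) \<le> 1)"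

text \<open>The product set \<open>AA\<close> is \<open>A * A\<close> with the set multiplication of
  \<open>HOL-Library.Set_Algebras\<close>, which has no division of sets.\<close>

definition quotient_set :: "real set \<Rightarrow> real set" where
  "quotient_set A = {a2 / a1 | a1 a2. a1 \<in> A \<and> a2 \<in> A}"

end

(*
  Put D = k(k+1)/2.  The first ingredient is the mean value bound J_{D,k}(B) <= C X^e |B|^D for every
  well-spaced B in an interval of length X.  It follows from l^2 decoupling for the moment curve,
  proved by induction on the degree as in Guo-Li-Yung-Zorin-Kranich: on the support of a short
  interval I' the sum over a distant interval I satisfies an approximate system of lower degree, so
  the sum over I can be decoupled with |f_{I'}|^q treated as a weight; Hoelder's inequality then
  exchanges I and I' and every round improves the exponent by a fixed amount.

  If J_{s,k}(A) is nearly maximal, so is the additive energy of the D-fold sums of the points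
  (a, ..., a^k).  By Balog-Szemeredi-Gowers and the Pluennecke-Petridis inequality a large part A' of A
  has at most about |A|^D sums of 2D points, while the mean value bound shows that the D-fold sums of
  any C inside A' number at least about |C|^D.  Feeding this into Solymosi's cone argument for the
  sets A' intersected with its dilates bounds the multiplicative energy of A', hence |A/A| and |AA|
  from below.
*)
theory Submission
  imports Defs "HOL-Analysis.Kronecker_Approximation_Theorem" "HOL-Library.Function_Algebras"
    "HOL-Library.Set_Algebras" "HOL-Real_Asymp.Real_Asymp"
begin

section \<open>Words and elementary inequalities\<close>

text \<open>The exponential sums are sums of abstract functions on a finite index set; all that is
  kept about them is which correlations of words may be non-zero. So multiplying the weight by a
  power of a sum merely lengthens words, and the application needs a finite cyclic group instead of
  integrals over frequency space. The obstacle there is that A consists of reals: a generic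
  combination of the k equations, followed by simultaneous Dirichlet approximation, gives integer
  weights with exactly the same solutions.

  The obstacle in the bootstrap is the accumulation of constants over many scales. Hence a base M,
  large in terms of the degree, the density bound and the target exponent, is fixed first, rescaling
  is exact, and the loss per scale is paid by a power of M.

  The value of \<delta> comes from the cone argument: with N = |A|, about N^(2D) / t^(2D) ratios at
  most have t representations, besides the trivial bound N^2 / t. Interpolating with weights
  \<delta> and 1 - \<delta> must give decay t^(-2), so that the energy loses only a logarithm; this
  means 2D\<delta> + 1 - \<delta> = 2, where 2D = k(k+1).\<close>

definition words :: "'a set \<Rightarrow> nat \<Rightarrow> 'a list set" where
  "words B n = {xs. set xs \<subseteq> B \<and> length xs = n}"

lemma finite_words: "finite B \<Longrightarrow> finite (words B n)"
  unfolding words_def by (rule finite_lists_length_eq)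

lemma card_words: "finite B \<Longrightarrow> card (words B n) = card B ^ n"
  unfolding words_def by (rule card_lists_length_eq)

lemma words_mono: "B \<subseteq> B' \<Longrightarrow> words B n \<subseteq> words B' n"
  by (auto simp: words_def)

lemma words_0 [simp]: "words B 0 = {[]}"
  by (auto simp: words_def)

lemma append_words: "xs \<in> words B n \<Longrightarrow> ys \<in> words B m \<Longrightarrow> xs @ ys \<in> words B (n + m)"
  by (auto simp: words_def)

lemma words_Suc: "words B (Suc n) = (\<lambda>(x, xs). x # xs) ` (B \<times> words B n)"
  by (auto simp: words_def length_Suc_conv image_iff)

lemma sum_words_Suc: "(\<Sum>xs\<in>words B (Suc n). F xs) = (\<Sum>x\<in>B. \<Sum>xs\<in>words B n. F (x # xs))"
  unfolding words_Suc
  by (subst sum.reindex) (auto simp: inj_on_def sum.cartesian_product intro!: sum.cong)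

lemma power_sum_words:
  fixes c :: "'a \<Rightarrow> 'b::comm_semiring_1"
  shows "(\<Sum>x\<in>B. c x) ^ n = (\<Sum>xs\<in>words B n. prod_list (map c xs))"
proof (induction n)
  case (Suc n)
  show ?case by (simp add: Suc sum_words_Suc sum_product)
qed simp

lemma sum_power_le_power_sum:
  fixes a :: "'a \<Rightarrow> real"
  assumes "finite S" "\<And>i. i \<in> S \<Longrightarrow> 0 \<le> a i" "n \<ge> 1"
  shows "(\<Sum>i\<in>S. a i ^ n) \<le> (\<Sum>i\<in>S. a i) ^ n"
proof -
  obtain m where n: "n = Suc m" using assms(3) by (cases n) auto
  let ?s = "\<Sum>i\<in>S. a i"
  have "(\<Sum>i\<in>S. a i ^ n) \<le> (\<Sum>i\<in>S. a i * ?s ^ m)"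
    unfolding n power_Suc using assms
    by (intro sum_mono mult_left_mono power_mono member_le_sum) auto
  also have "\<dots> = ?s ^ n" by (simp add: n sum_distrib_right)
  finally show ?thesis .
qed

text \<open>The sum is at most \<open>card S\<close> times its largest term, and the
  \<open>p\<close>-th power of that term is one of the summands. The exponent \<open>p\<close> in
  place of the sharp \<open>p - 1\<close> only enters losses that later gains exceed.\<close>

lemma power_sum_le_card:
  fixes a :: "'a \<Rightarrow> real"
  assumes "finite S" "\<And>i. i \<in> S \<Longrightarrow> 0 \<le> a i" "p > 0"
  shows "(\<Sum>i\<in>S. a i) ^ p \<le> real (card S) ^ p * (\<Sum>i\<in>S. a i ^ p)"
proof (cases "S = {}")
  case True thus ?thesis using assms by (simp add: zero_power)
next
  case False
  have "Max (a ` S) \<in> a ` S" using assms(1) False by (intro Max_in) auto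
  then obtain i0 where i0': "i0 \<in> S" "Max (a ` S) = a i0" by auto
  hence i0: "i0 \<in> S" "\<And>i. i \<in> S \<Longrightarrow> a i \<le> a i0"
    using assms(1) Max_ge[of "a ` S"] by auto
  have "(\<Sum>i\<in>S. a i) \<le> real (card S) * a i0"
    using i0 by (metis sum_bounded_above)
  hence "(\<Sum>i\<in>S. a i) ^ p \<le> (real (card S) * a i0) ^ p"
    using assms by (intro power_mono sum_nonneg) auto
  also have "\<dots> \<le> real (card S) ^ p * (\<Sum>i\<in>S. a i ^ p)"
    unfolding power_mult_distrib using assms i0
    by (intro mult_left_mono member_le_sum) auto
  finally show ?thesis .
qed

lemma power_powr_frac:
  fixes x :: real
  assumes "x \<ge> 0" "p > 0"
  shows "(x ^ p) powr a = x powr (real p * a)"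
  using assms by (cases "x = 0") (simp_all add: powr_powr flip: powr_realpow)

lemma power_powr_root:
  fixes x :: real
  assumes "x \<ge> 0" "p > 0"
  shows "x = (x ^ p) powr (1 / real p)"
  using assms by (simp add: power_powr_frac)

lemma Young_le:
  fixes a :: real
  assumes "0 \<le> a" "0 \<le> b" "0 < t" "t < 1"
  shows "a powr t * b powr (1 - t) \<le> t * a + (1 - t) * b"
  using Youngs_inequality_0[of t "1 - t" a b] assms by (cases "a = 0 \<or> b = 0") auto

text \<open>Young's inequality with weights \<open>p / (p + q)\<close> and
  \<open>q / (p + q)\<close>, applied termwise after dividing \<open>u\<close> and \<open>v\<close>
  by their totals; the right-hand sides then add up to 1. Stating it with integer powers keeps roots
  out of the later applications.\<close>

lemma Holder_sum:
  fixes u v w :: "'a \<Rightarrow> real"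
  assumes fin: "finite S"
    and nn: "\<And>i. i \<in> S \<Longrightarrow> 0 \<le> u i" "\<And>i. i \<in> S \<Longrightarrow> 0 \<le> v i" "\<And>i. i \<in> S \<Longrightarrow> 0 \<le> w i"
    and le: "\<And>i. i \<in> S \<Longrightarrow> w i ^ (p + q) \<le> u i ^ p * v i ^ q"
    and pq: "p > 0" "q > 0"
  shows "(\<Sum>i\<in>S. w i) ^ (p + q) \<le> (\<Sum>i\<in>S. u i) ^ p * (\<Sum>i\<in>S. v i) ^ q"
proof -
  let ?U = "\<Sum>i\<in>S. u i" and ?V = "\<Sum>i\<in>S. v i"
  have UV: "?U \<ge> 0" "?V \<ge> 0" using nn by (auto intro: sum_nonneg)
  show ?thesis
  proof (cases "?U = 0 \<or> ?V = 0")
    case True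
    have "w i = 0" if "i \<in> S" for i
    proof -
      have "u i = 0 \<or> v i = 0" using True that nn fin by (auto simp: sum_nonneg_eq_0_iff)
      hence "w i ^ (p + q) \<le> 0" using le[OF that] pq by (auto simp: zero_power)
      thus ?thesis using nn(3)[OF that] pq
        by (metis add_pos_pos order_antisym power_eq_0_iff zero_le_power)
    qed
    thus ?thesis using UV pq by (simp add: zero_power)
  next
    case False
    hence U: "?U > 0" and V: "?V > 0" using UV by auto
    let ?t = "real p / real (p + q)"
    have t: "0 < ?t" "?t < 1" "1 - ?t = real q / real (p + q)" using pq by (auto simp: field_simps)
    have *: "w i \<le> (?U powr ?t * ?V powr (1 - ?t)) * (?t * (u i / ?U) + (1 - ?t) * (v i / ?V))"
      if i: "i \<in> S" for i
    proof -
      have "w i = (w i ^ (p + q)) powr (1 / real (p + q))"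
        using nn(3)[OF i] pq by (intro power_powr_root) auto
      also have "\<dots> \<le> (u i ^ p * v i ^ q) powr (1 / real (p + q))"
        using le[OF i] nn[OF i] by (intro powr_mono2) auto
      also have "\<dots> = u i powr ?t * v i powr (1 - ?t)"
        using nn[OF i] pq by (simp add: powr_mult t(3) power_powr_frac del: of_nat_add)
      also have "\<dots> = (?U powr ?t * ?V powr (1 - ?t)) * ((u i / ?U) powr ?t * (v i / ?V) powr (1 - ?t))"
        using U V nn[OF i] by (simp add: powr_divide)
      also have "\<dots> \<le> (?U powr ?t * ?V powr (1 - ?t)) * (?t * (u i / ?U) + (1 - ?t) * (v i / ?V))"
        using U V nn[OF i] t by (intro mult_left_mono Young_le) auto
      finally show ?thesis .
    qed
    have "(\<Sum>i\<in>S. w i) \<le> (\<Sum>i\<in>S. (?U powr ?t * ?V powr (1 - ?t)) * (?t * (u i / ?U) + (1 - ?t) * (v i / ?V)))"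
      using * by (intro sum_mono) auto
    also have "\<dots> = ?U powr ?t * ?V powr (1 - ?t)"
      using U V t by (simp add: sum.distrib flip: sum_distrib_left sum_divide_distrib)
    finally have "(\<Sum>i\<in>S. w i) ^ (p + q) \<le> (?U powr ?t * ?V powr (1 - ?t)) ^ (p + q)"
      using nn by (intro power_mono sum_nonneg) auto
    also have "\<dots> = ?U ^ p * ?V ^ q"
      using U V pq unfolding t(3) power_mult_distrib
      by (simp add: powr_powr flip: powr_realpow del: of_nat_add)
    finally show ?thesis .
  qed
qed


section \<open>Exponential sums on cells\<close>

text \<open>\<open>\<xi> x\<close> plays the part of the character attached to the point
  \<open>x\<close>, but it is an arbitrary function of an index \<open>\<omega>\<close>. In the
  application it is a root of unity depending on \<open>x\<close> and
  \<open>\<omega>\<close>.\<close>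

definition expsum :: "(real \<Rightarrow> nat \<Rightarrow> complex) \<Rightarrow> real set \<Rightarrow> nat \<Rightarrow> complex" where
  "expsum \<xi> B \<omega> = (\<Sum>x\<in>B. \<xi> x \<omega>)"

definition moment :: "nat set \<Rightarrow> (nat \<Rightarrow> real) \<Rightarrow> nat \<Rightarrow> (nat \<Rightarrow> complex) \<Rightarrow> real" where
  "moment \<Omega> h n F = (\<Sum>\<omega>\<in>\<Omega>. h \<omega> * cmod (F \<omega>) ^ (2 * n))"

text \<open>\<open>sqnorm\<close> is the square of the weighted norm with exponent \<open>2n\<close>, so that square-function
  decoupling is linear in it.\<close>

definition sqnorm :: "nat set \<Rightarrow> (nat \<Rightarrow> real) \<Rightarrow> nat \<Rightarrow> (nat \<Rightarrow> complex) \<Rightarrow> real" where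
  "sqnorm \<Omega> h n F = moment \<Omega> h n F powr (1 / real n)"

definition idx :: "nat \<Rightarrow> nat \<Rightarrow> real \<Rightarrow> int" where
  "idx M t x = \<lfloor>x * real M ^ t\<rfloor>"

definition cell :: "nat \<Rightarrow> nat \<Rightarrow> real set \<Rightarrow> int \<Rightarrow> real set" where
  "cell M t A i = {x \<in> A. idx M t x = i}"

text \<open>The right-hand side of l^2 decoupling at scale \<open>M^(-t)\<close>. It is additive
  over coarser cells, which lets a bound for each cell be summed to a bound for the whole
  set.\<close>

definition cellsum :: "nat set \<Rightarrow> (nat \<Rightarrow> real) \<Rightarrow> nat \<Rightarrow> (real \<Rightarrow> nat \<Rightarrow> complex) \<Rightarrow>
    nat \<Rightarrow> nat \<Rightarrow> real set \<Rightarrow> real" where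
  "cellsum \<Omega> h n \<xi> M t A = (\<Sum>i\<in>idx M t ` A. sqnorm \<Omega> h n (expsum \<xi> (cell M t A i)))"

lemma sqnorm_nonneg [simp]: "0 \<le> sqnorm \<Omega> h n F"
  by (simp add: sqnorm_def)

lemma cellsum_nonneg [simp]: "0 \<le> cellsum \<Omega> h n \<xi> M t A"
  by (simp add: cellsum_def sum_nonneg)

lemma moment_nonneg: "(\<And>\<omega>. \<omega> \<in> \<Omega> \<Longrightarrow> 0 \<le> h \<omega>) \<Longrightarrow> 0 \<le> moment \<Omega> h n F"
  by (auto simp: moment_def intro!: sum_nonneg)

lemma sqnorm_power:
  assumes "\<And>\<omega>. \<omega> \<in> \<Omega> \<Longrightarrow> 0 \<le> h \<omega>" "n > 0"
  shows "sqnorm \<Omega> h n F ^ n = moment \<Omega> h n F"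
proof -
  have "moment \<Omega> h n F \<ge> 0" by (rule moment_nonneg) fact
  thus ?thesis using assms(2)
    by (cases "moment \<Omega> h n F = 0") (simp_all add: sqnorm_def powr_powr flip: powr_realpow)
qed

lemma sqnorm_le:
  assumes "\<And>\<omega>. \<omega> \<in> \<Omega> \<Longrightarrow> 0 \<le> h \<omega>" "n > 0" "moment \<Omega> h n F \<le> X ^ n" "X \<ge> 0"
  shows "sqnorm \<Omega> h n F \<le> X"
  using assms by (metis sqnorm_power power_mono_iff sqnorm_nonneg)

text \<open>The trivial decoupling bound. Over all scales at once it yields the exponent 2 from
  which the bootstrap starts; over a bounded number of scales it costs only a constant depending on
  \<open>M\<close>.\<close>

lemma sqnorm_sum_le:
  assumes h: "\<And>\<omega>. \<omega> \<in> \<Omega> \<Longrightarrow> 0 \<le> h \<omega>" and n: "n > 0" and S: "finite S"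
  shows "sqnorm \<Omega> h n (\<lambda>\<omega>. \<Sum>i\<in>S. F i \<omega>) \<le> real (card S) ^ 2 * (\<Sum>i\<in>S. sqnorm \<Omega> h n (F i))"
proof (rule sqnorm_le[OF h n])
  have "moment \<Omega> h n (\<lambda>\<omega>. \<Sum>i\<in>S. F i \<omega>)
      \<le> (\<Sum>\<omega>\<in>\<Omega>. h \<omega> * (real (card S) ^ (2 * n) * (\<Sum>i\<in>S. cmod (F i \<omega>) ^ (2 * n))))"
    unfolding moment_def
  proof (intro sum_mono mult_left_mono h)
    fix \<omega>
    have "cmod (\<Sum>i\<in>S. F i \<omega>) ^ (2 * n) \<le> (\<Sum>i\<in>S. cmod (F i \<omega>)) ^ (2 * n)"
      by (intro power_mono norm_sum) auto
    also have "\<dots> \<le> real (card S) ^ (2 * n) * (\<Sum>i\<in>S. cmod (F i \<omega>) ^ (2 * n))"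
      using S n by (intro power_sum_le_card) auto
    finally show "cmod (\<Sum>i\<in>S. F i \<omega>) ^ (2 * n) \<le> \<dots>" .
  qed
  also have "\<dots> = real (card S) ^ (2 * n) * (\<Sum>i\<in>S. moment \<Omega> h n (F i))"
    unfolding moment_def by (subst sum.swap) (simp add: sum_distrib_left mult_ac)
  also have "\<dots> = real (card S) ^ (2 * n) * (\<Sum>i\<in>S. sqnorm \<Omega> h n (F i) ^ n)"
    using h n by (simp add: sqnorm_power)
  also have "\<dots> \<le> real (card S) ^ (2 * n) * (\<Sum>i\<in>S. sqnorm \<Omega> h n (F i)) ^ n"
    using S n by (intro mult_left_mono sum_power_le_power_sum) auto
  also have "\<dots> = (real (card S) ^ 2 * (\<Sum>i\<in>S. sqnorm \<Omega> h n (F i))) ^ n"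
    by (simp add: power_mult_distrib power_mult)
  finally show "moment \<Omega> h n (\<lambda>\<omega>. \<Sum>i\<in>S. F i \<omega>) \<le> \<dots>" .
qed (auto intro!: mult_nonneg_nonneg sum_nonneg)

text \<open>Passing to the ancestor of an M-adic interval is integer division of its index. All
  nesting of cells is derived from this.\<close>

lemma idx_div:
  assumes "M > 0"
  shows "idx M t x = idx M (t + s) x div int M ^ s"
proof -
  have "idx M (t + s) x div int (M ^ s) = \<lfloor>(x * real M ^ (t + s)) / real_of_int (int (M ^ s))\<rfloor>"
    unfolding idx_def by (subst floor_divide_real_eq_div) auto
  also have "(x * real M ^ (t + s)) / real_of_int (int (M ^ s)) = x * real M ^ t"
    using assms by (simp add: power_add)
  finally show ?thesis by (simp add: idx_def)
qed

lemma idx_mono_eq: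
  assumes "M > 0" "t \<le> s" "idx M s x = idx M s y"
  shows "idx M t x = idx M t y"
  using idx_div[OF assms(1), of t x "s - t"] idx_div[OF assms(1), of t y "s - t"] assms by simp

lemma idx_0_eq [simp]: "M > 0 \<Longrightarrow> x \<in> {0..<1} \<Longrightarrow> idx M 0 x = 0"
  by (auto simp: idx_def floor_eq_iff)

lemma idx_bounds:
  assumes "M > 0" "x \<in> {0..<1}"
  shows "0 \<le> idx M t x" "idx M t x < int M ^ t"
proof -
  show "0 \<le> idx M t x" using assms by (simp add: idx_def)
  have "x * real M ^ t < real M ^ t" using assms by simp
  thus "idx M t x < int M ^ t" unfolding idx_def by (simp add: floor_less_iff)
qed

lemma idx_iff: 
  assumes "M > 0"
  shows "idx M t x = i \<longleftrightarrow> of_int i / real M ^ t \<le> x \<and> x < (of_int i + 1) / real M ^ t"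
  using assms by (auto simp: idx_def floor_eq_iff field_simps)

lemma card_cell_idx_le:
  assumes "M > 0" "finite A"
  shows "card (idx M (t + s) ` cell M t A i) \<le> M ^ s"
proof -
  have "idx M (t + s) ` cell M t A i \<subseteq> {i * int M ^ s..<i * int M ^ s + int M ^ s}"
  proof
    fix j assume "j \<in> idx M (t + s) ` cell M t A i"
    then obtain x where x: "j = idx M (t + s) x" "idx M t x = i" by (auto simp: cell_def)
    hence "i = j div int M ^ s" using idx_div[OF assms(1), of t x s] by (simp add: mult.commute)
    hence "j = i * int M ^ s + j mod int M ^ s" by (simp add: div_mult_mod_eq)
    moreover have "0 \<le> j mod int M ^ s" "j mod int M ^ s < int M ^ s" using assms by simp_all
    ultimately show "j \<in> {i * int M ^ s..<i * int M ^ s + int M ^ s}"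
      unfolding atLeastLessThan_iff by linarith
  qed
  from card_mono[OF _ this] have "card (idx M (t + s) ` cell M t A i) \<le> nat (int (M ^ s))"
    by simp
  thus ?thesis by (simp only: nat_int)
qed

lemma cell_cell:
  assumes "M > 0" "t \<le> s" "x \<in> A"
  shows "cell M s (cell M t A (idx M t x)) (idx M s x) = cell M s A (idx M s x)"
  unfolding cell_def using idx_mono_eq[OF assms(1,2), of _ x] assms(3) by blast

lemma sum_idx_refine:
  assumes "M > 0" "t \<le> s" "finite A"
  shows "(\<Sum>i\<in>idx M s ` A. G (cell M s A i))
       = (\<Sum>i\<in>idx M t ` A. \<Sum>j\<in>idx M s ` cell M t A i. G (cell M s (cell M t A i) j))"
proof -
  let ?\<pi> = "\<lambda>j. j div int M ^ (s - t)"
  have pi: "idx M t x = ?\<pi> (idx M s x)" for x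
    using idx_div[OF assms(1), of t x "s - t"] assms(2) by simp
  have "(\<Sum>i\<in>idx M s ` A. G (cell M s A i))
      = (\<Sum>i\<in>?\<pi> ` idx M s ` A. \<Sum>j\<in>{j \<in> idx M s ` A. ?\<pi> j = i}. G (cell M s A j))"
    using assms(3) by (intro sum.image_gen) auto
  also have "?\<pi> ` idx M s ` A = idx M t ` A" by (auto simp: pi image_image)
  also have "(\<Sum>i\<in>idx M t ` A. \<Sum>j\<in>{j \<in> idx M s ` A. ?\<pi> j = i}. G (cell M s A j))
     = (\<Sum>i\<in>idx M t ` A. \<Sum>j\<in>idx M s ` cell M t A i. G (cell M s (cell M t A i) j))"
  proof (intro sum.cong refl)
    fix i assume "i \<in> idx M t ` A"
    show "{j \<in> idx M s ` A. ?\<pi> j = i} = idx M s ` cell M t A i"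
      by (auto simp: cell_def pi)
    fix j assume "j \<in> idx M s ` cell M t A i"
    then obtain x where "x \<in> A" "idx M t x = i" "j = idx M s x" by (auto simp: cell_def)
    thus "G (cell M s A j) = G (cell M s (cell M t A i) j)"
      using cell_cell[OF assms(1,2), of x A] by simp
  qed
  finally show ?thesis .
qed

lemma cellsum_refine:
  assumes "M > 0" "t \<le> s" "finite A"
  shows "cellsum \<Omega> h n \<xi> M s A = (\<Sum>i\<in>idx M t ` A. cellsum \<Omega> h n \<xi> M s (cell M t A i))"
  unfolding cellsum_def by (rule sum_idx_refine[OF assms])

lemma expsum_cells:
  assumes "finite A"
  shows "expsum \<xi> A = (\<lambda>\<omega>. \<Sum>i\<in>idx M t ` A. expsum \<xi> (cell M t A i) \<omega>)"
  unfolding expsum_def cell_def using sum.image_gen[OF assms] by blast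

lemma finite_cell [simp]: "finite A \<Longrightarrow> finite (cell M t A i)"
  by (simp add: cell_def)

lemma cell_subset: "cell M t A i \<subseteq> A"
  by (auto simp: cell_def)

lemma cell_self:
  "cell M t (cell M t A i) i = cell M t A i"
  by (auto simp: cell_def)

lemma cellsum_cell_le:
  assumes "M > 0" "t \<le> s" "finite A" "i \<in> idx M t ` A"
  shows "cellsum \<Omega> h n \<xi> M s (cell M t A i) \<le> cellsum \<Omega> h n \<xi> M s A"
  unfolding cellsum_refine[OF assms(1-3), of \<Omega> h n \<xi>]
  using assms by (intro member_le_sum) auto

lemma cellsum_coarse_le:
  assumes h: "\<And>\<omega>. \<omega> \<in> \<Omega> \<Longrightarrow> 0 \<le> h \<omega>" and "n > 0" "M > 0" "finite A"
  shows "cellsum \<Omega> h n \<xi> M t A \<le> real M ^ (2 * s) * cellsum \<Omega> h n \<xi> M (t + s) A"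
proof -
  have "cellsum \<Omega> h n \<xi> M t A = (\<Sum>i\<in>idx M t ` A. sqnorm \<Omega> h n (expsum \<xi> (cell M t A i)))"
    by (simp add: cellsum_def)
  also have "\<dots> \<le> (\<Sum>i\<in>idx M t ` A. real M ^ (2 * s) * cellsum \<Omega> h n \<xi> M (t + s) (cell M t A i))"
  proof (rule sum_mono)
    fix i
    let ?B = "cell M t A i"
    have "sqnorm \<Omega> h n (expsum \<xi> ?B)
      \<le> real (card (idx M (t + s) ` ?B)) ^ 2 * cellsum \<Omega> h n \<xi> M (t + s) ?B"
      unfolding cellsum_def using assms
      by (subst expsum_cells[where M = M and t = "t + s"]) (auto intro!: sqnorm_sum_le)
    also have "\<dots> \<le> real (M ^ s) ^ 2 * cellsum \<Omega> h n \<xi> M (t + s) ?B"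
      using card_cell_idx_le[OF assms(3,4), of t s i]
      by (intro mult_right_mono power_mono) (auto simp del: of_nat_power)
    finally show "sqnorm \<Omega> h n (expsum \<xi> ?B) \<le> real M ^ (2 * s) * cellsum \<Omega> h n \<xi> M (t + s) ?B"
      by (simp add: power_mult mult.commute[of 2])
  qed
  also have "\<dots> = real M ^ (2 * s) * cellsum \<Omega> h n \<xi> M (t + s) A"
    using cellsum_refine[of M t "t + s" A \<Omega> h n \<xi>] assms by (simp add: sum_distrib_left)
  finally show ?thesis .
qed

lemma cellsum_0:
  assumes "M > 0" "A \<subseteq> {0..<1}" "n > 0"
  shows "cellsum \<Omega> h n \<xi> M 0 A = sqnorm \<Omega> h n (expsum \<xi> A)"
proof (cases "A = {}")
  case True thus ?thesis using assms by (simp add: cellsum_def expsum_def sqnorm_def moment_def power_0_left)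
next
  case False
  have "idx M 0 x = 0" if "x \<in> A" for x using assms that by auto
  hence "idx M 0 ` A = {0}" "cell M 0 A 0 = A" using False by (auto simp: cell_def)
  thus ?thesis by (simp add: cellsum_def)
qed

section \<open>The decoupling inequality\<close>

definition tri :: "nat \<Rightarrow> nat" where "tri k = k * (k + 1) div 2"

text \<open>For genuine characters and constant weight this is non-zero only if the two words solve
  the system. For a general weight, non-vanishing is the substitute for being an approximate
  solution.\<close>

definition word_corr :: "nat set \<Rightarrow> (nat \<Rightarrow> real) \<Rightarrow> (real \<Rightarrow> nat \<Rightarrow> complex) \<Rightarrow> real list \<Rightarrow> real list \<Rightarrow> complex" where
  "word_corr \<Omega> h \<xi> xs ys =
     (\<Sum>\<omega>\<in>\<Omega>. of_real (h \<omega>) * prod_list (map (\<lambda>x. \<xi> x \<omega>) xs) * cnj (prod_list (map (\<lambda>y. \<xi> y \<omega>) ys)))"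

text \<open>The weight \<open>h\<close> stands for a power of an exponential sum over a short interval, and \<open>limited\<close> says
  that its spectrum lies in a thin slab around the curve with velocity \<open>g(u) (1, u, \<dots>, u^(k-1))\<close>.
  Testing only against monic products with roots in the unit interval makes the condition rescale to
  subintervals without any loss of constants, which the induction over scales cannot afford.\<close>

definition limited :: "nat \<Rightarrow> (real \<Rightarrow> real) \<Rightarrow> real \<Rightarrow> nat set \<Rightarrow> (nat \<Rightarrow> real) \<Rightarrow>
    (real \<Rightarrow> nat \<Rightarrow> complex) \<Rightarrow> real set \<Rightarrow> bool" where
  "limited k g T \<Omega> h \<xi> A \<longleftrightarrow>
     (\<forall>xs\<in>words A (tri k). \<forall>ys\<in>words A (tri k). word_corr \<Omega> h \<xi> xs ys \<noteq> 0 \<longrightarrow>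
       (\<forall>zs \<Phi>. length zs < k \<longrightarrow> set zs \<subseteq> {0..1} \<longrightarrow>
          (\<forall>u. (\<Phi> has_real_derivative g u * prod_list (map (\<lambda>z. u - z) zs)) (at u)) \<longrightarrow>
          \<bar>sum_list (map \<Phi> xs) - sum_list (map \<Phi> ys)\<bar> \<le> T))"

text \<open>\<open>H\<close> is the number of M-adic scales to be decoupled, and
  \<open>M^(-k H)\<close> is the smallest side of a box around an arc of length
  \<open>M^(-H)\<close> on a curve of degree \<open>k\<close>. The density \<open>g\<close> is
  allowed to range up to \<open>\<Lambda>\<close> because each descent to a lower degree multiplies
  it by a factor between 1 and a power of 2.\<close>

definition config :: "nat \<Rightarrow> real \<Rightarrow> nat \<Rightarrow> nat \<Rightarrow> nat set \<Rightarrow> (nat \<Rightarrow> real) \<Rightarrow>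
    (real \<Rightarrow> nat \<Rightarrow> complex) \<Rightarrow> (real \<Rightarrow> real) \<Rightarrow> real set \<Rightarrow> bool" where
  "config k \<Lambda> M H \<Omega> h \<xi> g A \<longleftrightarrow>
     finite \<Omega> \<and> finite A \<and> A \<subseteq> {0..<1} \<and> (\<forall>\<omega>\<in>\<Omega>. 0 \<le> h \<omega>) \<and> (\<forall>u. isCont g u) \<and>
     (\<forall>u\<in>{0..1}. 1 \<le> g u \<and> g u \<le> \<Lambda>) \<and> limited k g (1 / real M ^ (k * H)) \<Omega> h \<xi> A"

lemma word_corr_rescale: "word_corr \<Omega> h (\<lambda>w. \<xi> (f w)) xs ys = word_corr \<Omega> h \<xi> (map f xs) (map f ys)"
  by (simp add: word_corr_def o_def)

text \<open>The exponent is even, so the power of the absolute value is \<open>f^v\<close> times its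
  conjugate and expands into pairs of words. A non-zero correlation for the new weight therefore
  produces a non-zero correlation of longer words for the old one; this is how a condition on words
  of length \<open>tri k\<close> informs about words of length \<open>tri l\<close>.\<close>

lemma word_corr_weight:
  assumes "finite B"
  shows "word_corr \<Omega> (\<lambda>\<omega>. h \<omega> * cmod (expsum \<xi> B \<omega>) ^ (2 * v)) \<xi> xs ys =
    (\<Sum>xs'\<in>words B v. \<Sum>ys'\<in>words B v. word_corr \<Omega> h \<xi> (xs @ xs') (ys @ ys'))"
proof -
  have pw: "expsum \<xi> B \<omega> ^ v = (\<Sum>xs'\<in>words B v. prod_list (map (\<lambda>x. \<xi> x \<omega>) xs'))" for \<omega>
    unfolding expsum_def by (rule power_sum_words)
  have "complex_of_real (cmod (expsum \<xi> B \<omega>) ^ (2 * v)) = expsum \<xi> B \<omega> ^ v * cnj (expsum \<xi> B \<omega> ^ v)" for \<omega>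
    by (simp only: power_mult of_real_power[of "(cmod (expsum \<xi> B \<omega>))\<^sup>2"] complex_norm_square
        power_mult_distrib complex_cnj_power)
  hence eq: "complex_of_real (cmod (expsum \<xi> B \<omega>) ^ (2 * v)) =
     (\<Sum>xs'\<in>words B v. \<Sum>ys'\<in>words B v. prod_list (map (\<lambda>x. \<xi> x \<omega>) xs') *
         cnj (prod_list (map (\<lambda>x. \<xi> x \<omega>) ys')))" for \<omega>
    unfolding pw by (simp add: sum_product)
  have "word_corr \<Omega> (\<lambda>\<omega>. h \<omega> * cmod (expsum \<xi> B \<omega>) ^ (2 * v)) \<xi> xs ys =
    (\<Sum>\<omega>\<in>\<Omega>. \<Sum>xs'\<in>words B v. \<Sum>ys'\<in>words B v. of_real (h \<omega>) *
       prod_list (map (\<lambda>x. \<xi> x \<omega>) (xs @ xs')) * cnj (prod_list (map (\<lambda>y. \<xi> y \<omega>) (ys @ ys'))))"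
    unfolding word_corr_def of_real_mult eq
    by (intro sum.cong refl) (simp add: sum_distrib_left sum_distrib_right mult_ac)
  also have "\<dots> = (\<Sum>xs'\<in>words B v. \<Sum>ys'\<in>words B v. word_corr \<Omega> h \<xi> (xs @ xs') (ys @ ys'))"
    unfolding word_corr_def by (subst sum.swap, intro sum.cong refl, subst sum.swap) auto
  finally show ?thesis .
qed

section \<open>Affine rescaling of configurations\<close>

lemma prod_list_affine:
  fixes R c u :: real
  assumes "R > 0"
  shows "prod_list (map (\<lambda>z. (u * R - c) - z) zs) = R ^ length zs * prod_list (map (\<lambda>z. u - z) (map (\<lambda>z. (z + c) / R) zs))"
  using assms by (induction zs) (simp_all add: field_simps)

text \<open>The roots move with the variable; each linear factor contributes one \<open>R\<close>
  and the chain rule one more. The free scalar \<open>s\<close> lets the caller restore a monic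
  product.\<close>

lemma deriv_rescale:
  fixes R c s :: real
  assumes "R > 0" "\<And>w. (\<Phi> has_real_derivative G w * prod_list (map (\<lambda>z. w - z) zs)) (at w)"
  shows "((\<lambda>u. s * \<Phi> (u * R - c)) has_real_derivative
     (s * R ^ (1 + length zs)) * G (u * R - c) * prod_list (map (\<lambda>z. u - z) (map (\<lambda>z. (z + c) / R) zs))) (at u)"
proof -
  have "((\<lambda>u. \<Phi> (u * R - c)) has_real_derivative
     (G (u * R - c) * prod_list (map (\<lambda>z. (u * R - c) - z) zs)) * R) (at u)"
    by (rule DERIV_chain2[OF assms(2)]) (auto intro!: derivative_eq_intros)
  from DERIV_cmult[OF this, of s] show ?thesis
    unfolding prod_list_affine[OF assms(1)] by (simp add: mult_ac)
qed

context
  fixes M a :: nat and i :: int and aff ffa :: "real \<Rightarrow> real"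
  assumes M: "M > 0"
  defines "aff \<equiv> \<lambda>w. (w + of_int i) / real M ^ a"
    and "ffa \<equiv> \<lambda>x. x * real M ^ a - of_int i"
begin

lemma aff_ffa: "aff (ffa x) = x" "ffa (aff x) = x"
  using M by (simp_all add: aff_def ffa_def)

lemma expsum_rescale: "expsum (\<lambda>w. \<xi> (aff w)) (ffa ` B) = expsum \<xi> B"
proof -
  have "inj_on ffa B" by (metis aff_ffa(1) inj_onI)
  thus ?thesis by (auto simp: expsum_def sum.reindex aff_ffa fun_eq_iff)
qed

lemma idx_rescale: "idx M t (ffa x) = idx M (a + t) x - i * int M ^ t"
proof -
  have "ffa x * real M ^ t = x * real M ^ (a + t) - of_int (i * int M ^ t)"
    by (simp add: ffa_def power_add algebra_simps)
  thus ?thesis unfolding idx_def by (metis floor_diff_of_int)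
qed

lemma cell_rescale: "cell M t (ffa ` B) (j - i * int M ^ t) = ffa ` cell M (a + t) B j"
  by (auto simp: cell_def idx_rescale)

lemma cellsum_rescale: "cellsum \<Omega> h n (\<lambda>w. \<xi> (aff w)) M t (ffa ` B) = cellsum \<Omega> h n \<xi> M (a + t) B"
proof -
  have "idx M t ` ffa ` B = (\<lambda>j. j - i * int M ^ t) ` idx M (a + t) ` B"
    by (simp add: image_image idx_rescale)
  thus ?thesis
    unfolding cellsum_def by (simp add: sum.reindex inj_on_def cell_rescale expsum_rescale)
qed

lemma ffa_cell: "ffa ` cell M a A i \<subseteq> {0..<1}"
  using M by (auto simp: cell_def idx_def ffa_def floor_eq_iff)

lemma aff_unit_interval:
  assumes "0 \<le> i" "i < int M ^ a" "w \<in> {0..1}"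
  shows "aff w \<in> {0..1}"
proof -
  have "of_int i + 1 \<le> (of_int (int M ^ a) :: real)"
    using assms(2) by linarith
  hence "of_int i + 1 \<le> real M ^ a" by simp
  moreover have "0 \<le> (of_int i :: real)" using assms(1) by simp
  ultimately show ?thesis using assms(3) M by (simp add: aff_def divide_le_eq)
qed

lemma words_aff:
  assumes "xs \<in> words (ffa ` B) n"
  shows "map aff xs \<in> words B n"
  using assms aff_ffa by (auto simp: words_def)

text \<open>Pulling a test potential back to the cell changes its size by \<open>R\<close> to the
  power \<open>1 + length zs\<close>, which is at most \<open>R^k = M^(k a)\<close>. This is exactly
  the ratio of the two tolerances, so neither \<open>\<Lambda>\<close> nor any constant deteriorates
  and the step can be repeated at every scale.\<close>

lemma config_rescale:
  assumes c: "config k \<Lambda> M (a + H') \<Omega> h \<xi> g A" and i: "0 \<le> i" "i < int M ^ a"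
  shows "config k \<Lambda> M H' \<Omega> h (\<lambda>w. \<xi> (aff w)) (\<lambda>w. g (aff w)) (ffa ` cell M a A i)"
  unfolding config_def
proof (intro conjI)
  let ?B = "cell M a A i" and ?R = "real M ^ a"
  show "finite \<Omega>" "\<forall>\<omega>\<in>\<Omega>. 0 \<le> h \<omega>" "finite (ffa ` ?B)" "ffa ` ?B \<subseteq> {0..<1}"
    using c ffa_cell unfolding config_def by auto
  have g: "isCont g u" for u using c by (simp add: config_def)
  have "isCont aff u" for u using M by (auto simp: aff_def intro!: continuous_intros)
  thus "\<forall>u. isCont (\<lambda>w. g (aff w)) u" using isCont_o2[OF _ g] by blast
  show "\<forall>u\<in>{0..1}. 1 \<le> g (aff u) \<and> g (aff u) \<le> \<Lambda>"
    using c aff_unit_interval[OF i] unfolding config_def by blast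
  have R: "?R > 0" "?R \<ge> 1" using M by auto
  show "limited k (\<lambda>w. g (aff w)) (1 / real M ^ (k * H')) \<Omega> h (\<lambda>w. \<xi> (aff w)) (ffa ` ?B)"
    unfolding limited_def
  proof (intro ballI impI allI)
    fix xs ys zs \<Phi>
    assume xs: "xs \<in> words (ffa ` ?B) (tri k)" and ys: "ys \<in> words (ffa ` ?B) (tri k)"
      and nz: "word_corr \<Omega> h (\<lambda>w. \<xi> (aff w)) xs ys \<noteq> 0"
      and zs: "length zs < k" "set zs \<subseteq> {0..1}"
      and \<Phi>: "\<forall>u. (\<Phi> has_real_derivative g (aff u) * prod_list (map (\<lambda>z. u - z) zs)) (at u)"
    \<comment> \<open>Cancels the power of \<open>R\<close> from the change of variables, so that
      the pulled back derivative is again \<open>g\<close> times a monic product.\<close>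
    define s where "s = 1 / ?R ^ (1 + length zs)"
    have s0: "s > 0" using M by (simp add: s_def)
    have "\<bar>sum_list (map (\<lambda>u. s * \<Phi> (ffa u)) (map aff xs)) - sum_list (map (\<lambda>u. s * \<Phi> (ffa u)) (map aff ys))\<bar>
       \<le> 1 / real M ^ (k * (a + H'))"
    proof -
      have lim: "limited k g (1 / real M ^ (k * (a + H'))) \<Omega> h \<xi> A"
        using c by (simp add: config_def)
      have w: "map aff xs \<in> words A (tri k)" "map aff ys \<in> words A (tri k)"
        using words_aff[OF xs] words_aff[OF ys] words_mono[OF cell_subset] by blast+
      have d: "((\<lambda>u. s * \<Phi> (ffa u)) has_real_derivative g u * prod_list (map (\<lambda>z. u - z) (map aff zs))) (at u)" for u
      proof -
        have "s * ?R ^ (1 + length zs) = 1" using M by (simp add: s_def)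
        with deriv_rescale[of ?R \<Phi> "\<lambda>w. g (aff w)" zs s "of_int i" u] \<Phi> R aff_ffa(1)[of u]
        show ?thesis by (simp add: ffa_def aff_def)
      qed
      have "set (map aff zs) \<subseteq> {0..1}" using zs(2) aff_unit_interval[OF i] by auto
      thus ?thesis using lim w nz d zs(1) unfolding limited_def word_corr_rescale
        by (metis (no_types, lifting) length_map)
    qed
    moreover have "sum_list (map (\<lambda>u. s * \<Phi> (ffa u)) (map aff xs)) = s * sum_list (map \<Phi> xs)" for xs
      by (induction xs) (simp_all add: aff_ffa distrib_left)
    ultimately have "s * \<bar>sum_list (map \<Phi> xs) - sum_list (map \<Phi> ys)\<bar> \<le> 1 / real M ^ (k * (a + H'))"
      using s0 by (simp add: abs_mult del: map_map flip: right_diff_distrib)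
    hence "\<bar>sum_list (map \<Phi> xs) - sum_list (map \<Phi> ys)\<bar> \<le> ?R ^ (1 + length zs) * (1 / real M ^ (k * (a + H')))"
      using R unfolding s_def by (simp add: field_simps)
    also have "\<dots> \<le> ?R ^ k * (1 / real M ^ (k * (a + H')))"
      using R zs(1) by (intro mult_right_mono power_increasing) auto
    also have "\<dots> = 1 / real M ^ (k * H')"
      using M by (simp add: field_simps power_add algebra_simps flip: power_mult)
    finally show "\<bar>sum_list (map \<Phi> xs) - sum_list (map \<Phi> ys)\<bar> \<le> 1 / real M ^ (k * H')" .
  qed
qed

end

section \<open>Lowering the degree on a distant interval\<close>

lemma sum_list_diff_bound:
  fixes \<Phi> :: "real \<Rightarrow> real"
  assumes "length xs = length ys" "\<And>x y. x \<in> set xs \<Longrightarrow> y \<in> set ys \<Longrightarrow> \<bar>\<Phi> x - \<Phi> y\<bar> \<le> \<beta>"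
  shows "\<bar>sum_list (map \<Phi> xs) - sum_list (map \<Phi> ys)\<bar> \<le> real (length xs) * \<beta>"
  using assms
proof (induction xs ys rule: list_induct2)
  case (Cons x xs y ys)
  have "\<bar>\<Phi> x - \<Phi> y\<bar> \<le> \<beta>" using Cons.prems by simp
  moreover have "\<bar>sum_list (map \<Phi> xs) - sum_list (map \<Phi> ys)\<bar> \<le> real (length xs) * \<beta>"
    using Cons by simp
  ultimately show ?case by (simp add: algebra_simps)
qed simp

lemma abs_prod_list_le_1:
  fixes u :: real
  assumes "u \<in> {0..1}" "set zs \<subseteq> {0..1}"
  shows "\<bar>prod_list (map (\<lambda>z. u - z) zs)\<bar> \<le> 1"
  using assms(2)
proof (induction zs)
  case (Cons z zs)
  have "\<bar>u - z\<bar> \<le> 1" using assms(1) Cons.prems by (auto simp: abs_le_iff)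
  with Cons show ?case by (auto simp: abs_mult intro!: mult_le_one)
qed simp

lemma cell_in_interval:
  assumes "M > 0" "x \<in> cell M b A i"
  shows "x \<in> {of_int i / real M ^ b..of_int i / real M ^ b + 1 / real M ^ b}"
  using assms by (auto simp: cell_def idx_iff add_divide_distrib)

text \<open>The factor \<open>(u - c)^m\<close> is absorbed into the density \<open>g\<close>: on \<open>I\<close> it varies by a bounded
  ratio only, so the \<open>l\<close>-dimensional problem has the same shape as the original one.\<close>

lemma config_lower:
  fixes M a b :: nat and i i' :: int
  assumes M: "M > 0" and c: "config k \<Lambda> M H \<Omega> h \<xi> g A" and \<Lambda>: "\<Lambda> \<ge> 0"
    and l: "1 \<le> l" "l + m = k"
    and i: "0 \<le> i" "i < int M ^ a" and i': "0 \<le> i'" "i' < int M ^ b"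
    and a: "a \<ge> 1"
    and sep: "of_int i / real M ^ a - of_int i' / real M ^ b \<ge> 1 / real M \<or>
       of_int i' / real M ^ b - (of_int i + 1) / real M ^ a \<ge> 1 / real M"
    and v: "tri l + v = tri k" and Mv: "real M \<ge> 1 + real v * \<Lambda>"
    and b: "b \<le> H" and H': "1 + m + a * l + l * H' \<le> b * (m + 1)"
  obtains G where "config l (2 ^ k * \<Lambda>) M H' \<Omega> (\<lambda>\<omega>. h \<omega> * cmod (expsum \<xi> (cell M b A i') \<omega>) ^ (2 * v))
     (\<lambda>w. \<xi> ((w + of_int i) / real M ^ a)) G ((\<lambda>x. x * real M ^ a - of_int i) ` cell M a A i)"
proof -
  define R where "R = real M ^ a"
  define aff where "aff = (\<lambda>w::real. (w + of_int i) / R)"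
  define ffa where "ffa = (\<lambda>x::real. x * R - of_int i)"
  define c' where "c' = of_int i' / real M ^ b"
  \<comment> \<open>The signed distance from \<open>c'\<close>, the left end of the short interval,
    to the nearer end of the other interval. That interval has length
    \<open>1 / R \<le> 1 / M \<le> |d|\<close>, so \<open>(u - c') / d\<close> stays between 1 and 2
    on it.\<close>
  define d where "d = (if of_int i / R - c' \<ge> 1 / real M then of_int i / R - c'
      else (of_int i + 1) / R - c')"
  define G where "G = (\<lambda>w. g (aff w) * ((aff w - c') / d) ^ m)"
  let ?B = "cell M a A i" and ?B' = "cell M b A i'"
  let ?h' = "\<lambda>\<omega>. h \<omega> * cmod (expsum \<xi> ?B' \<omega>) ^ (2 * v)"
  have M1: "real M \<ge> 1" using M by simp
  have R: "R > 0" "R \<ge> real M" "R \<ge> 1"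
    using M1 a self_le_power[of "real M" a] by (auto simp: R_def)
  have aff01: "aff w \<in> {0..1}" if "w \<in> {0..1}" for w
    using aff_unit_interval[OF M i that] by (simp add: aff_def R_def)
  have af: "aff (ffa x) = x" "ffa (aff x) = x" for x using R by (simp_all add: aff_def ffa_def)
  have "of_int i' + 1 \<le> (of_int (int M ^ b) :: real)" using i'(2) by linarith
  hence "of_int i' + 1 \<le> real M ^ b" by simp
  moreover have "0 \<le> (of_int i' :: real)" using i'(1) by simp
  ultimately have c'01: "0 \<le> c'" "c' + 1 / real M ^ b \<le> 1"
    using M by (simp_all add: c'_def divide_le_eq flip: add_divide_distrib)
  have c'1: "c' \<le> 1" using c'01 M by (smt (verit) divide_nonneg_nonneg of_nat_0_le_iff zero_le_power)
  have RM: "1 / R \<le> 1 / real M" using R M by (intro divide_left_mono) auto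
  have d: "\<bar>d\<bar> \<ge> 1 / real M"
    using sep by (auto simp: d_def c'_def R_def)
  have d0: "d \<noteq> 0" using d M by auto
  have M': "1 / real M > 0" using M by simp
  have ratio: "(aff w - c') / d \<in> {1..2}" if "w \<in> {0..1}" for w
  proof (cases "of_int i / R - c' \<ge> 1 / real M")
    case True
    hence "d = of_int i / R - c'" by (simp add: d_def)
    moreover from this have "d > 0" using True M' by linarith
    ultimately have dd: "d = of_int i / R - c'" "d > 0" by auto
    have "aff w - c' = d + w / R" by (simp add: dd aff_def add_divide_distrib)
    moreover have "w / R \<ge> 0" "w / R \<le> 1 / R" using that R by (auto simp: divide_right_mono)
    ultimately show ?thesis using dd RM True by (auto simp: field_simps)
  next
    case False
    hence dd: "d = (of_int i + 1) / R - c'" "- d \<ge> 1 / real M" 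
      using sep by (auto simp: d_def c'_def R_def)
    have "aff w - c' = d - (1 - w) / R" by (simp add: dd aff_def add_divide_distrib diff_divide_distrib)
    moreover have "(1 - w) / R \<ge> 0" "(1 - w) / R \<le> 1 / R" using that R by (auto simp: divide_right_mono)
    moreover have "- d > 0" using dd(2) M' by linarith
    ultimately obtain q where e: "q \<ge> 0" "q \<le> - d" "- d > 0" "aff w - c' = d - q"
      using dd(2) RM by (metis order_trans)
    have "(d - q) / d = 1 + q / (- d)" using d0 by (simp add: diff_divide_distrib)
    moreover have "q / (- d) \<ge> 0" using e(1,3) by (rule divide_nonneg_pos)
    moreover have "q / (- d) \<le> 1" using e(2,3) by (simp only: divide_le_eq_1_pos)
    ultimately show ?thesis unfolding e(4) by simp
  qed
  have "config l (2 ^ k * \<Lambda>) M H' \<Omega> ?h' (\<lambda>w. \<xi> (aff w)) G (ffa ` ?B)"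
    unfolding config_def
  proof (intro conjI)
    show "finite \<Omega>" using c by (simp add: config_def)
    show "finite (ffa ` ?B)" using c by (simp add: config_def)
    show "ffa ` ?B \<subseteq> {0..<1}" using ffa_cell[OF M, of a i A] by (simp add: ffa_def R_def)
    show "\<forall>\<omega>\<in>\<Omega>. 0 \<le> ?h' \<omega>" using c by (auto simp: config_def)
    have g: "isCont g u" for u using c by (simp add: config_def)
    have caf: "isCont aff u" for u using R by (auto simp: aff_def intro!: continuous_intros)
    have "isCont (\<lambda>w. g (aff w)) u" for u using isCont_o2[OF caf g] .
    thus "\<forall>u. isCont G u" unfolding G_def using d0 caf
      by (auto intro!: continuous_intros)
    show "\<forall>u\<in>{0..1}. 1 \<le> G u \<and> G u \<le> 2 ^ k * \<Lambda>"
    proof (intro ballI)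
      fix u :: real assume u: "u \<in> {0..1}"
      have g: "1 \<le> g (aff u)" "g (aff u) \<le> \<Lambda>"
        using c aff01[OF u] by (auto simp: config_def)
      have r: "1 \<le> ((aff u - c') / d) ^ m" "((aff u - c') / d) ^ m \<le> 2 ^ m"
        using ratio[OF u] by (auto intro!: one_le_power power_mono)
      have "(2::real) ^ m \<le> 2 ^ k" using l by (intro power_increasing) auto
      with r have r2: "((aff u - c') / d) ^ m \<le> 2 ^ k" by linarith
      have "1 * 1 \<le> G u" unfolding G_def using g r by (intro mult_mono) auto
      moreover have "G u \<le> \<Lambda> * 2 ^ k" unfolding G_def using g r r2 \<Lambda> by (intro mult_mono) auto
      ultimately show "1 \<le> G u \<and> G u \<le> 2 ^ k * \<Lambda>" by (simp add: mult.commute)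
    qed
    show "limited l G (1 / real M ^ (l * H')) \<Omega> ?h' (\<lambda>w. \<xi> (aff w)) (ffa ` ?B)"
      unfolding limited_def
    proof (intro ballI impI allI)
      fix xs ys zs \<Phi>
      assume xs: "xs \<in> words (ffa ` ?B) (tri l)" and ys: "ys \<in> words (ffa ` ?B) (tri l)"
        and nz: "word_corr \<Omega> ?h' (\<lambda>w. \<xi> (aff w)) xs ys \<noteq> 0"
        and zs: "length zs < l" "set zs \<subseteq> {0..1}"
        and \<Phi>: "\<forall>u. (\<Phi> has_real_derivative G u * prod_list (map (\<lambda>z. u - z) zs)) (at u)"
      have "map aff us \<in> words A (tri l)" if "us \<in> words (ffa ` ?B) (tri l)" for us
        using that cell_subset[of M a A i] af(1) by (fastforce simp: words_def)
      with xs ys have w: "map aff xs \<in> words A (tri l)" "map aff ys \<in> words A (tri l)" by blast+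
      have finB': "finite ?B'" using c by (simp add: config_def)
      \<comment> \<open>The words over the short interval that complete the given ones to words of
        length \<open>tri k\<close>, where the hypothesis on the original configuration can be
        used.\<close>
      obtain xs' ys' where xs': "xs' \<in> words ?B' v" and ys': "ys' \<in> words ?B' v"
        and nz': "word_corr \<Omega> h \<xi> (map aff xs @ xs') (map aff ys @ ys') \<noteq> 0"
        using nz unfolding word_corr_rescale word_corr_weight[OF finB']
        by (meson sum.not_neutral_contains_not_neutral)
      define s where "s = d ^ m / R ^ (1 + length zs)"
      define \<Psi> where "\<Psi> = (\<lambda>u. s * \<Phi> (ffa u))"
      \<comment> \<open>The \<open>m\<close> additional roots at \<open>c'\<close> make the
        potential nearly constant on the short interval, while on the distant one they are part of
        the density \<open>G\<close>.\<close>
      let ?zs' = "replicate m c' @ map aff zs"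
      have D: "(\<Psi> has_real_derivative g u * prod_list (map (\<lambda>z. u - z) ?zs')) (at u)" for u
      proof -
        have "s * R ^ (1 + length zs) = d ^ m" using R by (simp add: s_def)
        moreover have "((\<lambda>u. s * \<Phi> (u * R - of_int i)) has_real_derivative
           (s * R ^ (1 + length zs)) * G (u * R - of_int i) *
             prod_list (map (\<lambda>z. u - z) (map (\<lambda>z. (z + of_int i) / R) zs))) (at u)"
          using deriv_rescale[of R \<Phi> G zs s "of_int i" u] \<Phi> R by blast
        moreover have "G (u * R - of_int i) = g u * ((u - c') / d) ^ m"
          using af(1)[of u] by (simp add: G_def ffa_def)
        ultimately show ?thesis
          using d0 by (simp add: \<Psi>_def ffa_def aff_def power_divide prod_list_replicate map_replicate_const mult_ac)
      qed
      have zs': "length ?zs' < k" "set ?zs' \<subseteq> {0..1}"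
        using zs l c'01 c'1 aff01 by auto
      have xw: "map aff xs @ xs' \<in> words A (tri k)" "map aff ys @ ys' \<in> words A (tri k)"
        using w xs' ys' words_mono[OF cell_subset, of M b A i' v] append_words v by (metis subsetD)+
      have lim: "limited k g (1 / real M ^ (k * H)) \<Omega> h \<xi> A"
        using c by (simp add: config_def)
      have big: "\<bar>sum_list (map \<Psi> (map aff xs @ xs')) - sum_list (map \<Psi> (map aff ys @ ys'))\<bar> \<le> 1 / real M ^ (k * H)"
        using lim xw nz' zs' D unfolding limited_def by blast
      \<comment> \<open>The oscillation of the potential on the short interval: its derivative is at
        most \<open>\<Lambda> M^(-b m)\<close> there, and the length is
        \<open>M^(-b)\<close>.\<close>
      let ?\<beta> = "\<Lambda> / real M ^ (b * (m + 1))"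
      have small: "\<bar>sum_list (map \<Psi> xs') - sum_list (map \<Psi> ys')\<bar> \<le> real v * ?\<beta>"
      proof -
        have "\<bar>\<Psi> x - \<Psi> y\<bar> \<le> ?\<beta>" if "x \<in> ?B'" "y \<in> ?B'" for x y
        proof -
          let ?I = "{c'..c' + 1 / real M ^ b}"
          have "norm (\<Psi> x - \<Psi> y) \<le> (\<Lambda> * (1 / real M ^ b) ^ m) * norm (x - y)"
          proof (rule field_differentiable_bound[where S = ?I])
            show "convex ?I" by simp
            show "x \<in> ?I" "y \<in> ?I" using that cell_in_interval[OF M] by (auto simp: c'_def)
            fix u assume u: "u \<in> ?I"
            show "(\<Psi> has_field_derivative g u * prod_list (map (\<lambda>z. u - z) ?zs')) (at u within ?I)"
              using D[of u] by (rule has_field_derivative_at_within)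
            have u01: "u \<in> {0..1}" using u c'01 by auto
            have "1 \<le> g u" "g u \<le> \<Lambda>" using c u01 unfolding config_def by blast+
            hence "\<bar>g u\<bar> \<le> \<Lambda>" by simp
            moreover have "\<bar>u - c'\<bar> ^ m \<le> (1 / real M ^ b) ^ m" using u by (intro power_mono) auto
            moreover have "\<bar>prod_list (map (\<lambda>z. u - z) (map aff zs))\<bar> \<le> 1"
              using zs' u01 by (intro abs_prod_list_le_1) auto
            ultimately have "\<bar>g u\<bar> * (\<bar>u - c'\<bar> ^ m * \<bar>prod_list (map (\<lambda>z. u - z) (map aff zs))\<bar>)
                \<le> \<Lambda> * ((1 / real M ^ b) ^ m * 1)"
              using \<Lambda> by (intro mult_mono) auto
            thus "norm (g u * prod_list (map (\<lambda>z. u - z) ?zs')) \<le> \<Lambda> * (1 / real M ^ b) ^ m"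
              by (simp add: abs_mult power_abs prod_list_replicate map_replicate_const)
          qed
          also have "\<dots> \<le> (\<Lambda> * (1 / real M ^ b) ^ m) * (1 / real M ^ b)"
            using that cell_in_interval[OF M, of x b A i'] cell_in_interval[OF M, of y b A i'] \<Lambda>
            by (intro mult_left_mono) (auto simp: abs_le_iff)
          also have "\<dots> = ?\<beta>" using M by (simp add: power_divide power_add power_mult)
          finally show ?thesis by simp
        qed
        hence "\<bar>sum_list (map \<Psi> xs') - sum_list (map \<Psi> ys')\<bar> \<le> real (length xs') * ?\<beta>"
          using xs' ys' by (intro sum_list_diff_bound) (auto simp: words_def)
        thus ?thesis using xs' by (simp add: words_def)
      qed
      have map\<Psi>: "sum_list (map \<Psi> (map aff xs)) = s * sum_list (map \<Phi> xs)" for xs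
        by (induction xs) (simp_all add: \<Psi>_def af distrib_left)
      have "\<bar>s\<bar> * \<bar>sum_list (map \<Phi> xs) - sum_list (map \<Phi> ys)\<bar> \<le> 1 / real M ^ (k * H) + real v * ?\<beta>"
        using big small unfolding map_append sum_list_append map\<Psi>
        by (simp add: right_diff_distrib flip: abs_mult)
      also have "\<dots> \<le> 1 / real M ^ (b * (m + 1)) + real v * ?\<beta>"
      proof -
        have "b * (m + 1) \<le> H * k" using b l by (intro mult_mono) auto
        hence "real M ^ (b * (m + 1)) \<le> real M ^ (k * H)" using M1 by (intro power_increasing) (auto simp: mult.commute)
        thus ?thesis using M by (simp add: divide_left_mono)
      qed
      also have "\<dots> = (1 + real v * \<Lambda>) / real M ^ (b * (m + 1))" by (simp add: add_divide_distrib)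
      \<comment> \<open>This accounts for the \<open>1 + m\<close> in the hypothesis on
        \<open>H'\<close>: one power of \<open>M\<close> pays for the constant
        \<open>1 + v \<Lambda>\<close>, and \<open>m\<close> powers pay for
        \<open>|d|^m \<ge> M^(-m)\<close>.\<close>
      also have "\<dots> \<le> real M / real M ^ (b * (m + 1))" using Mv by (intro divide_right_mono) auto
      also have "\<dots> \<le> real M / real M ^ (1 + m + a * l + l * H')"
        using H' M1 M by (intro divide_left_mono power_increasing) auto
      finally have bnd: "\<bar>s\<bar> * \<bar>sum_list (map \<Phi> xs) - sum_list (map \<Phi> ys)\<bar> \<le> real M / real M ^ (1 + m + a * l + l * H')" .
      have "1 / (real M ^ m * real M ^ (a * l)) \<le> \<bar>s\<bar>"
      proof -
        have "(1 / real M) ^ m \<le> \<bar>d\<bar> ^ m" using d M by (intro power_mono) auto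
        moreover have "R ^ (1 + length zs) \<le> R ^ l" using R zs by (intro power_increasing) auto
        ultimately have "(1 / real M) ^ m / R ^ l \<le> \<bar>d\<bar> ^ m / R ^ (1 + length zs)"
          using R M by (intro frac_le) auto
        thus ?thesis using R M by (simp add: s_def abs_mult power_abs R_def power_divide flip: power_mult)
      qed
      hence "1 / (real M ^ m * real M ^ (a * l)) * \<bar>sum_list (map \<Phi> xs) - sum_list (map \<Phi> ys)\<bar>
         \<le> real M / real M ^ (1 + m + a * l + l * H')"
        using bnd by (meson abs_ge_zero mult_right_mono order_trans)
      thus "\<bar>sum_list (map \<Phi> xs) - sum_list (map \<Phi> ys)\<bar> \<le> 1 / real M ^ (l * H')"
        using M by (simp add: field_simps power_add)
    qed
  qed
  thus ?thesis using that unfolding aff_def ffa_def R_def by blast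
qed

section \<open>Decoupling estimates and the linear case\<close>

text \<open>The base \<open>M\<close> is a parameter and not quantified: \<open>C\<close> may depend
  on it, but is uniform in the number of scales and in the configuration.\<close>

definition decouples :: "nat \<Rightarrow> real \<Rightarrow> nat \<Rightarrow> real \<Rightarrow> real \<Rightarrow> bool" where
  "decouples k \<Lambda> M \<eta> C \<longleftrightarrow> (\<forall>H \<Omega> h \<xi> g A. config k \<Lambda> M H \<Omega> h \<xi> g A \<longrightarrow>
     sqnorm \<Omega> h (tri k) (expsum \<xi> A) \<le> C * real M powr (\<eta> * real H) * cellsum \<Omega> h (tri k) \<xi> M H A)"

lemma decouplesD:
  "decouples k \<Lambda> M \<eta> C \<Longrightarrow> config k \<Lambda> M H \<Omega> h \<xi> g A \<Longrightarrow>
     sqnorm \<Omega> h (tri k) (expsum \<xi> A) \<le> C * real M powr (\<eta> * real H) * cellsum \<Omega> h (tri k) \<xi> M H A"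
  by (auto simp: decouples_def)

lemma tri_0 [simp]: "tri 0 = 0" by (simp add: tri_def)

lemma tri_Suc: "tri (Suc k) = tri k + Suc k"
  unfolding tri_def by simp

lemma tri_1 [simp]: "tri (Suc 0) = 1"
  by (simp add: tri_Suc)

lemma tri_add: "tri (l + m) = tri l + tri m + l * m"
  by (induction m) (simp_all add: tri_Suc)

lemma tri_ge: "k \<le> tri k"
  by (cases k) (simp_all add: tri_Suc)

lemma tri_pos: "k > 0 \<Longrightarrow> tri k > 0"
  using tri_ge[of k] by linarith

lemma tri_mono: "l \<le> k \<Longrightarrow> tri l \<le> tri k"
  using tri_add[of l "k - l"] by simp

lemma config_nonneg: "config k \<Lambda> M H \<Omega> h \<xi> g A \<Longrightarrow> \<omega> \<in> \<Omega> \<Longrightarrow> 0 \<le> h \<omega>"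
  by (simp add: config_def)

lemma config_finite: "config k \<Lambda> M H \<Omega> h \<xi> g A \<Longrightarrow> finite A" "config k \<Lambda> M H \<Omega> h \<xi> g A \<Longrightarrow> finite \<Omega>"
  "config k \<Lambda> M H \<Omega> h \<xi> g A \<Longrightarrow> A \<subseteq> {0..<1}"
  by (simp_all add: config_def)

lemma ex_antideriv:
  fixes g :: "real \<Rightarrow> real"
  assumes "\<And>u. isCont g u"
  obtains \<Phi> where "\<And>u. (\<Phi> has_real_derivative g u) (at u)"
  using einterval_antiderivative[of "- \<infinity>" "\<infinity>" g] assms
  by (auto simp: has_real_derivative_iff_has_vector_derivative)

lemma idx_close:
  assumes "M > 0" "\<bar>x - y\<bar> \<le> 1 / real M ^ H"
  shows "\<bar>idx M H x - idx M H y\<bar> \<le> 1"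
proof -
  have "\<bar>x - y\<bar> * real M ^ H \<le> (1 / real M ^ H) * real M ^ H"
    using assms by (intro mult_right_mono) auto
  hence "\<bar>x * real M ^ H - y * real M ^ H\<bar> \<le> 1"
    using assms(1) by (simp add: abs_mult flip: left_diff_distrib)
  thus ?thesis unfolding idx_def by linarith
qed

text \<open>In degree 1 the norm is a weighted L^2 norm and the estimate is almost orthogonality. An
  antiderivative of \<open>g\<close> does not shrink distances because \<open>g \<ge> 1\<close>, so
  cells that are neither equal nor adjacent have vanishing correlation. The constant 3 counts a cell
  and its two neighbours; nothing is lost per scale.\<close>

lemma decouples_one:
  assumes M: "M > 0"
  shows "decouples 1 \<Lambda> M 0 3"
  unfolding decouples_def
proof (intro allI impI)
  fix H \<Omega> h \<xi> g A assume c: "config 1 \<Lambda> M H \<Omega> h \<xi> g A"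
  let ?I = "idx M H ` A"
  let ?f = "\<lambda>i. expsum \<xi> (cell M H A i)"
  let ?c = "\<lambda>i j. \<Sum>\<omega>\<in>\<Omega>. of_real (h \<omega>) * ?f i \<omega> * cnj (?f j \<omega>)"
  let ?m = "\<lambda>i. moment \<Omega> h 1 (?f i)"
  note fin = config_finite[OF c]
  have finI: "finite ?I" using fin by simp
  obtain \<Phi> where \<Phi>: "\<And>u. (\<Phi> has_real_derivative g u) (at u)"
    using ex_antideriv[of g] c by (auto simp: config_def)
  have far: "?c i j = 0" if "\<bar>i - j\<bar> \<ge> 2" for i j
  proof -
    have "?c i j = (\<Sum>x\<in>cell M H A i. \<Sum>y\<in>cell M H A j. word_corr \<Omega> h \<xi> [x] [y])"
      unfolding expsum_def word_corr_def sum_distrib_left cnj_sum sum_distrib_right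
      by (subst sum.swap, subst (2) sum.swap, subst sum.swap, intro sum.cong refl) (simp add: mult_ac)
    also have "\<dots> = 0"
    proof (intro sum.neutral ballI, rule ccontr)
      fix x y assume x: "x \<in> cell M H A i" and y: "y \<in> cell M H A j" and nz: "word_corr \<Omega> h \<xi> [x] [y] \<noteq> 0"
      have xy: "x \<in> {0..1}" "y \<in> {0..1}" "x \<in> A" "y \<in> A" using fin x y by (auto simp: cell_def)
      have "limited 1 g (1 / real M ^ (1 * H)) \<Omega> h \<xi> A" using c by (simp add: config_def)
      hence "\<bar>sum_list (map \<Phi> [x]) - sum_list (map \<Phi> [y])\<bar> \<le> 1 / real M ^ (1 * H)"
        unfolding limited_def using nz \<Phi> xy by (elim ballE[of _ _ "[x]"] ballE[of _ _ "[y]"])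
          (auto simp: words_def dest: spec[of _ "[]"])
      hence le: "\<bar>\<Phi> x - \<Phi> y\<bar> \<le> 1 / real M ^ H" by simp
      have "\<bar>x - y\<bar> \<le> \<bar>\<Phi> x - \<Phi> y\<bar>" 
      proof -
        have *: "v - u \<le> \<Phi> v - \<Phi> u" if uv: "u < v" "u \<in> {0..1}" "v \<in> {0..1}" for u v
        proof -
          obtain z where z: "z > u" "z < v" "\<Phi> v - \<Phi> u = (v - u) * g z"
            using MVT2[OF uv(1), of \<Phi> g] \<Phi> by blast
          have "g z \<ge> 1" using c z uv by (auto simp: config_def)
          thus ?thesis using z uv by (simp add: mult_le_cancel_left1)
        qed
        show ?thesis using *[of x y] *[of y x] xy by (cases x y rule: linorder_cases) auto
      qed
      with le have "\<bar>x - y\<bar> \<le> 1 / real M ^ H" by simp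
      from idx_close[OF M this] show False using x y that by (simp add: cell_def)
    qed
    finally show ?thesis .
  qed
  have near: "Re (?c i j) \<le> (?m i + ?m j) / 2" for i j
  proof -
    have "Re (?c i j) = (\<Sum>\<omega>\<in>\<Omega>. h \<omega> * Re (?f i \<omega> * cnj (?f j \<omega>)))"
      by (simp add: mult.assoc)
    also have "\<dots> \<le> (\<Sum>\<omega>\<in>\<Omega>. h \<omega> * ((cmod (?f i \<omega>) ^ 2 + cmod (?f j \<omega>) ^ 2) / 2))"
    proof (intro sum_mono mult_left_mono config_nonneg[OF c])
      fix \<omega>
      have "Re (?f i \<omega> * cnj (?f j \<omega>)) \<le> cmod (?f i \<omega>) * cmod (?f j \<omega>)"
        by (metis complex_Re_le_cmod complex_mod_cnj norm_mult)
      also have "\<dots> \<le> (cmod (?f i \<omega>) ^ 2 + cmod (?f j \<omega>) ^ 2) / 2"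
        using sum_squares_bound[of "cmod (?f i \<omega>)" "cmod (?f j \<omega>)"] by simp
      finally show "Re (?f i \<omega> * cnj (?f j \<omega>)) \<le> \<dots>" .
    qed
    also have "\<dots> = (?m i + ?m j) / 2"
      by (simp add: moment_def sum.distrib sum_divide_distrib distrib_left add_divide_distrib)
    finally show ?thesis .
  qed
  have m0: "?m i \<ge> 0" for i using config_nonneg[OF c] by (intro moment_nonneg)
  have "moment \<Omega> h 1 (expsum \<xi> A) = Re (\<Sum>\<omega>\<in>\<Omega>. of_real (h \<omega>) * expsum \<xi> A \<omega> * cnj (expsum \<xi> A \<omega>))"
    by (simp add: moment_def mult.assoc flip: complex_norm_square)
  also have "(\<Sum>\<omega>\<in>\<Omega>. of_real (h \<omega>) * expsum \<xi> A \<omega> * cnj (expsum \<xi> A \<omega>)) = (\<Sum>i\<in>?I. \<Sum>j\<in>?I. ?c i j)"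
    unfolding expsum_cells[OF fin(1), of \<xi> M H] sum_distrib_left cnj_sum sum_distrib_right
    by (subst sum.swap, subst (2) sum.swap, subst sum.swap) (simp add: mult_ac)
  also have "Re \<dots> = (\<Sum>i\<in>?I. \<Sum>j\<in>?I. Re (?c i j))" by simp
  also have "\<dots> \<le> (\<Sum>i\<in>?I. \<Sum>j\<in>?I. if \<bar>i - j\<bar> \<le> 1 then (?m i + ?m j) / 2 else 0)"
  proof (intro sum_mono)
    fix i j
    show "Re (?c i j) \<le> (if \<bar>i - j\<bar> \<le> 1 then (?m i + ?m j) / 2 else 0)"
    proof (cases "\<bar>i - j\<bar> \<le> 1")
      case True thus ?thesis using near[of i j] by (simp only: if_True)
    next
      case False
      hence "?c i j = 0" by (intro far) simp
      hence "Re (?c i j) = 0" by (simp only: zero_complex.sel)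
      thus ?thesis using False by simp
    qed
  qed
  also have "\<dots> = (\<Sum>i\<in>?I. \<Sum>j\<in>?I. if \<bar>i - j\<bar> \<le> 1 then ?m i / 2 else 0)
                + (\<Sum>i\<in>?I. \<Sum>j\<in>?I. if \<bar>i - j\<bar> \<le> 1 then ?m j / 2 else 0)"
    unfolding sum.distrib[symmetric] by (intro sum.cong refl) (simp add: add_divide_distrib)
  also have "(\<Sum>i\<in>?I. \<Sum>j\<in>?I. if \<bar>i - j\<bar> \<le> 1 then ?m j / 2 else 0)
           = (\<Sum>i\<in>?I. \<Sum>j\<in>?I. if \<bar>i - j\<bar> \<le> 1 then ?m i / 2 else 0)"
    by (subst sum.swap) (simp add: abs_minus_commute)
  also have "(\<Sum>i\<in>?I. \<Sum>j\<in>?I. if \<bar>i - j\<bar> \<le> 1 then ?m i / 2 else 0) \<le> (\<Sum>i\<in>?I. 3 * (?m i / 2))"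
  proof (rule sum_mono)
    fix i
    have "(\<Sum>j\<in>?I. if \<bar>i - j\<bar> \<le> 1 then ?m i / 2 else 0) = real (card {j \<in> ?I. \<bar>i - j\<bar> \<le> 1}) * (?m i / 2)"
      using finI by (simp add: sum.If_cases Int_def)
    also have "card {j \<in> ?I. \<bar>i - j\<bar> \<le> 1} \<le> card {i - 1..i + 1}"
      by (intro card_mono) auto
    hence "real (card {j \<in> ?I. \<bar>i - j\<bar> \<le> 1}) * (?m i / 2) \<le> 3 * (?m i / 2)"
      using m0[of i] by (intro mult_right_mono) auto
    finally show "(\<Sum>j\<in>?I. if \<bar>i - j\<bar> \<le> 1 then ?m i / 2 else 0) \<le> 3 * (?m i / 2)" .
  qed
  finally have "moment \<Omega> h 1 (expsum \<xi> A) \<le> 3 * (\<Sum>i\<in>?I. ?m i)"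
    by (simp add: sum_distrib_left flip: sum_divide_distrib)
  thus "sqnorm \<Omega> h (tri 1) (expsum \<xi> A) \<le> 3 * real M powr (0 * real H) * cellsum \<Omega> h (tri 1) \<xi> M H A"
    using M m0 moment_nonneg[OF config_nonneg[OF c], where n = 1 and F = "expsum \<xi> A"] by (simp add: sqnorm_def cellsum_def)
qed

text \<open>A cell at level \<open>a\<close> has only \<open>H - a\<close> scales left, so the
  exponent drops by \<open>\<eta> a\<close> compared with the full range. Every later gain
  originates here.\<close>

lemma decouples_cell:
  assumes "decouples k \<Lambda> M \<eta> C" "config k \<Lambda> M H \<Omega> h \<xi> g A" "M > 0" "a \<le> H" "0 \<le> i" "i < int M ^ a"
  shows "sqnorm \<Omega> h (tri k) (expsum \<xi> (cell M a A i))
     \<le> C * real M powr (\<eta> * real (H - a)) * cellsum \<Omega> h (tri k) \<xi> M H (cell M a A i)"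
proof -
  have "config k \<Lambda> M (a + (H - a)) \<Omega> h \<xi> g A" using assms by simp
  from decouplesD[OF assms(1) config_rescale[OF assms(3) this assms(5,6)]]
  show ?thesis unfolding expsum_rescale[OF assms(3)] cellsum_rescale[OF assms(3)] using assms(4) by simp
qed

text \<open>The quotients are the indices of the ancestors of length \<open>1 / M\<close>. If they
  differ by at least 2, a whole interval of that length lies in between. Expressing separation
  through ancestors makes it pass to subcells automatically.\<close>

lemma separated_cells:
  fixes i i' :: int
  assumes M: "M > 0" and ab: "a \<ge> 1" "b \<ge> 1"
    and sep: "\<bar>i div int M ^ (a - 1) - i' div int M ^ (b - 1)\<bar> \<ge> 2"
  shows "of_int i / real M ^ a - of_int i' / real M ^ b \<ge> 1 / real M \<or>
       of_int i' / real M ^ b - (of_int i + 1) / real M ^ a \<ge> 1 / real M"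
proof -
  have *: "of_int (j div int M ^ (t - 1)) / real M \<le> of_int j / real M ^ t \<and>
      (of_int j + 1) / real M ^ t \<le> (of_int (j div int M ^ (t - 1)) + 1) / real M" if "t \<ge> 1" for j t
  proof -
    define P where "P = int M ^ (t - 1)"
    have P: "P > 0" using M by (simp add: P_def)
    have t: "real M ^ t = real_of_int P * real M" using that M
      by (simp add: P_def flip: power_Suc2)
    have 1: "(j div P) * P \<le> j"
    proof -
      have "j = (j div P) * P + j mod P" by simp
      moreover have "0 \<le> j mod P" using P by simp
      ultimately show ?thesis by linarith
    qed
    have 2: "j + 1 \<le> (j div P + 1) * P"
    proof -
      have "j = (j div P) * P + j mod P" by simp
      moreover have "j mod P < P" using P by simp
      ultimately show ?thesis unfolding distrib_right by linarith
    qed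
    from 1 have 3: "real_of_int (j div P) * real_of_int P \<le> real_of_int j" 
      by (metis of_int_le_iff of_int_mult)
    from 2 have 4: "real_of_int j + 1 \<le> (real_of_int (j div P) + 1) * real_of_int P" 
      by (metis of_int_1 of_int_add of_int_le_iff of_int_mult)
    have e: "x / real M = x * real_of_int P / (real_of_int P * real M)" for x using P by simp
    have "real_of_int (j div P) / real M \<le> of_int j / (real_of_int P * real M)"
      unfolding e[of "real_of_int (j div P)"] using 3 P by (intro divide_right_mono) auto
    moreover have "(real_of_int j + 1) / (real_of_int P * real M) \<le> (real_of_int (j div P) + 1) / real M"
      unfolding e[of "real_of_int (j div P) + 1"] using 4 P by (intro divide_right_mono) auto
    ultimately show ?thesis unfolding P_def[symmetric] t by simp
  qed
  let ?p = "i div int M ^ (a - 1)" and ?q = "i' div int M ^ (b - 1)"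
  have p: "of_int ?p / real M \<le> of_int i / real M ^ a" "(of_int i + 1) / real M ^ a \<le> (of_int ?p + 1) / real M"
    and q: "of_int ?q / real M \<le> of_int i' / real M ^ b" "(of_int i' + 1) / real M ^ b \<le> (of_int ?q + 1) / real M"
    using *[OF ab(1)] *[OF ab(2)] by auto
  have two: "2 / real M = 1 / real M + 1 / real M" by simp
  have lt: "of_int i' / real M ^ b \<le> (of_int i' + 1) / real M ^ b"
    using M by (intro divide_right_mono) auto
  show ?thesis
  proof (cases "?p \<ge> ?q + 2")
    case True
    hence "real_of_int ?p \<ge> real_of_int ?q + 2" by linarith
    hence "(of_int ?q + 2) / real M \<le> of_int ?p / real M" using M by (intro divide_right_mono) auto
    thus ?thesis using p(1) q(2) lt unfolding add_divide_distrib two by linarith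
  next
    case False
    hence "?q \<ge> ?p + 2" using sep by linarith
    hence "real_of_int ?q \<ge> real_of_int ?p + 2" by linarith
    hence "(of_int ?p + 2) / real M \<le> of_int ?q / real M" using M by (intro divide_right_mono) auto
    thus ?thesis using p(2) q(1) unfolding add_divide_distrib two by linarith
  qed
qed

lemma cellsum_cell_self:
  assumes "cell M a A i \<noteq> {}"
  shows "cellsum \<Omega> h n \<xi> M a (cell M a A i) = sqnorm \<Omega> h n (expsum \<xi> (cell M a A i))"
proof -
  have "idx M a ` cell M a A i = {i}" using assms by (auto simp: cell_def)
  thus ?thesis by (simp add: cellsum_def cell_self)
qed

text \<open>The short interval determines the lower system up to \<open>M^(-b (m + 1))\<close>, and
  a system of degree \<open>l\<close> with this tolerance sees scale \<open>nt\<close> where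
  \<open>l nt = (m + 1) b\<close>. The reduction needs \<open>1 + m\<close> spare powers of
  \<open>M\<close>; since \<open>1 + m \<le> l k\<close>, it suffices to stop \<open>k\<close>
  scales early and to treat those trivially, which is the factor \<open>M^(2 k)\<close>.\<close>

lemma sqnorm_lower:
  fixes i i' :: int
  assumes decouples: "decouples l (2 ^ k * \<Lambda>) M \<epsilon> C" and C: "C \<ge> 1" and \<epsilon>: "\<epsilon> \<ge> 0"
    and M: "M > 0" and c: "config k \<Lambda> M H \<Omega> h \<xi> g A" and \<Lambda>: "\<Lambda> \<ge> 0"
    and l: "1 \<le> l" "l + m = k"
    and i: "0 \<le> i" "i < int M ^ a" and i': "0 \<le> i'" "i' < int M ^ b"
    and ab: "a \<ge> 1" "b \<ge> 1" "b \<le> H"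
    and sep: "\<bar>i div int M ^ (a - 1) - i' div int M ^ (b - 1)\<bar> \<ge> 2"
    and v: "tri l + v = tri k" and Mv: "real M \<ge> 1 + real v * \<Lambda>"
    and nt: "l * nt = (m + 1) * b" "a \<le> nt"
  defines "h' \<equiv> \<lambda>\<omega>. h \<omega> * cmod (expsum \<xi> (cell M b A i') \<omega>) ^ (2 * v)"
  shows "sqnorm \<Omega> h' (tri l) (expsum \<xi> (cell M a A i))
     \<le> C * real M ^ (2 * k) * real M powr (\<epsilon> * real nt) * cellsum \<Omega> h' (tri l) \<xi> M nt (cell M a A i)"
proof (cases "cell M a A i = {}")
  case True
  have "expsum \<xi> {} = (\<lambda>_. 0)" by (auto simp: expsum_def)
  moreover have "tri l > 0" using l tri_pos by simp
  ultimately have "sqnorm \<Omega> h' (tri l) (expsum \<xi> {}) = 0" by (simp add: sqnorm_def moment_def power_0_left)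
  thus ?thesis unfolding True using C by (auto intro!: mult_nonneg_nonneg)
next
  case ne: False
  let ?B = "cell M a A i"
  have h': "0 \<le> h' \<omega>" if "\<omega> \<in> \<Omega>" for \<omega> using config_nonneg[OF c that] by (simp add: h'_def)
  have tl: "tri l > 0" using l tri_pos by simp
  have M1: "real M \<ge> 1" using M by simp
  have finB: "finite ?B" using config_finite[OF c] by simp
  let ?D = "cellsum \<Omega> h' (tri l) \<xi> M"
  show ?thesis
  \<comment> \<open>With at most \<open>k\<close> scales to go, the trivial bound alone is
    enough.\<close>
  proof (cases "nt - a \<le> k")
    case True
    have "sqnorm \<Omega> h' (tri l) (expsum \<xi> ?B) = ?D a ?B" using cellsum_cell_self[OF ne] by simp
    also have "\<dots> \<le> real M ^ (2 * (nt - a)) * ?D (a + (nt - a)) ?B"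
      by (rule cellsum_coarse_le[OF h' tl M finB])
    also have "\<dots> \<le> real M ^ (2 * k) * ?D nt ?B"
      using nt M1 True by (intro mult_mono power_increasing) auto
    also have "\<dots> \<le> (C * real M powr (\<epsilon> * real nt)) * (real M ^ (2 * k) * ?D nt ?B)"
    proof -
      have "1 * 1 \<le> C * real M powr (\<epsilon> * real nt)" 
        using C M1 \<epsilon> by (intro mult_mono ge_one_powr_ge_zero) auto
      moreover have "0 \<le> real M ^ (2 * k) * ?D nt ?B" by simp
      ultimately show ?thesis using mult_right_mono by fastforce
    qed
    finally show ?thesis by (simp add: mult_ac)
  next
    case False
    define H' where "H' = nt - a - k"
    have nt_eq: "nt = a + H' + k" using False by (simp add: H'_def)
    have "1 + m + a * l + l * H' \<le> l * nt"
    proof -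
      have "1 + m \<le> l * k" using l by (metis One_nat_def Suc_leI add.commute less_add_same_cancel2 
         le_trans mult_le_mono1 nat_mult_1 add_le_mono1 add_Suc_right plus_1_eq_Suc)
      thus ?thesis unfolding nt_eq by (simp add: distrib_left mult.commute)
    qed
    hence H': "1 + m + a * l + l * H' \<le> b * (m + 1)" using nt(1) by (simp add: mult.commute)
    obtain G where G: "config l (2 ^ k * \<Lambda>) M H' \<Omega> h'
         (\<lambda>w. \<xi> ((w + of_int i) / real M ^ a)) G ((\<lambda>x. x * real M ^ a - of_int i) ` ?B)"
      using config_lower[OF M c \<Lambda> l i i' ab(1) separated_cells[OF M ab(1,2) sep] v Mv ab(3) H'] 
      unfolding h'_def by blast
    have "sqnorm \<Omega> h' (tri l) (expsum \<xi> ?B) \<le> C * real M powr (\<epsilon> * real H') * ?D (a + H') ?B"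
      using decouplesD[OF decouples G] unfolding expsum_rescale[OF M] cellsum_rescale[OF M] .
    also have "\<dots> \<le> C * real M powr (\<epsilon> * real nt) * (real M ^ (2 * k) * ?D (a + H' + k) ?B)"
      using C M1 \<epsilon> by (intro mult_mono powr_mono mult_left_mono cellsum_coarse_le[OF h' tl M finB] 
         mult_nonneg_nonneg) (auto simp: nt_eq)
    finally show ?thesis by (simp add: nt_eq mult_ac)
  qed
qed

section \<open>Mixed moments of two separated intervals\<close>

definition mixed_moment :: "nat set \<Rightarrow> (nat \<Rightarrow> real) \<Rightarrow> (real \<Rightarrow> nat \<Rightarrow> complex) \<Rightarrow> nat \<Rightarrow> nat \<Rightarrow> real set \<Rightarrow> real set \<Rightarrow> real" where
  "mixed_moment \<Omega> h \<xi> p q B B' = (\<Sum>\<omega>\<in>\<Omega>. h \<omega> * cmod (expsum \<xi> B \<omega>) ^ (2 * p) * cmod (expsum \<xi> B' \<omega>) ^ (2 * q))"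

text \<open>The savings coefficient: after \<open>r\<close> rounds the mixed moment with exponents
  \<open>2 tri l\<close>, \<open>2 (tri k - tri l)\<close> at scale \<open>b\<close> is \<open>M^(\<eta> b (gain k r l))\<close> better than the trivial bound.\<close>

fun gain :: "nat \<Rightarrow> nat \<Rightarrow> nat \<Rightarrow> real" where
  "gain k 0 l = (if l = 0 then 1 else 0)"
| "gain k (Suc r) l = (if l = 0 then 1 else
     real (k - l) / real (k - l + 1) * gain k r (l - 1) + gain k r (k - l) / real l)"

lemma gain_0 [simp]: "gain k r 0 = 1"
  by (cases r) auto

text \<open>A conservation law. An index \<open>l > 0\<close> passes the fraction
  \<open>(k - 1 - l) / (k - l)\<close> of its gain to \<open>l + 1\<close> and
  \<open>1 / (k - l)\<close> to \<open>k - l\<close>, and these add up to 1. The index 0 always has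
  gain 1 and injects \<open>(k - 1) / k\<close> in every round, so the total grows linearly.\<close>

lemma sum_gain:
  assumes "k \<ge> 2"
  shows "(\<Sum>l=1..k-1. gain k r l) = real r * (real (k - 1) / real k)"
proof (induction r)
  case (Suc r)
  let ?c = "gain k r"
  obtain k' where k: "k = Suc (Suc k')" using assms by (metis add_2_eq_Suc le_Suc_ex)
  have "(\<Sum>l=1..k-1. gain k (Suc r) l) =
     (\<Sum>l=1..k-1. real (k - l) / real (k - l + 1) * ?c (l - 1)) + (\<Sum>l=1..k-1. ?c (k - l) / real l)"
    by (simp add: sum.distrib)
  also have "(\<Sum>l=1..k-1. ?c (k - l) / real l) = (\<Sum>l=1..k-1. ?c l / real (k - l))"
    by (rule sum.reindex_bij_witness[of _ "\<lambda>l. k - l" "\<lambda>l. k - l"]) auto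
  also have "(\<Sum>l=1..k-1. real (k - l) / real (k - l + 1) * ?c (l - 1))
      = (\<Sum>l=0..k'. real (k - 1 - l) / real (k - l) * ?c l)"
    by (rule sum.reindex_bij_witness[of _ "\<lambda>l. l + 1" "\<lambda>l. l - 1"]) (auto simp: k)
  also have "\<dots> = real (k - 1) / real k + (\<Sum>l=1..k'. real (k - 1 - l) / real (k - l) * ?c l)"
    by (subst sum.atLeast_Suc_atMost) (auto simp: k)
  also have "(\<Sum>l=1..k'. real (k - 1 - l) / real (k - l) * ?c l)
      = (\<Sum>l=1..k-1. real (k - 1 - l) / real (k - l) * ?c l)"
    by (simp add: k)
  also have "real (k - 1) / real k + (\<Sum>l=1..k-1. real (k - 1 - l) / real (k - l) * ?c l) + (\<Sum>l=1..k-1. ?c l / real (k - l))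
     = real (k - 1) / real k + (\<Sum>l=1..k-1. ?c l)"
    unfolding add.assoc sum.distrib[symmetric]
  proof (intro arg_cong2[where f = "(+)"] sum.cong refl)
    fix l assume "l \<in> {1..k - 1}"
    hence y: "real (k - 1 - l) = real (k - l) - 1" "real (k - l) > 0" by auto
    have "(y - 1) / y * c + c / y = c" if "y > 0" for y c :: real
      using that by (simp add: field_simps)
    from this[OF y(2)] show "real (k - 1 - l) / real (k - l) * ?c l + ?c l / real (k - l) = ?c l"
      by (simp only: y(1))
  qed
  also have "\<dots> = real (Suc r) * (real (k - 1) / real k)"
    unfolding Suc by (simp add: algebra_simps add_divide_distrib)
  finally show ?case .
qed simp

lemma gain_large:
  assumes "k \<ge> 2"
  obtains l where "1 \<le> l" "l < k" "gain k r l \<ge> real r / real k"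
proof -
  have "\<exists>l\<in>{1..k-1}. real r / real k \<le> gain k r l"
  proof (rule ccontr)
    assume "\<not> ?thesis"
    hence "(\<Sum>l=1..k-1. gain k r l) < (\<Sum>l=1..k-1. real r / real k)"
      using assms by (intro sum_strict_mono) (auto simp: not_le)
    thus False unfolding sum_gain[OF assms] by (simp add: mult.commute)
  qed
  thus ?thesis using that by force
qed

text \<open>The conditions on \<open>b\<close> leave room for \<open>r\<close> rounds: a round
  replaces \<open>b\<close> by \<open>(k - l + 1) b / l\<close>, which must be an integer and is at
  most \<open>k b\<close>. The inequality between \<open>a\<close> and \<open>b\<close> says that
  the first interval is not yet finer than the scale to which the next round moves it. The term with
  \<open>\<iota>\<close> pays for one lower degree decoupling per round.\<close>

definition mixed_bound :: "nat \<Rightarrow> real \<Rightarrow> nat \<Rightarrow> real \<Rightarrow> real \<Rightarrow> nat \<Rightarrow> real \<Rightarrow> bool" where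
  "mixed_bound k \<Lambda> M \<eta> \<iota> r K \<longleftrightarrow> (\<forall>H \<Omega> h \<xi> g A a b i i' l.
     config k \<Lambda> M H \<Omega> h \<xi> g A \<longrightarrow> l < k \<longrightarrow> 0 \<le> i \<longrightarrow> i < int M ^ a \<longrightarrow> 0 \<le> i' \<longrightarrow> i' < int M ^ b \<longrightarrow>
     1 \<le> a \<longrightarrow> a \<le> H \<longrightarrow> 1 \<le> b \<longrightarrow> b * k ^ r \<le> H \<longrightarrow> fact k ^ r dvd b \<longrightarrow> l * a \<le> (k - l + 1) * b \<longrightarrow>
     \<bar>i div int M ^ (a - 1) - i' div int M ^ (b - 1)\<bar> \<ge> 2 \<longrightarrow>
     mixed_moment \<Omega> h \<xi> (tri l) (tri k - tri l) (cell M a A i) (cell M b A i')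
       \<le> K * real M powr (real (tri k) * (\<eta> * (real H - gain k r l * real b) + \<iota> * real r * real H))
          * cellsum \<Omega> h (tri k) \<xi> M H (cell M a A i) ^ tri l
          * cellsum \<Omega> h (tri k) \<xi> M H (cell M b A i') ^ (tri k - tri l))"

lemma mixed_moment_0: "mixed_moment \<Omega> h \<xi> 0 q B B' = moment \<Omega> h q (expsum \<xi> B')"
  by (simp add: mixed_moment_def moment_def)

lemma mixed_moment_eq_moment: "mixed_moment \<Omega> h \<xi> p q B B' = moment \<Omega> (\<lambda>\<omega>. h \<omega> * cmod (expsum \<xi> B' \<omega>) ^ (2 * q)) p (expsum \<xi> B)"
  by (simp add: mixed_moment_def moment_def mult_ac)

lemma mixed_moment_nonneg:
  assumes "\<And>\<omega>. \<omega> \<in> \<Omega> \<Longrightarrow> 0 \<le> h \<omega>"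
  shows "0 \<le> mixed_moment \<Omega> h \<xi> p q B B'"
  unfolding mixed_moment_def using assms by (intro sum_nonneg mult_nonneg_nonneg) auto

lemma le_if_power_le:
  fixes x y :: real
  shows "x ^ n \<le> y ^ n \<Longrightarrow> 0 \<le> y \<Longrightarrow> n > 0 \<Longrightarrow> x \<le> y"
  by (metis linorder_not_le power_strict_mono)

lemma mixed_moment_le_sqnorm:
  assumes h: "\<And>\<omega>. \<omega> \<in> \<Omega> \<Longrightarrow> 0 \<le> h \<omega>" and \<Omega>: "finite \<Omega>" and pq: "p > 0" "q > 0"
  shows "mixed_moment \<Omega> h \<xi> p q B B' \<le> sqnorm \<Omega> h (p + q) (expsum \<xi> B) ^ p * sqnorm \<Omega> h (p + q) (expsum \<xi> B') ^ q"
proof -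
  have "mixed_moment \<Omega> h \<xi> p q B B' ^ (p + q) \<le> moment \<Omega> h (p + q) (expsum \<xi> B) ^ p * moment \<Omega> h (p + q) (expsum \<xi> B') ^ q"
    unfolding mixed_moment_def moment_def
  proof (rule Holder_sum[OF \<Omega>])
    fix \<omega> assume "\<omega> \<in> \<Omega>"
    show "(h \<omega> * cmod (expsum \<xi> B \<omega>) ^ (2 * p) * cmod (expsum \<xi> B' \<omega>) ^ (2 * q)) ^ (p + q)
      \<le> (h \<omega> * cmod (expsum \<xi> B \<omega>) ^ (2 * (p + q))) ^ p * (h \<omega> * cmod (expsum \<xi> B' \<omega>) ^ (2 * (p + q))) ^ q"
      by (rule eq_refl) (simp add: power_mult_distrib power_add mult_ac flip: power_mult)
  qed (use h pq in auto)
  also have "\<dots> = (sqnorm \<Omega> h (p + q) (expsum \<xi> B) ^ p * sqnorm \<Omega> h (p + q) (expsum \<xi> B') ^ q) ^ (p + q)"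
    using pq by (simp add: sqnorm_power[OF h, symmetric] power_mult_distrib mult.commute flip: power_mult)
  finally show ?thesis
    by (rule le_if_power_le) (use pq in auto)
qed

text \<open>The exponent pair \<open>(tri l, tri k - tri l)\<close> is the mean, with weights
  \<open>m\<close> and 1, of \<open>(tri (l - 1), tri k - tri (l - 1))\<close> and of
  \<open>(tri k - tri m, tri m)\<close>. The second pair belongs to degree \<open>m = k - l\<close>
  with the two intervals exchanged.\<close>

lemma mixed_moment_Holder:
  assumes h: "\<And>\<omega>. \<omega> \<in> \<Omega> \<Longrightarrow> 0 \<le> h \<omega>" and \<Omega>: "finite \<Omega>"
    and l: "1 \<le> l" "1 \<le> m" "l + m = k"
  shows "mixed_moment \<Omega> h \<xi> (tri l) (tri k - tri l) B B' ^ (m + 1)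
    \<le> mixed_moment \<Omega> h \<xi> (tri (l - 1)) (tri k - tri (l - 1)) B B' ^ m * mixed_moment \<Omega> h \<xi> (tri m) (tri k - tri m) B' B ^ 1"
  unfolding mixed_moment_def
proof (rule Holder_sum[OF \<Omega>])
  fix \<omega> assume "\<omega> \<in> \<Omega>"
  let ?x = "cmod (expsum \<xi> B \<omega>) ^ 2" and ?y = "cmod (expsum \<xi> B' \<omega>) ^ 2"
  obtain l' where l': "l = Suc l'" using l by (cases l) auto
  have 1: "tri l * (m + 1) = tri (l - 1) * m + (tri k - tri m)"
    unfolding l(3)[symmetric] tri_add l' by (simp add: tri_Suc algebra_simps)
  have 2: "(tri k - tri l) * (m + 1) = (tri k - tri (l - 1)) * m + tri m"
    unfolding l(3)[symmetric] tri_add l' by (simp add: tri_Suc algebra_simps)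
  have "(h \<omega> * ?x ^ tri l * ?y ^ (tri k - tri l)) ^ (m + 1)
      = h \<omega> ^ (m + 1) * ?x ^ (tri l * (m + 1)) * ?y ^ ((tri k - tri l) * (m + 1))"
    by (simp only: power_mult_distrib power_mult)
  also have "\<dots> = (h \<omega> * ?x ^ tri (l - 1) * ?y ^ (tri k - tri (l - 1))) ^ m * (h \<omega> * ?y ^ tri m * ?x ^ (tri k - tri m)) ^ 1"
    unfolding 1 2 by (simp add: power_add power_mult_distrib mult_ac flip: power_mult)
  finally have eq: "(h \<omega> * ?x ^ tri l * ?y ^ (tri k - tri l)) ^ (m + 1) = \<dots>" .
  show "(h \<omega> * cmod (expsum \<xi> B \<omega>) ^ (2 * tri l) * cmod (expsum \<xi> B' \<omega>) ^ (2 * (tri k - tri l))) ^ (m + 1)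
    \<le> (h \<omega> * cmod (expsum \<xi> B \<omega>) ^ (2 * tri (l - 1)) * cmod (expsum \<xi> B' \<omega>) ^ (2 * (tri k - tri (l - 1)))) ^ m *
      (h \<omega> * cmod (expsum \<xi> B' \<omega>) ^ (2 * tri m) * cmod (expsum \<xi> B \<omega>) ^ (2 * (tri k - tri m))) ^ 1"
    unfolding power_mult[of _ 2] using eq by (rule eq_refl)
qed (use h l in auto)

text \<open>For \<open>l = 0\<close> only the sum over the short interval is present, and rescaling
  it saves all \<open>b\<close> scales at once. This is why the gain at index 0 is 1 in every
  round.\<close>

lemma mixed_bound_linear:
  assumes decouples: "decouples k \<Lambda> M \<eta> C" and C: "C \<ge> 1" "C ^ tri k \<le> K" and M: "M > 0" and \<eta>: "\<eta> \<ge> 0" and \<iota>: "\<iota> \<ge> 0"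
    and c: "config k \<Lambda> M H \<Omega> h \<xi> g A" and k: "k > 0"
    and i': "0 \<le> i'" "i' < int M ^ b" and b: "b \<le> H"
  shows "mixed_moment \<Omega> h \<xi> 0 (tri k) B (cell M b A i')
       \<le> K * real M powr (real (tri k) * (\<eta> * (real H - real b) + \<iota> * real r * real H))
          * cellsum \<Omega> h (tri k) \<xi> M H (cell M b A i') ^ tri k"
proof -
  let ?U = "cellsum \<Omega> h (tri k) \<xi> M H (cell M b A i')"
  have "mixed_moment \<Omega> h \<xi> 0 (tri k) B (cell M b A i') = sqnorm \<Omega> h (tri k) (expsum \<xi> (cell M b A i')) ^ tri k"
    unfolding mixed_moment_0 using config_nonneg[OF c] tri_pos[OF k] by (subst sqnorm_power) auto
  also have "\<dots> \<le> (C * real M powr (\<eta> * real (H - b)) * ?U) ^ tri k"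
    by (intro power_mono decouples_cell[OF decouples c M b i']) auto
  also have "\<dots> = C ^ tri k * (real M powr (\<eta> * (real H - real b))) ^ tri k * ?U ^ tri k"
    using b by (simp add: power_mult_distrib of_nat_diff)
  also have "(real M powr (\<eta> * (real H - real b))) ^ tri k = real M powr (real (tri k) * (\<eta> * (real H - real b)))"
    using M by (simp add: powr_powr mult.commute flip: powr_realpow)
  also have "C ^ tri k * real M powr (real (tri k) * (\<eta> * (real H - real b))) * ?U ^ tri k
    \<le> K * real M powr (real (tri k) * (\<eta> * (real H - real b) + \<iota> * real r * real H)) * ?U ^ tri k"
    using C M \<iota> by (intro mult_right_mono mult_mono powr_mono mult_left_mono) (auto intro: order_trans[OF _ C(2)])
  finally show ?thesis .
qed

text \<open>Without any round, Hoelder's inequality separates the factors and each is decoupled by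
  itself; the only gain is the one at \<open>l = 0\<close>.\<close>

lemma mixed_bound_0:
  assumes decouples: "decouples k \<Lambda> M \<eta> C" and C: "C \<ge> 1" and M: "M > 0" and \<eta>: "\<eta> \<ge> 0"
  shows "mixed_bound k \<Lambda> M \<eta> \<iota> 0 (C ^ tri k)"
  unfolding mixed_bound_def
proof (intro allI impI)
  fix H \<Omega> h \<xi> g A a b i i' l
  assume c: "config k \<Lambda> M H \<Omega> h \<xi> g A" and l: "l < k" and i: "0 \<le> i" "i < int M ^ a"
    and i': "0 \<le> i'" "i' < int M ^ b" and a: "a \<le> H" and b: "b * k ^ 0 \<le> H"
  let ?U = "cellsum \<Omega> h (tri k) \<xi> M H (cell M a A i)" and ?U' = "cellsum \<Omega> h (tri k) \<xi> M H (cell M b A i')"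
  let ?n = "tri k"
  show "mixed_moment \<Omega> h \<xi> (tri l) (tri k - tri l) (cell M a A i) (cell M b A i')
       \<le> C ^ tri k * real M powr (real (tri k) * (\<eta> * (real H - gain k 0 l * real b) + \<iota> * real 0 * real H))
          * ?U ^ tri l * ?U' ^ (tri k - tri l)"
  proof (cases "l = 0")
    case True
    thus ?thesis using mixed_bound_linear[OF decouples C order_refl M \<eta> order_refl c _ i', of "cell M a A i" 0] b l by simp
  next
    case False
    obtain m where m: "k = l + Suc m" using l less_iff_Suc_add by auto
    have "tri k = tri l + tri (Suc m) + l * Suc m" unfolding m by (rule tri_add)
    hence p: "tri l > 0" "tri k - tri l > 0" "tri l + (tri k - tri l) = tri k"
      using False tri_pos[of l] tri_pos[of "Suc m"] by linarith+
    have M1: "real M \<ge> 1" using M by simp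
    have n: "sqnorm \<Omega> h ?n (expsum \<xi> (cell M t A j)) \<le> C * real M powr (\<eta> * real H) * cellsum \<Omega> h ?n \<xi> M H (cell M t A j)"
      if "t \<le> H" "0 \<le> j" "j < int M ^ t" for t j
    proof -
      have "real M powr (\<eta> * real (H - t)) \<le> real M powr (\<eta> * real H)"
        using M1 \<eta> by (intro powr_mono mult_left_mono) auto
      hence "C * real M powr (\<eta> * real (H - t)) * cellsum \<Omega> h ?n \<xi> M H (cell M t A j) 
         \<le> C * real M powr (\<eta> * real H) * cellsum \<Omega> h ?n \<xi> M H (cell M t A j)"
        using C by (intro mult_right_mono mult_left_mono) auto
      thus ?thesis using decouples_cell[OF decouples c M that] by linarith
    qed
    let ?X = "C * real M powr (\<eta> * real H)"
    have "mixed_moment \<Omega> h \<xi> (tri l) (tri k - tri l) (cell M a A i) (cell M b A i')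
      \<le> sqnorm \<Omega> h ?n (expsum \<xi> (cell M a A i)) ^ tri l * sqnorm \<Omega> h ?n (expsum \<xi> (cell M b A i')) ^ (tri k - tri l)"
      using mixed_moment_le_sqnorm[OF config_nonneg[OF c] config_finite(2)[OF c] p(1,2), where \<xi> = \<xi> and B = "cell M a A i" and B' = "cell M b A i'"] p(3) by simp
    also have "\<dots> \<le> (?X * ?U) ^ tri l * (?X * ?U') ^ (tri k - tri l)"
      using n a b i i' C by (intro mult_mono power_mono) auto
    also have "\<dots> = ?X ^ (tri l + (tri k - tri l)) * ?U ^ tri l * ?U' ^ (tri k - tri l)"
      by (simp only: power_mult_distrib power_add mult_ac)
    also have "?X ^ (tri l + (tri k - tri l)) = C ^ ?n * real M powr (real ?n * (\<eta> * real H))"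
      unfolding p(3) using M by (simp add: power_mult_distrib powr_powr mult.commute flip: powr_realpow)
    finally show ?thesis using False by simp
  qed
qed

lemma idx_coarse_eq:
  assumes "M > 0" "a \<ge> 1" "a \<le> nt" "x \<in> cell M a A i"
  shows "idx M nt x div int M ^ (nt - 1) = i div int M ^ (a - 1)"
proof -
  have "idx M 1 x = idx M a x div int M ^ (a - 1)" "idx M 1 x = idx M nt x div int M ^ (nt - 1)"
    using idx_div[OF assms(1), of 1 x "a - 1"] idx_div[OF assms(1), of 1 x "nt - 1"] assms by auto
  thus ?thesis using assms(4) by (simp add: cell_def)
qed


text \<open>One round: decoupling in the lower degree \<open>l\<close> moves the first interval to the scale
  \<open>(k - l + 1) b / l\<close>, and then Hoelder's inequality exchanges the roles of the two intervals.\<close>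

lemma mixed_bound_Suc:
  assumes bb: "mixed_bound k \<Lambda> M \<eta> \<iota> r K" and K: "K \<ge> 1"
    and decl: "\<And>l. 1 \<le> l \<Longrightarrow> l < k \<Longrightarrow> decouples l (2 ^ k * \<Lambda>) M \<iota> C" and C: "C \<ge> 1"
    and decouples: "decouples k \<Lambda> M \<eta> C\<^sub>0" and C0: "C\<^sub>0 \<ge> 1" "C\<^sub>0 ^ tri k \<le> K"
    and M: "real M \<ge> 1 + real (tri k) * \<Lambda>" and \<Lambda>: "\<Lambda> \<ge> 0" and \<eta>: "\<eta> \<ge> 0" and \<iota>: "\<iota> \<ge> 0"
  shows "mixed_bound k \<Lambda> M \<eta> \<iota> (Suc r) ((C * real M ^ (2 * k)) ^ tri k * K)"
  unfolding mixed_bound_def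
proof (intro allI impI)
  fix H \<Omega> h \<xi> g A a b i i' l
  assume c: "config k \<Lambda> M H \<Omega> h \<xi> g A" and l: "l < k" and i: "0 \<le> i" "i < int M ^ a"
    and i': "0 \<le> i'" "i' < int M ^ b" and a: "1 \<le> a" "a \<le> H" and b: "1 \<le> b" "b * k ^ Suc r \<le> H"
    and dv: "fact k ^ Suc r dvd b" and la: "l * a \<le> (k - l + 1) * b"
    and sep: "\<bar>i div int M ^ (a - 1) - i' div int M ^ (b - 1)\<bar> \<ge> 2"
  let ?n = "tri k"
  let ?U = "\<lambda>B. cellsum \<Omega> h ?n \<xi> M H B"
  let ?B = "cell M a A i" and ?B' = "cell M b A i'"
  let ?Z = "C * real M ^ (2 * k)"
  have M1: "real M \<ge> 1" using M \<Lambda> by (smt (verit) mult_nonneg_nonneg of_nat_0_le_iff)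
  have M0: "M > 0" using M1 by (cases M) auto
  have Z: "?Z \<ge> 1" using C M1 mult_mono[of 1 C 1 "real M ^ (2 * k)"] by simp
  have k1: "k \<ge> 1" using l by simp
  have bH: "b \<le> H" "b * k ^ r \<le> H"
  proof -
    have "b * 1 \<le> b * k ^ Suc r" "b * k ^ r \<le> b * k ^ Suc r" 
      using k1 by (intro mult_left_mono; simp)+
    thus "b \<le> H" "b * k ^ r \<le> H" using b(2) by linarith+
  qed
  note hn = config_nonneg[OF c]
  show "mixed_moment \<Omega> h \<xi> (tri l) (tri k - tri l) ?B ?B'
       \<le> ?Z ^ ?n * K * real M powr (real ?n * (\<eta> * (real H - gain k (Suc r) l * real b) + \<iota> * real (Suc r) * real H))
          * ?U ?B ^ tri l * ?U ?B' ^ (tri k - tri l)"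
  proof (cases "l = 0")
    case True
    have "1 * K \<le> ?Z ^ ?n * K" using Z K by (intro mult_right_mono one_le_power) auto
    hence "C\<^sub>0 ^ tri k \<le> ?Z ^ ?n * K" using C0 by linarith
    from mixed_bound_linear[OF decouples C0(1) this M0 \<eta> \<iota> c _ i' bH(1), of ?B "Suc r"]
    show ?thesis using True k1 by simp
  next
    case False
    define m where "m = k - l"
    have m: "1 \<le> m" "l + m = k" "1 \<le> l" using l False by (auto simp: m_def)
    have "l dvd fact k" using m by (intro dvd_fact) auto
    hence "l dvd b" using dv by (metis dvd_mult2 dvd_trans power_Suc)
    hence ldv: "l dvd (m + 1) * b" by simp
    \<comment> \<open>The level reached by decoupling in degree \<open>l\<close>; it is exact
      because one factor \<open>fact k\<close> of \<open>b\<close> is spent on the division by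
      \<open>l\<close>.\<close>
    define nt where "nt = (m + 1) * b div l"
    have lnt: "l * nt = (m + 1) * b" using ldv by (simp add: nt_def)
    have "l * a \<le> l * nt" using la lnt by (simp add: m_def)
    hence ant: "a \<le> nt" using m by simp
    have nt_k: "nt \<le> k * b"
    proof -
      have "l * nt \<le> l * (k * b)" unfolding lnt mult.assoc[symmetric] using m
        by (intro mult_right_mono) (metis Suc_leI add.commute add_mult_distrib2 le_add2 mult.right_neutral 
            mult_le_mono nat_add_left_cancel_le plus_1_eq_Suc trans_le_add1 not_less_eq_eq add_le_mono le_refl mult_1, simp)
      thus ?thesis using m by simp
    qed
    have nt_H: "nt * k ^ r \<le> H" "nt \<le> H"
    proof -
      have "nt * k ^ r \<le> k * b * k ^ r" using nt_k by (rule mult_right_mono) simp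
      also have "\<dots> \<le> H" using b(2) by (simp add: mult_ac)
      finally show *: "nt * k ^ r \<le> H" .
      have "nt * 1 \<le> nt * k ^ r" using k1 by (intro mult_left_mono) auto
      thus "nt \<le> H" using * by linarith
    qed
    have nt_dvd: "fact k ^ r dvd nt"
    proof -
      obtain q where q: "b = fact k ^ Suc r * q" using dv by (elim dvdE)
      obtain f where f: "fact k = l * f" using \<open>l dvd fact k\<close> by (elim dvdE)
      have "l * nt = l * (fact k ^ r * ((m + 1) * f * q))" unfolding lnt q power_Suc by (simp add: f algebra_simps)
      thus ?thesis using m by simp
    qed
    define v where "v = tri k - tri l"
    have v: "tri l + v = tri k" using tri_mono[of l k] l by (simp add: v_def)
    have v_pos: "v \<ge> 1"
    proof -
      have "tri k = tri l + tri m + l * m" using tri_add[of l m] m by simp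
      thus ?thesis using v tri_pos[of m] m by linarith
    qed
    have Mv: "real M \<ge> 1 + real v * \<Lambda>"
    proof -
      have "real v * \<Lambda> \<le> real (tri k) * \<Lambda>" using v \<Lambda> by (intro mult_right_mono) auto
      thus ?thesis using M by linarith
    qed
    define h' where "h' = (\<lambda>\<omega>. h \<omega> * cmod (expsum \<xi> ?B' \<omega>) ^ (2 * v))"
    have h': "0 \<le> h' \<omega>" if "\<omega> \<in> \<Omega>" for \<omega> using hn[OF that] by (simp add: h'_def)
    have tl: "tri l > 0" using m tri_pos by simp
    define x where "x = \<eta> * (real H - gain k (Suc r) l * real b) + \<iota> * real r * real H"
    let ?P = "real M powr (real ?n * x)"
    have piece: "mixed_moment \<Omega> h \<xi> (tri l) v (cell M nt A j) ?B' \<le> K * ?P * ?U (cell M nt A j) ^ tri l * ?U ?B' ^ v"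
      if j: "j \<in> idx M nt ` ?B" for j
    proof -
      let ?J = "cell M nt A j"
      obtain y where y: "y \<in> ?B" "j = idx M nt y" using j by auto
      have yA: "y \<in> {0..<1}" using y config_finite[OF c] cell_subset by blast
      have jr: "0 \<le> j" "j < int M ^ nt" unfolding y(2) using idx_bounds[OF M0 yA] by auto
      have jd: "j div int M ^ (nt - 1) = i div int M ^ (a - 1)"
        unfolding y(2) by (rule idx_coarse_eq[OF M0 a(1) ant y(1)])
      have nt1: "1 \<le> nt" using a ant by simp
      define x1 where "x1 = \<eta> * (real H - gain k r (l - 1) * real b) + \<iota> * real r * real H"
      define x2 where "x2 = \<eta> * (real H - gain k r m * real nt) + \<iota> * real r * real H"
      have 1: "mixed_moment \<Omega> h \<xi> (tri (l - 1)) (tri k - tri (l - 1)) ?J ?B'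
        \<le> K * real M powr (real ?n * x1) * ?U ?J ^ tri (l - 1) * ?U ?B' ^ (tri k - tri (l - 1))"
      proof -
        have "(l - 1) * nt \<le> (k - (l - 1) + 1) * b"
        proof -
          have "(l - 1) * nt \<le> l * nt" by simp
          also have "\<dots> \<le> (k - (l - 1) + 1) * b" unfolding lnt using m by (intro mult_right_mono) auto
          finally show ?thesis .
        qed
        moreover have "fact k ^ r dvd b" using dv by (metis dvd_mult_right power_Suc)
        ultimately show ?thesis
          using bb c l jr i' nt1 nt_H b bH sep jd unfolding mixed_bound_def x1_def
          by (metis diff_less less_imp_diff_less)
      qed
      \<comment> \<open>Here the piece \<open>?J\<close> at level \<open>nt\<close> takes over the
        part of the short interval, so the gain is multiplied by \<open>nt\<close> instead of
        \<open>b\<close>.\<close>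
      have 2: "mixed_moment \<Omega> h \<xi> (tri m) (tri k - tri m) ?B' ?J
        \<le> K * real M powr (real ?n * x2) * ?U ?B' ^ tri m * ?U ?J ^ (tri k - tri m)"
      proof -
        have "m * b \<le> (k - m + 1) * nt"
        proof -
          have "m * b \<le> l * nt" unfolding lnt by simp
          also have "\<dots> \<le> (k - m + 1) * nt" using m by (intro mult_right_mono) auto
          finally show ?thesis .
        qed
        moreover have "m < k" using m by simp
        moreover have "\<bar>i' div int M ^ (b - 1) - j div int M ^ (nt - 1)\<bar> \<ge> 2" 
          using sep jd by (simp add: abs_minus_commute)
        ultimately show ?thesis
          using bb c jr i' nt1 nt_H b bH nt_dvd unfolding mixed_bound_def x2_def by blast
      qed
      define u where "u = ?U ?J"
      define u' where "u' = ?U ?B'"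
      have u: "u \<ge> 0" "u' \<ge> 0" by (simp_all add: u_def u'_def)
      obtain l' where l': "l = Suc l'" using m by (cases l) auto
      have e1: "tri (l - 1) * m + (tri k - tri m) = tri l * (m + 1)"
        unfolding m(2)[symmetric] tri_add l' by (simp add: tri_Suc algebra_simps)
      have e2: "(tri k - tri (l - 1)) * m + tri m = v * (m + 1)"
        unfolding v_def m(2)[symmetric] tri_add l' by (simp add: tri_Suc algebra_simps)
      \<comment> \<open>The origin of the recursion for \<open>gain\<close>: the Hoelder weights
        \<open>m\<close> and 1 combined with \<open>nt = (m + 1) b / l\<close>.\<close>
      have xx: "real m * x1 + x2 = real (m + 1) * x"
      proof -
        have g: "gain k (Suc r) l = real m / real (m + 1) * gain k r (l - 1) + gain k r m / real l"
          using False by (simp add: m_def)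
        have weighted: "w * p * z + q * (N * z / L) = N * ((w / N * p + q / L) * z)" if "N > 0" for N w p z q L :: real
          using that by (simp add: distrib_left distrib_right)
        have "real l * real nt = real (m + 1) * real b" using lnt by (metis of_nat_mult)
        hence "real nt = real (m + 1) * real b / real l" using m by (simp add: field_simps)
        hence "real m * gain k r (l - 1) * real b + gain k r m * real nt = real (m + 1) * (gain k (Suc r) l * real b)"
          unfolding g
          using weighted[of "real (m + 1)" "real m" "gain k r (l - 1)" "real b" "gain k r m" "real l"] by simp
        hence "\<eta> * (real m * gain k r (l - 1) * real b + gain k r m * real nt) = \<eta> * (real (m + 1) * (gain k (Suc r) l * real b))"
          by simp
        thus ?thesis unfolding x1_def x2_def x_def by (simp add: algebra_simps)
      qed
      have gen: "(K * p1 * u ^ a1 * u' ^ b1) ^ m * (K * p2 * u' ^ a2 * u ^ b2) ^ 1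
        = K ^ (m + 1) * (p1 ^ m * p2) * u ^ (a1 * m + b2) * u' ^ (b1 * m + a2)" for p1 p2 :: real and a1 b1 a2 b2 :: nat
        by (simp add: power_mult_distrib power_add mult_ac flip: power_mult)
      have "mixed_moment \<Omega> h \<xi> (tri l) v ?J ?B' ^ (m + 1)
        \<le> (K * real M powr (real ?n * x1) * u ^ tri (l - 1) * u' ^ (tri k - tri (l - 1))) ^ m
          * (K * real M powr (real ?n * x2) * u' ^ tri m * u ^ (tri k - tri m)) ^ 1"
        unfolding v_def u_def u'_def
        using mixed_moment_nonneg[OF hn, of \<Omega>] K
        by (intro order_trans[OF mixed_moment_Holder[OF hn config_finite(2)[OF c] m(3,1,2)]] mult_mono power_mono 1 2[unfolded One_nat_def])
           auto
      also have "\<dots> = K ^ (m + 1) * ((real M powr (real ?n * x1)) ^ m * real M powr (real ?n * x2))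
          * u ^ (tri (l - 1) * m + (tri k - tri m)) * u' ^ ((tri k - tri (l - 1)) * m + tri m)"
        by (rule gen[of "real M powr (real ?n * x1)" "tri (l - 1)" "tri k - tri (l - 1)"
              "real M powr (real ?n * x2)" "tri m" "tri k - tri m"])
      also have "(real M powr (real ?n * x1)) ^ m * real M powr (real ?n * x2) = ?P ^ (m + 1)"
      proof -
        have "(real M powr (real ?n * x1)) ^ m * real M powr (real ?n * x2) = real M powr (real ?n * (real m * x1 + x2))"
          using M0 by (simp add: powr_powr powr_add algebra_simps flip: powr_realpow)
        moreover have "?P ^ (m + 1) = real M powr (real (m + 1) * (real ?n * x))"
          using M0 by (intro powr_power) simp
        ultimately show ?thesis unfolding xx by (simp only: mult_ac)
      qed
      also have "K ^ (m + 1) * ?P ^ (m + 1) * u ^ (tri (l - 1) * m + (tri k - tri m)) * u' ^ ((tri k - tri (l - 1)) * m + tri m)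
         = (K * ?P * u ^ tri l * u' ^ v) ^ (m + 1)"
        unfolding e1 e2 by (simp only: power_mult_distrib power_mult)
      finally show ?thesis unfolding u_def[symmetric] u'_def[symmetric]
        by (rule le_if_power_le) (use u K in auto)
    qed
    define \<beta> where "\<beta> = K * ?P * ?U ?B' ^ v"
    \<comment> \<open>The bound for a piece is homogeneous of degree \<open>tri l\<close> in its
      cell sum. Taking the root makes it linear, so that the pieces can be added up.\<close>
    define Y where "Y = root (tri l) \<beta>"
    have \<beta>: "\<beta> \<ge> 0" using K by (simp add: \<beta>_def)
    have Y: "Y ^ tri l = \<beta>" "Y \<ge> 0" using \<beta> tl by (simp_all add: Y_def)
    have D: "cellsum \<Omega> h' (tri l) \<xi> M nt ?B \<le> Y * ?U ?B"
    proof -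
      have cc: "cell M nt ?B j = cell M nt A j" if j: "j \<in> idx M nt ` ?B" for j
      proof -
        obtain y where y: "y \<in> A" "i = idx M a y" "j = idx M nt y" using j by (auto simp: cell_def)
        thus ?thesis using cell_cell[OF M0 ant y(1)] by simp
      qed
      have "sqnorm \<Omega> h' (tri l) (expsum \<xi> (cell M nt ?B j)) \<le> Y * ?U (cell M nt ?B j)" if "j \<in> idx M nt ` ?B" for j
      proof (rule sqnorm_le[OF h' tl])
        have "moment \<Omega> h' (tri l) (expsum \<xi> (cell M nt ?B j)) \<le> \<beta> * ?U (cell M nt A j) ^ tri l"
          using piece[OF that] unfolding mixed_moment_eq_moment h'_def cc[OF that] \<beta>_def by (simp add: mult_ac)
        thus "moment \<Omega> h' (tri l) (expsum \<xi> (cell M nt ?B j)) \<le> (Y * ?U (cell M nt ?B j)) ^ tri l"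
          by (simp add: cc[OF that] power_mult_distrib Y)
      qed (use Y in auto)
      hence "cellsum \<Omega> h' (tri l) \<xi> M nt ?B \<le> (\<Sum>j\<in>idx M nt ` ?B. Y * ?U (cell M nt ?B j))"
        unfolding cellsum_def[of \<Omega> h'] by (rule sum_mono)
      also have "\<dots> = Y * ?U ?B"
        using config_finite[OF c] by (simp add: cellsum_refine[OF M0 nt_H(2)] flip: sum_distrib_left)
      finally show ?thesis .
    qed
    have "sqnorm \<Omega> h' (tri l) (expsum \<xi> ?B) \<le> ?Z * real M powr (\<iota> * real nt) * cellsum \<Omega> h' (tri l) \<xi> M nt ?B"
      using sqnorm_lower[OF decl[OF m(3) l] C \<iota> M0 c \<Lambda> m(3,2) i i' a(1) b(1) bH(1) sep v Mv lnt ant]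
      unfolding h'_def .
    also have "\<dots> \<le> ?Z * real M powr (\<iota> * real nt) * (Y * ?U ?B)"
      using D C by (intro mult_left_mono) auto
    finally have nb: "sqnorm \<Omega> h' (tri l) (expsum \<xi> ?B) \<le> ?Z * real M powr (\<iota> * real nt) * (Y * ?U ?B)" .
    have "mixed_moment \<Omega> h \<xi> (tri l) v ?B ?B' = sqnorm \<Omega> h' (tri l) (expsum \<xi> ?B) ^ tri l"
      unfolding mixed_moment_eq_moment using sqnorm_power[OF h' tl] by (simp add: h'_def)
    also have "\<dots> \<le> (?Z * real M powr (\<iota> * real nt) * (Y * ?U ?B)) ^ tri l"
      using nb by (intro power_mono) auto
    also have "\<dots> = (?Z * real M powr (\<iota> * real nt)) ^ tri l * (\<beta> * ?U ?B ^ tri l)"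
      by (simp only: power_mult_distrib Y)
    also have "\<dots> \<le> (?Z ^ ?n * real M powr (real ?n * (\<iota> * real H))) * (\<beta> * ?U ?B ^ tri l)"
    proof (intro mult_right_mono)
      have "(?Z * real M powr (\<iota> * real nt)) ^ tri l \<le> (?Z * real M powr (\<iota> * real H)) ^ tri l"
        using M1 \<iota> nt_H Z by (intro power_mono mult_left_mono powr_mono) auto
      also have "\<dots> \<le> (?Z * real M powr (\<iota> * real H)) ^ ?n"
      proof (rule power_increasing)
        have "1 * 1 \<le> ?Z * real M powr (\<iota> * real H)"
          using Z M1 \<iota> by (intro mult_mono ge_one_powr_ge_zero) auto
        thus "1 \<le> ?Z * real M powr (\<iota> * real H)" by simp
      qed (use v in simp)
      also have "\<dots> = ?Z ^ ?n * real M powr (real ?n * (\<iota> * real H))"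
        using M0 by (simp only: power_mult_distrib) (simp add: powr_powr mult.commute flip: powr_realpow)
      finally show "(?Z * real M powr (\<iota> * real nt)) ^ tri l \<le> \<dots>" .
    qed (use \<beta> in simp)
    also have "\<dots> = ?Z ^ ?n * K * (real M powr (real ?n * (\<iota> * real H)) * ?P) * ?U ?B ^ tri l * ?U ?B' ^ v"
      unfolding \<beta>_def by (simp add: mult_ac)
    also have "real M powr (real ?n * (\<iota> * real H)) * ?P
        = real M powr (real ?n * (\<eta> * (real H - gain k (Suc r) l * real b) + \<iota> * real (Suc r) * real H))"
      unfolding x_def by (simp add: algebra_simps flip: powr_add del: gain.simps)
    finally show ?thesis unfolding v_def .
  qed
qed

section \<open>Broad-narrow analysis and the bootstrap\<close>

text \<open>The Bourgain-Guth dichotomy. If the sum exceeds 6 times its largest term, the at most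
  three terms with index within 1 of that one account for less than half of it. Some term further
  away then has size at least the sum divided by \<open>2 m\<close>, and together with the largest
  term it bounds the power of the sum by one product of separated terms.\<close>

lemma broad_or_narrow:
  fixes F :: "int \<Rightarrow> complex"
  assumes I: "finite I" "card I \<le> m" and pq: "p + q = n" "n > 0" and m: "m \<ge> 1"
  shows "cmod (\<Sum>i\<in>I. F i) ^ (2 * n) \<le> 6 ^ (2 * n) * (\<Sum>i\<in>I. cmod (F i) ^ (2 * n))
     + (2 * real m) ^ (2 * n) * (\<Sum>(i, j)\<in>{(i, j) \<in> I \<times> I. \<bar>i - j\<bar> \<ge> 2}. cmod (F i) ^ (2 * p) * cmod (F j) ^ (2 * q))"
    (is "?L \<le> ?N + ?B")
proof (cases "I = {}")
  case True thus ?thesis using pq by (simp add: power_0_left)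
next
  case False
  let ?f = "cmod (\<Sum>i\<in>I. F i)"
  have N0: "?N \<ge> 0" by (intro mult_nonneg_nonneg sum_nonneg) auto
  have B0: "?B \<ge> 0" by (intro mult_nonneg_nonneg sum_nonneg) auto
  have "Max ((\<lambda>i. cmod (F i)) ` I) \<in> (\<lambda>i. cmod (F i)) ` I" using I False by (intro Max_in) auto
  then obtain i0 where i0': "i0 \<in> I" "Max ((\<lambda>i. cmod (F i)) ` I) = cmod (F i0)" by auto
  have i0: "cmod (F i) \<le> cmod (F i0)" if "i \<in> I" for i
    using Max_ge[of "(\<lambda>i. cmod (F i)) ` I" "cmod (F i)"] I that i0' by auto
  show ?thesis
  proof (cases "?f \<le> 6 * cmod (F i0)")
    case True
    have "?L \<le> (6 * cmod (F i0)) ^ (2 * n)" using True by (intro power_mono) auto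
    also have "\<dots> = 6 ^ (2 * n) * cmod (F i0) ^ (2 * n)" by (simp add: power_mult_distrib)
    also have "\<dots> \<le> ?N" using I i0'(1) by (intro mult_left_mono member_le_sum) auto
    finally show ?thesis using B0 by linarith
  next
    case f: False
    hence fpos: "?f > 0" by (smt (verit) norm_ge_zero)
    have "\<exists>i\<in>I. \<bar>i - i0\<bar> \<ge> 2 \<and> cmod (F i) \<ge> ?f / (2 * real m)"
    proof (rule ccontr)
      assume neg: "\<not> ?thesis"
      define near where "near = {i \<in> I. \<bar>i - i0\<bar> \<le> 1}"
      define far where "far = I - near"
      have sub: "near \<subseteq> I" "far \<subseteq> I" by (auto simp: near_def far_def)
      have "(\<Sum>i\<in>I. F i) = (\<Sum>i\<in>far. F i) + (\<Sum>i\<in>near. F i)"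
        unfolding far_def using I(1) sub(1) by (intro sum.subset_diff)
      also have "\<dots> = (\<Sum>i\<in>near. F i) + (\<Sum>i\<in>far. F i)" by simp
      finally have eq: "(\<Sum>i\<in>I. F i) = (\<Sum>i\<in>near. F i) + (\<Sum>i\<in>far. F i)" .
      have "?f \<le> cmod (\<Sum>i\<in>near. F i) + cmod (\<Sum>i\<in>far. F i)" unfolding eq by (rule norm_triangle_ineq)
      also have "\<dots> \<le> (\<Sum>i\<in>near. cmod (F i)) + (\<Sum>i\<in>far. cmod (F i))"
        by (intro add_mono norm_sum)
      also have "(\<Sum>i\<in>near. cmod (F i)) \<le> real (card near) * cmod (F i0)"
        using i0 sub by (intro sum_bounded_above) auto
      also have "card near \<le> card {i0 - 1..i0 + 1}" by (intro card_mono) (auto simp: near_def)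
      hence "real (card near) * cmod (F i0) \<le> 3 * cmod (F i0)" by (intro mult_right_mono) auto
      also have "(\<Sum>i\<in>far. cmod (F i)) \<le> real (card far) * (?f / (2 * real m))"
        
      proof (rule sum_bounded_above)
        fix i assume "i \<in> far"
        hence "i \<in> I" "\<bar>i - i0\<bar> \<ge> 2" by (auto simp: far_def near_def)
        thus "cmod (F i) \<le> ?f / (2 * real m)" using neg by force
      qed
      also have "card far \<le> m" using I sub(2) by (meson card_mono le_trans)
      hence "real (card far) * (?f / (2 * real m)) \<le> real m * (?f / (2 * real m))"
        by (intro mult_right_mono) auto
      also have "\<dots> = ?f / 2" using m by simp
      finally show False using f by simp
    qed
    then obtain i where i: "i \<in> I" "\<bar>i - i0\<bar> \<ge> 2" "cmod (F i) \<ge> ?f / (2 * real m)" by blast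
    have "(?f / (2 * real m)) ^ (2 * n) = (?f / (2 * real m)) ^ (2 * p) * (?f / (2 * real m)) ^ (2 * q)"
      unfolding pq(1)[symmetric] by (simp add: power_add distrib_left)
    also have "\<dots> \<le> cmod (F i0) ^ (2 * p) * cmod (F i) ^ (2 * q)"
      using i i0[OF i(1)] by (intro mult_mono power_mono) auto
    also have "\<dots> \<le> (\<Sum>(i, j)\<in>{(i, j) \<in> I \<times> I. \<bar>i - j\<bar> \<ge> 2}. cmod (F i) ^ (2 * p) * cmod (F j) ^ (2 * q))"
    proof -
      let ?G = "\<lambda>(i, j). cmod (F i) ^ (2 * p) * cmod (F j) ^ (2 * q)"
      let ?S = "{(i, j) \<in> I \<times> I. \<bar>i - j\<bar> \<ge> 2}"
      have "finite ?S" using I by (intro finite_subset[of ?S "I \<times> I"]) auto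
      hence "?G (i0, i) \<le> sum ?G ?S"
        using i i0'(1) by (intro member_le_sum) (auto simp: abs_minus_commute)
      thus ?thesis by simp
    qed
    finally have "(2 * real m) ^ (2 * n) * (?f / (2 * real m)) ^ (2 * n) \<le> ?B"
      by (intro mult_left_mono) auto
    moreover have "(2 * real m) ^ (2 * n) * (?f / (2 * real m)) ^ (2 * n) = ?L"
      unfolding power_mult_distrib[symmetric] using m by simp
    ultimately show ?thesis using N0 by linarith
  qed
qed

lemma cellsum_cell_mono:
  assumes "M > 0" "t \<le> s" "finite A"
  shows "cellsum \<Omega> h n \<xi> M s (cell M t A i) \<le> cellsum \<Omega> h n \<xi> M s A"
proof (cases "i \<in> idx M t ` A")
  case False
  hence "cell M t A i = {}" by (auto simp: cell_def)
  thus ?thesis by (simp add: cellsum_def[of _ _ _ _ _ _ "{}"])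
qed (rule cellsum_cell_le[OF assms])

lemma mixed_bound_exists:
  assumes decl: "\<And>l. 1 \<le> l \<Longrightarrow> l < k \<Longrightarrow> decouples l (2 ^ k * \<Lambda>) M \<iota> C" and C: "C \<ge> 1"
    and decouples: "decouples k \<Lambda> M \<eta> C\<^sub>0" and C0: "C\<^sub>0 \<ge> 1"
    and M: "real M \<ge> 1 + real (tri k) * \<Lambda>" and \<Lambda>: "\<Lambda> \<ge> 0" and \<eta>: "\<eta> \<ge> 0" and \<iota>: "\<iota> \<ge> 0"
  shows "\<exists>K\<ge>1. C\<^sub>0 ^ tri k \<le> K \<and> mixed_bound k \<Lambda> M \<eta> \<iota> r K"
proof (induction r)
  case 0
  have "1 \<le> C\<^sub>0 ^ tri k" using C0 by (rule one_le_power)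
  moreover have "real M > 0" using M \<Lambda> by (smt (verit) mult_nonneg_nonneg of_nat_0_le_iff)
  hence "M > 0" by simp
  ultimately show ?case using mixed_bound_0[OF decouples C0 _ \<eta>] by blast
next
  case (Suc r)
  then obtain K where K: "K \<ge> 1" "C\<^sub>0 ^ tri k \<le> K" "mixed_bound k \<Lambda> M \<eta> \<iota> r K" by blast
  have M1: "real M \<ge> 1" using M \<Lambda> by (smt (verit) mult_nonneg_nonneg of_nat_0_le_iff)
  let ?Z = "(C * real M ^ (2 * k)) ^ tri k"
  have "1 * 1 \<le> C * real M ^ (2 * k)" using C M1 by (intro mult_mono one_le_power) auto
  hence "?Z \<ge> 1" by (intro one_le_power) simp
  hence "1 * K \<le> ?Z * K" using K by (intro mult_right_mono) auto
  hence "?Z * K \<ge> 1" "C\<^sub>0 ^ tri k \<le> ?Z * K" using K by linarith+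
  moreover have "mixed_bound k \<Lambda> M \<eta> \<iota> (Suc r) (?Z * K)"
    by (rule mixed_bound_Suc[OF K(3,1) decl C decouples C0 K(2) M \<Lambda> \<eta> \<iota>])
  ultimately show ?case by blast
qed

text \<open>\<open>R\<close> rounds give some index with gain at least \<open>R / k\<close>, and
  \<open>R\<close> is so large that \<open>\<eta>\<close> times this gain is at least 4. That
  outweighs the cost of cutting the second interval down to level \<open>b\<close>, and the surplus
  is proportional to \<open>H\<close> because \<open>b\<close> is comparable with
  \<open>H / k^R\<close>.\<close>

lemma broad_bound:
  fixes R :: nat
  assumes k: "k \<ge> 2" and \<epsilon>: "\<epsilon> > 0" and R: "real R \<ge> 4 * real k / \<epsilon>" and \<eta>: "\<eta> \<ge> \<epsilon>"
  defines "\<iota> \<equiv> 1 / (2 * real R * real k ^ R)" and "\<kappa> \<equiv> 1 / (4 * real k ^ R)"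
  assumes decl: "\<And>l. 1 \<le> l \<Longrightarrow> l < k \<Longrightarrow> decouples l (2 ^ k * \<Lambda>) M \<iota> C" and C: "C \<ge> 1"
    and decouples: "decouples k \<Lambda> M \<eta> C\<^sub>0" and C0: "C\<^sub>0 \<ge> 1"
    and M: "real M \<ge> 1 + real (tri k) * \<Lambda>" and \<Lambda>: "\<Lambda> \<ge> 0"
  obtains l C\<^sub>2 where "C\<^sub>2 \<ge> 1" "1 \<le> l" "l < k"
    "\<And>H \<Omega> h \<xi> g A i i'. config k \<Lambda> M H \<Omega> h \<xi> g A \<Longrightarrow> H \<ge> 1 \<Longrightarrow> 0 \<le> i \<Longrightarrow> i < int M \<Longrightarrow> 0 \<le> i' \<Longrightarrow> i' < int M \<Longrightarrow>
       \<bar>i - i'\<bar> \<ge> 2 \<Longrightarrow> mixed_moment \<Omega> h \<xi> (tri l) (tri k - tri l) (cell M 1 A i) (cell M 1 A i')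
         \<le> (C\<^sub>2 * real M powr ((\<eta> - 2 * \<kappa>) * real H) * cellsum \<Omega> h (tri k) \<xi> M H A) ^ tri k"
proof -
  have "4 * real k / \<epsilon> > 0" using k \<epsilon> by simp
  hence R0: "R > 0" using R by (cases R) auto
  have \<iota>: "\<iota> \<ge> 0" and \<kappa>: "\<kappa> > 0" using k by (auto simp: \<iota>_def \<kappa>_def)
  have \<eta>0: "\<eta> \<ge> 0" using \<epsilon> \<eta> by linarith
  have M1: "real M \<ge> 1" using M \<Lambda> by (smt (verit) mult_nonneg_nonneg of_nat_0_le_iff)
  have M0: "M > 0" using M1 by (cases M) auto
  obtain K where K: "K \<ge> 1" "C\<^sub>0 ^ tri k \<le> K" "mixed_bound k \<Lambda> M \<eta> \<iota> R K"
    using mixed_bound_exists[OF decl C decouples C0 M \<Lambda> \<eta>0 \<iota>] by blast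
  obtain l where l: "1 \<le> l" "l < k" "gain k R l \<ge> real R / real k" using gain_large[OF k] .
  have "4 \<le> \<epsilon> * (real R / real k)" using R \<epsilon> k by (simp add: field_simps)
  also have "\<dots> \<le> \<eta> * gain k R l" using \<eta> l \<epsilon> by (intro mult_mono) auto
  finally have gain4: "\<eta> * gain k R l \<ge> 4" .
  let ?n = "tri k"
  define v where "v = tri k - tri l"
  have "tri k = tri l + tri (k - l) + l * (k - l)" using tri_add[of l "k - l"] l by simp
  hence v: "tri l + v = tri k" "v \<ge> 1" and tl: "tri l > 0"
    using l tri_pos[of "k - l"] tri_pos[of l] by (simp_all add: v_def)
  \<comment> \<open>The least \<open>H\<close> for which some \<open>b \<ge> 1\<close> satisfies
    both conditions of \<open>mixed_bound\<close>. For smaller \<open>H\<close> the claim is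
    absorbed into the constant.\<close>
  define W where "W = fact k ^ R * k ^ R"
  define C2 where "C2 = C\<^sub>0 * real M powr (2 * \<kappa> * real W) * K"
  have P1: "real M powr (2 * \<kappa> * real W) \<ge> 1" using M1 \<kappa> by (intro ge_one_powr_ge_zero) auto
  have "1 * 1 * 1 \<le> C2" unfolding C2_def using C0 K P1 by (intro mult_mono) auto
  hence C2: "C2 \<ge> 1" by simp
  have C2K: "K \<le> C2"
  proof -
    have "1 * 1 * K \<le> C2" unfolding C2_def using C0 K P1 by (intro mult_mono) auto
    thus ?thesis by simp
  qed
  have C2C: "C\<^sub>0 * real M powr (2 * \<kappa> * real W) \<le> C2"
  proof -
    have "C\<^sub>0 * real M powr (2 * \<kappa> * real W) * 1 \<le> C2"
      unfolding C2_def using C0 K P1 by (intro mult_left_mono) auto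
    thus ?thesis by simp
  qed
  show ?thesis
  proof (rule that[OF C2 l(1,2)])
    fix H \<Omega> h \<xi> g A and i i' :: int
    assume c: "config k \<Lambda> M H \<Omega> h \<xi> g A" and H: "H \<ge> 1" and i: "0 \<le> i" "i < int M" and i': "0 \<le> i'" "i' < int M"
      and sep: "\<bar>i - i'\<bar> \<ge> 2"
    note hn = config_nonneg[OF c] and fin = config_finite[OF c]
    let ?U = "cellsum \<Omega> h ?n \<xi> M H"
    let ?I = "cell M 1 A i" and ?I' = "cell M 1 A i'"
    let ?G = "real M powr ((\<eta> - 2 * \<kappa>) * real H)"
    have UI: "?U ?I \<le> ?U A" "?U ?I' \<le> ?U A" using cellsum_cell_mono[OF M0 H fin(1)] by blast+
    show "mixed_moment \<Omega> h \<xi> (tri l) (tri k - tri l) ?I ?I' \<le> (C2 * ?G * ?U A) ^ ?n"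
    proof (cases "H < W")
      case True
      have nb: "sqnorm \<Omega> h ?n (expsum \<xi> (cell M 1 A j)) \<le> C2 * ?G * ?U A" if "0 \<le> j" "j < int M" for j
      proof -
        have "sqnorm \<Omega> h ?n (expsum \<xi> (cell M 1 A j)) \<le> C\<^sub>0 * real M powr (\<eta> * real (H - 1)) * ?U (cell M 1 A j)"
          using that by (intro decouples_cell[OF decouples c M0 H]) auto
        also have "\<dots> \<le> C\<^sub>0 * (real M powr (2 * \<kappa> * real W) * ?G) * ?U A"
        proof (intro mult_mono mult_left_mono)
          have "\<eta> * real (H - 1) \<le> \<eta> * real H" using \<eta>0 by (intro mult_left_mono) auto
          moreover have "2 * \<kappa> * real H \<le> 2 * \<kappa> * real W" using True \<kappa> by (intro mult_left_mono) auto
          ultimately have "\<eta> * real (H - 1) \<le> 2 * \<kappa> * real W + (\<eta> - 2 * \<kappa>) * real H"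
            unfolding left_diff_distrib by linarith
          thus "real M powr (\<eta> * real (H - 1)) \<le> real M powr (2 * \<kappa> * real W) * ?G"
            unfolding powr_add[symmetric] using M1 by (intro powr_mono) auto
          show "?U (cell M 1 A j) \<le> ?U A" by (rule cellsum_cell_mono[OF M0 H fin(1)])
        qed (use C0 in auto)
        also have "\<dots> \<le> C2 * (?G * ?U A)"
          unfolding mult.assoc[symmetric] using C2C by (intro mult_right_mono) auto
        finally show ?thesis by (simp add: mult.assoc)
      qed
      have "mixed_moment \<Omega> h \<xi> (tri l) v ?I ?I' \<le> sqnorm \<Omega> h ?n (expsum \<xi> ?I) ^ tri l * sqnorm \<Omega> h ?n (expsum \<xi> ?I') ^ v"
        using mixed_moment_le_sqnorm[OF hn fin(2) tl, where q = v and \<xi> = \<xi> and B = ?I and B' = ?I'] v by simp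
      also have "\<dots> \<le> (C2 * ?G * ?U A) ^ tri l * (C2 * ?G * ?U A) ^ v"
        using nb i i' C2 by (intro mult_mono power_mono zero_le_power) auto
      also have "\<dots> = (C2 * ?G * ?U A) ^ ?n" using v by (simp flip: power_add)
      finally show ?thesis by (simp add: v_def)
    next
      case False
      define q where "q = H div W"
      define b where "b = fact k ^ R * q"
      have W: "W > 0" using k by (simp add: W_def)
      have q: "q \<ge> 1" "W * q \<le> H" "H < W * q + W"
      proof -
        show "q \<ge> 1" using False W by (simp add: q_def div_greater_zero_iff Suc_le_eq)
        have "H = W * q + H mod W" by (simp add: q_def)
        moreover have "H mod W < W" using W by simp
        ultimately show "W * q \<le> H" "H < W * q + W" by linarith+
      qed
      have fR: "fact k ^ R \<ge> k"
      proof -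
        have "k \<le> fact k" by (rule fact_ge_self)
        also have "\<dots> \<le> fact k ^ R" using R0 by (intro self_le_power) auto
        finally show ?thesis .
      qed
      have bk: "b \<ge> k" using fR q mult_le_mono[of k "fact k ^ R" 1 q] by (simp add: b_def)
      have b1: "b \<ge> 1" using bk k by linarith
      have bH: "b * k ^ R \<le> H" using q by (simp add: b_def W_def mult_ac)
      have "b * 1 \<le> b * k ^ R" using k by (intro mult_left_mono) auto
      hence bH': "b \<le> H" using bH by linarith
      have b2: "real H \<le> 2 * real b * real k ^ R"
      proof -
        have "W * 1 \<le> W * q" using q by (intro mult_left_mono) auto
        hence "H \<le> 2 * (W * q)" using q by linarith
        hence "real H \<le> real (2 * (W * q))" by linarith
        thus ?thesis by (simp add: W_def b_def mult_ac)
      qed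
      let ?J = "idx M b ` ?I'"
      define x where "x = \<eta> * (real H - gain k R l * real b) + \<iota> * real R * real H"
      have split: "mixed_moment \<Omega> h \<xi> (tri l) v ?I ?I' \<le> real M ^ (2 * ?n * b) * (\<Sum>j\<in>?J. mixed_moment \<Omega> h \<xi> (tri l) v ?I (cell M b ?I' j))"
      proof -
        have "card ?J \<le> M ^ (b - 1)" using card_cell_idx_le[OF M0 fin(1), of 1 "b - 1" i'] b1 by simp
        hence cJ: "real (card ?J) \<le> real M ^ (b - 1)" by (metis of_nat_le_iff of_nat_power)
        have "mixed_moment \<Omega> h \<xi> (tri l) v ?I ?I' \<le> (\<Sum>\<omega>\<in>\<Omega>. h \<omega> * cmod (expsum \<xi> ?I \<omega>) ^ (2 * tri l) *
          (real M ^ (2 * ?n * b) * (\<Sum>j\<in>?J. cmod (expsum \<xi> (cell M b ?I' j) \<omega>) ^ (2 * v))))"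
          unfolding mixed_moment_def
        proof (intro sum_mono mult_left_mono)
          fix \<omega> assume "\<omega> \<in> \<Omega>"
          thus "0 \<le> h \<omega> * cmod (expsum \<xi> ?I \<omega>) ^ (2 * tri l)" using hn by simp
          let ?S = "\<Sum>j\<in>?J. cmod (expsum \<xi> (cell M b ?I' j) \<omega>) ^ (2 * v)"
          have S0: "?S \<ge> 0" by (intro sum_nonneg) auto
          have "cmod (expsum \<xi> ?I' \<omega>) \<le> (\<Sum>j\<in>?J. cmod (expsum \<xi> (cell M b ?I' j) \<omega>))"
            using fin by (subst expsum_cells[where M = M and t = b]) (auto intro: norm_sum)
          hence "cmod (expsum \<xi> ?I' \<omega>) ^ (2 * v) \<le> (\<Sum>j\<in>?J. cmod (expsum \<xi> (cell M b ?I' j) \<omega>)) ^ (2 * v)"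
            by (intro power_mono) auto
          also have "\<dots> \<le> real (card ?J) ^ (2 * v) * ?S"
            using fin v by (intro power_sum_le_card) auto
          also have "\<dots> \<le> (real M ^ (b - 1)) ^ (2 * v) * ?S"
            using cJ S0 by (intro mult_right_mono power_mono) auto
          also have "\<dots> \<le> real M ^ (2 * ?n * b) * ?S"
          proof (intro mult_right_mono S0)
            have "(b - 1) * (2 * v) \<le> b * (2 * ?n)" using v by (intro mult_mono) auto
            thus "(real M ^ (b - 1)) ^ (2 * v) \<le> real M ^ (2 * ?n * b)"
              unfolding power_mult[symmetric] using M1 by (intro power_increasing) (auto simp: mult_ac)
          qed
          finally show "cmod (expsum \<xi> ?I' \<omega>) ^ (2 * v) \<le> real M ^ (2 * ?n * b) * ?S" .
        qed
        also have "\<dots> = real M ^ (2 * ?n * b) * (\<Sum>j\<in>?J. mixed_moment \<Omega> h \<xi> (tri l) v ?I (cell M b ?I' j))"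
          unfolding mixed_moment_def by (subst sum.swap) (simp add: sum_distrib_left mult_ac)
        finally show ?thesis .
      qed
      have piece: "mixed_moment \<Omega> h \<xi> (tri l) v ?I (cell M b ?I' j)
          \<le> K * real M powr (real ?n * x) * ?U ?I ^ tri l * ?U (cell M b ?I' j) ^ v" if j: "j \<in> ?J" for j
      proof -
        obtain y where y: "y \<in> ?I'" "j = idx M b y" using j by auto
        have y': "y \<in> A" "i' = idx M 1 y" using y by (auto simp: cell_def)
        have yA: "y \<in> {0..<1}" using y' fin by blast
        have jr: "0 \<le> j" "j < int M ^ b" unfolding y(2) using idx_bounds[OF M0 yA] by auto
        have jd: "j div int M ^ (b - 1) = i'"
          unfolding y(2) using idx_coarse_eq[OF M0 order_refl b1 y(1)] by simp
        have cc: "cell M b ?I' j = cell M b A j"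
          using cell_cell[OF M0 b1 y'(1)] y y' by simp
        have "l * 1 \<le> (k - l + 1) * b" using bk l mult_le_mono[of 1 "k - l + 1" l b] by simp
        moreover have "\<bar>i div int M ^ (1 - 1) - j div int M ^ (b - 1)\<bar> \<ge> 2" using sep jd by simp
        moreover have "i < int M ^ 1" using i by simp
        moreover have "fact k ^ R dvd b" by (simp add: b_def)
        ultimately show ?thesis
          using K(3) c l(2) i(1) jr H b1 bH unfolding mixed_bound_def x_def v_def cc by blast
      qed
      have "mixed_moment \<Omega> h \<xi> (tri l) v ?I ?I' \<le> real M ^ (2 * ?n * b) *
          (\<Sum>j\<in>?J. K * real M powr (real ?n * x) * ?U ?I ^ tri l * ?U (cell M b ?I' j) ^ v)"
        using piece by (intro order_trans[OF split] mult_left_mono sum_mono) auto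
      also have "\<dots> = real M ^ (2 * ?n * b) * (K * real M powr (real ?n * x) * ?U ?I ^ tri l * (\<Sum>j\<in>?J. ?U (cell M b ?I' j) ^ v))"
        by (simp add: sum_distrib_left)
      also have "\<dots> \<le> real M ^ (2 * ?n * b) * (K * real M powr (real ?n * x) * ?U ?I ^ tri l * (\<Sum>j\<in>?J. ?U (cell M b ?I' j)) ^ v)"
        using fin v K by (intro mult_left_mono sum_power_le_power_sum) auto
      also have "(\<Sum>j\<in>?J. ?U (cell M b ?I' j)) = ?U ?I'"
        using fin by (subst cellsum_refine[OF M0 bH', symmetric]) auto
      also have "real M ^ (2 * ?n * b) * (K * real M powr (real ?n * x) * ?U ?I ^ tri l * ?U ?I' ^ v)
          \<le> real M ^ (2 * ?n * b) * (K * real M powr (real ?n * x) * ?U A ^ tri l * ?U A ^ v)"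
        using UI K by (intro mult_left_mono mult_mono power_mono) auto
      also have "\<dots> = K * (real M powr (real ?n * (2 * real b)) * real M powr (real ?n * x)) * ?U A ^ ?n"
      proof -
        have "real M ^ (2 * ?n * b) = real M powr (real ?n * (2 * real b))"
          using M0 by (simp add: mult_ac flip: powr_realpow)
        thus ?thesis unfolding v(1)[symmetric] power_add by (simp add: mult_ac)
      qed
      also have "\<dots> \<le> K * real M powr (real ?n * ((\<eta> - 2 * \<kappa>) * real H)) * ?U A ^ ?n"
      proof (intro mult_right_mono mult_left_mono)
        \<comment> \<open>The balance: cutting costs \<open>2 b\<close>, the gain returns at least
          \<open>4 b\<close>, and the lower degree decouplings cost
          \<open>\<iota> R H = 2 \<kappa> H\<close>. Since \<open>2 b \<ge> 4 \<kappa> H\<close>, a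
          saving of \<open>2 \<kappa> H\<close> remains.\<close>
        have "4 * real b \<le> (\<eta> * gain k R l) * real b" using gain4 by (intro mult_right_mono) auto
        moreover have "\<iota> * real R * real H = 2 * (\<kappa> * real H)" using R0 by (simp add: \<iota>_def \<kappa>_def)
        moreover have "4 * (\<kappa> * real H) \<le> 2 * real b" using b2 k by (simp add: \<kappa>_def field_simps)
        moreover have "x = \<eta> * real H - (\<eta> * gain k R l) * real b + \<iota> * real R * real H"
          by (simp add: x_def algebra_simps)
        moreover have "(\<eta> - 2 * \<kappa>) * real H = \<eta> * real H - 2 * (\<kappa> * real H)"
          by (simp add: algebra_simps)
        ultimately have "2 * real b + x \<le> (\<eta> - 2 * \<kappa>) * real H" by linarith
        hence "real ?n * (2 * real b) + real ?n * x \<le> real ?n * ((\<eta> - 2 * \<kappa>) * real H)"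
          unfolding distrib_left[symmetric] by (intro mult_left_mono) auto
        thus "real M powr (real ?n * (2 * real b)) * real M powr (real ?n * x) \<le> real M powr (real ?n * ((\<eta> - 2 * \<kappa>) * real H))"
          unfolding powr_add[symmetric] using M1 by (intro powr_mono) auto
      qed (use K in auto)
      also have "real M powr (real ?n * ((\<eta> - 2 * \<kappa>) * real H)) = ?G ^ ?n"
        using M0 by (subst powr_power) auto
      also have "K * ?G ^ ?n * ?U A ^ ?n \<le> C2 ^ ?n * ?G ^ ?n * ?U A ^ ?n"
      proof (intro mult_right_mono)
        have "C2 ^ 1 \<le> C2 ^ ?n" using C2 tri_pos[of k] k by (intro power_increasing) auto
        thus "K \<le> C2 ^ ?n" using C2K by simp
      qed auto
      finally show ?thesis by (simp add: v_def power_mult_distrib)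
    qed
  qed
qed


lemma decouples_mono:
  assumes "decouples k \<Lambda> M \<eta> C" "\<eta> \<le> \<eta>'" "C \<le> C'" "C \<ge> 0" "M > 0"
  shows "decouples k \<Lambda> M \<eta>' C'"
  unfolding decouples_def
proof (intro allI impI)
  fix H \<Omega> h \<xi> g A assume c: "config k \<Lambda> M H \<Omega> h \<xi> g A"
  have "C * real M powr (\<eta> * real H) * cellsum \<Omega> h (tri k) \<xi> M H A
     \<le> C' * real M powr (\<eta>' * real H) * cellsum \<Omega> h (tri k) \<xi> M H A"
    using assms by (intro mult_right_mono mult_mono powr_mono) auto
  thus "sqnorm \<Omega> h (tri k) (expsum \<xi> A) \<le> C' * real M powr (\<eta>' * real H) * cellsum \<Omega> h (tri k) \<xi> M H A"
    using decouplesD[OF assms(1) c] by linarith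
qed

lemma decouples_trivial:
  assumes "M > 0" "k > 0"
  shows "decouples k \<Lambda> M 2 1"
  unfolding decouples_def
proof (intro allI impI)
  fix H \<Omega> h \<xi> g A assume c: "config k \<Lambda> M H \<Omega> h \<xi> g A"
  note fin = config_finite[OF c]
  have n: "tri k > 0" using assms(2) by (rule tri_pos)
  have "sqnorm \<Omega> h (tri k) (expsum \<xi> A) \<le> real M ^ (2 * H) * cellsum \<Omega> h (tri k) \<xi> M (0 + H) A"
    using cellsum_coarse_le[OF config_nonneg[OF c] n assms(1) fin(1), where t = 0 and s = H and \<xi> = \<xi>]
    unfolding cellsum_0[OF assms(1) fin(3) n] .
  thus "sqnorm \<Omega> h (tri k) (expsum \<xi> A) \<le> 1 * real M powr (2 * real H) * cellsum \<Omega> h (tri k) \<xi> M H A"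
    using assms(1) by (simp flip: powr_realpow)
qed

lemma moment_broad_narrow:
  assumes c: "config k \<Lambda> M H \<Omega> h \<xi> g A" and M: "M > 0" and pq: "p + q = n" "n > 0"
  shows "moment \<Omega> h n (expsum \<xi> A) \<le> 6 ^ (2 * n) * (\<Sum>i\<in>idx M 1 ` A. moment \<Omega> h n (expsum \<xi> (cell M 1 A i)))
    + (2 * real M) ^ (2 * n) * (\<Sum>(i, j)\<in>{(i, j) \<in> (idx M 1 ` A) \<times> (idx M 1 ` A). \<bar>i - j\<bar> \<ge> 2}.
         mixed_moment \<Omega> h \<xi> p q (cell M 1 A i) (cell M 1 A j))"
proof -
  let ?I = "idx M 1 ` A"
  define S where "S = {(i, j) \<in> ?I \<times> ?I. \<bar>i - j\<bar> \<ge> 2}"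
  note fin = config_finite[OF c]
  have cI: "card ?I \<le> M"
  proof -
    have "?I \<subseteq> {0..<int M}" using idx_bounds[OF M, of _ 1] fin by force
    from card_mono[OF _ this] show ?thesis by simp
  qed
  have "moment \<Omega> h n (expsum \<xi> A) \<le> (\<Sum>\<omega>\<in>\<Omega>. h \<omega> * (6 ^ (2 * n) * (\<Sum>i\<in>?I. cmod (expsum \<xi> (cell M 1 A i) \<omega>) ^ (2 * n))
     + (2 * real M) ^ (2 * n) * (\<Sum>(i, j)\<in>S. cmod (expsum \<xi> (cell M 1 A i) \<omega>) ^ (2 * p) * cmod (expsum \<xi> (cell M 1 A j) \<omega>) ^ (2 * q))))"
    unfolding moment_def S_def
  proof (intro sum_mono mult_left_mono config_nonneg[OF c])
    fix \<omega>
    have M1: "M \<ge> 1" using M by simp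
    show "cmod (expsum \<xi> A \<omega>) ^ (2 * n) \<le> 6 ^ (2 * n) * (\<Sum>i\<in>?I. cmod (expsum \<xi> (cell M 1 A i) \<omega>) ^ (2 * n))
     + (2 * real M) ^ (2 * n) * (\<Sum>(i, j)\<in>{(i, j) \<in> ?I \<times> ?I. \<bar>i - j\<bar> \<ge> 2}. cmod (expsum \<xi> (cell M 1 A i) \<omega>) ^ (2 * p) * cmod (expsum \<xi> (cell M 1 A j) \<omega>) ^ (2 * q))"
      unfolding expsum_cells[OF fin(1), of \<xi> M 1] by (rule broad_or_narrow[OF finite_imageI[OF fin(1)] cI pq M1])
  qed
  also have "\<dots> = 6 ^ (2 * n) * (\<Sum>\<omega>\<in>\<Omega>. \<Sum>i\<in>?I. h \<omega> * cmod (expsum \<xi> (cell M 1 A i) \<omega>) ^ (2 * n))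
     + (2 * real M) ^ (2 * n) * (\<Sum>\<omega>\<in>\<Omega>. \<Sum>(i, j)\<in>S. h \<omega> * cmod (expsum \<xi> (cell M 1 A i) \<omega>) ^ (2 * p) * cmod (expsum \<xi> (cell M 1 A j) \<omega>) ^ (2 * q))"
    by (simp add: distrib_left sum.distrib sum_distrib_left case_prod_unfold mult_ac)
  also have "(\<Sum>\<omega>\<in>\<Omega>. \<Sum>i\<in>?I. h \<omega> * cmod (expsum \<xi> (cell M 1 A i) \<omega>) ^ (2 * n)) = (\<Sum>i\<in>?I. moment \<Omega> h n (expsum \<xi> (cell M 1 A i)))"
    unfolding moment_def by (rule sum.swap)
  also have "(\<Sum>\<omega>\<in>\<Omega>. \<Sum>(i, j)\<in>S. h \<omega> * cmod (expsum \<xi> (cell M 1 A i) \<omega>) ^ (2 * p) * cmod (expsum \<xi> (cell M 1 A j) \<omega>) ^ (2 * q))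
      = (\<Sum>(i, j)\<in>S. mixed_moment \<Omega> h \<xi> p q (cell M 1 A i) (cell M 1 A j))"
    unfolding mixed_moment_def case_prod_unfold by (rule sum.swap)
  finally show ?thesis unfolding S_def .
qed

text \<open>Induction over the number of scales with a constant fixed in advance. The narrow part is
  a sum over cells of length \<open>1 / M\<close>, which are rescaled and handled by the induction
  hypothesis; the broad part consists of boundedly many separated pairs and already has a better
  exponent.\<close>

lemma decouples_improve:
  fixes R :: nat
  assumes k: "k \<ge> 2" and \<epsilon>: "\<epsilon> > 0" and R: "real R \<ge> 4 * real k / \<epsilon>" and \<eta>: "\<eta> \<ge> \<epsilon>"
  assumes decl: "\<And>l. 1 \<le> l \<Longrightarrow> l < k \<Longrightarrow> decouples l (2 ^ k * \<Lambda>) M (1 / (2 * real R * real k ^ R)) C" and C: "C \<ge> 1"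
    and decouples: "decouples k \<Lambda> M \<eta> C\<^sub>0" and C0: "C\<^sub>0 \<ge> 1"
    and M: "real M \<ge> 1 + real (tri k) * \<Lambda>" and \<Lambda>: "\<Lambda> \<ge> 0" and M72: "real M powr (\<epsilon> / 2) \<ge> 72"
  obtains C\<^sub>1 where "C\<^sub>1 \<ge> 1" "decouples k \<Lambda> M (\<eta> - 1 / (4 * real k ^ R)) C\<^sub>1"
proof -
  define \<kappa> where "\<kappa> = 1 / (4 * real k ^ R)"
  let ?n = "tri k"
  have n: "?n > 0" using k by (intro tri_pos) auto
  have \<kappa>0: "\<kappa> > 0" using k by (simp add: \<kappa>_def)
  have \<kappa>: "\<kappa> \<le> \<epsilon> / 2"
  proof -
    have "real R \<le> 2 ^ R" using of_nat_less_two_power[of R, where ?'a = real] by simp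
    also have "\<dots> \<le> real k ^ R" using k by (intro power_mono) auto
    finally have "4 * real k / \<epsilon> \<le> real k ^ R" using R by linarith
    moreover have "2 / (4 * \<epsilon>) \<le> 4 * real k / \<epsilon>" using k \<epsilon> by (simp add: field_simps)
    ultimately have "2 / (4 * \<epsilon>) \<le> real k ^ R" by linarith
    thus ?thesis using \<epsilon> k by (simp add: \<kappa>_def field_simps)
  qed
  have M1: "real M \<ge> 1" using M \<Lambda> by (smt (verit) mult_nonneg_nonneg of_nat_0_le_iff)
  have M0: "M > 0" using M1 by (cases M) auto
  obtain l C\<^sub>2 where C2: "C\<^sub>2 \<ge> 1" and l: "1 \<le> l" "l < k" and
    broad: "\<And>H \<Omega> h \<xi> g A i i'. config k \<Lambda> M H \<Omega> h \<xi> g A \<Longrightarrow> H \<ge> 1 \<Longrightarrow> 0 \<le> i \<Longrightarrow> i < int M \<Longrightarrow> 0 \<le> i' \<Longrightarrow> i' < int M \<Longrightarrow>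
       \<bar>i - i'\<bar> \<ge> 2 \<Longrightarrow> mixed_moment \<Omega> h \<xi> (tri l) (tri k - tri l) (cell M 1 A i) (cell M 1 A i')
         \<le> (C\<^sub>2 * real M powr ((\<eta> - 2 * \<kappa>) * real H) * cellsum \<Omega> h (tri k) \<xi> M H A) ^ tri k"
    by (rule broad_bound[OF k \<epsilon> R \<eta> decl C decouples C0 M \<Lambda>, folded \<kappa>_def]) (assumption | rule that)+
  define C\<^sub>1 where "C\<^sub>1 = 8 * real M ^ 4 * C\<^sub>2"
  have "1 * 1 * 1 \<le> C\<^sub>1" unfolding C\<^sub>1_def using M1 C2 by (intro mult_mono one_le_power) auto
  hence C1: "C\<^sub>1 \<ge> 1" by simp
  have "sqnorm \<Omega> h ?n (expsum \<xi> A) \<le> C\<^sub>1 * real M powr ((\<eta> - \<kappa>) * real H) * cellsum \<Omega> h ?n \<xi> M H A"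
    if "config k \<Lambda> M H \<Omega> h \<xi> g A" for H \<Omega> h \<xi> g A
    using that
  proof (induction H arbitrary: \<xi> g A)
    case 0
    have "1 * sqnorm \<Omega> h ?n (expsum \<xi> A) \<le> C\<^sub>1 * sqnorm \<Omega> h ?n (expsum \<xi> A)" using C1 by (intro mult_right_mono) auto
    thus ?case using cellsum_0[OF M0 config_finite(3)[OF 0] n] M0 by simp
  next
    case (Suc H)
    note c = Suc.prems
    note fin = config_finite[OF c]
    let ?U = "cellsum \<Omega> h ?n \<xi> M (Suc H)"
    let ?I = "idx M 1 ` A"
    define S where "S = {(i, j) \<in> ?I \<times> ?I. \<bar>i - j\<bar> \<ge> 2}"
    have Ib: "0 \<le> i \<and> i < int M" if "i \<in> ?I" for i
    proof -
      obtain x where "x \<in> A" "i = idx M 1 x" using \<open>i \<in> ?I\<close> by auto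
      thus ?thesis using idx_bounds[OF M0, of x 1] fin by auto
    qed
    define Y where "Y = C\<^sub>1 * real M powr ((\<eta> - \<kappa>) * real H)"
    define X where "X = C\<^sub>2 * real M powr ((\<eta> - 2 * \<kappa>) * real (Suc H)) * ?U A"
    have Y0: "Y \<ge> 0" using C1 by (simp add: Y_def)
    have X0: "X \<ge> 0" using C2 by (simp add: X_def)
    have nb: "sqnorm \<Omega> h ?n (expsum \<xi> (cell M 1 A i)) \<le> Y * ?U (cell M 1 A i)" if i: "i \<in> ?I" for i
    proof -
      have "config k \<Lambda> M (1 + H) \<Omega> h \<xi> g A" using c by simp
      from Suc.IH[OF config_rescale[OF M0 this, of i]] Ib[OF i]
      show ?thesis unfolding expsum_rescale[OF M0] cellsum_rescale[OF M0] Y_def by simp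
    qed
    have momi: "moment \<Omega> h ?n (expsum \<xi> (cell M 1 A i)) \<le> Y ^ ?n * ?U (cell M 1 A i) ^ ?n" if "i \<in> ?I" for i
      using power_mono[OF nb[OF that], of ?n] sqnorm_power[OF config_nonneg[OF c] n] by (simp add: power_mult_distrib)
    have momI: "(\<Sum>i\<in>?I. moment \<Omega> h ?n (expsum \<xi> (cell M 1 A i))) \<le> (Y * ?U A) ^ ?n"
    proof -
      have "(\<Sum>i\<in>?I. moment \<Omega> h ?n (expsum \<xi> (cell M 1 A i))) \<le> Y ^ ?n * (\<Sum>i\<in>?I. ?U (cell M 1 A i) ^ ?n)"
        unfolding sum_distrib_left using momi by (rule sum_mono)
      also have "\<dots> \<le> Y ^ ?n * (\<Sum>i\<in>?I. ?U (cell M 1 A i)) ^ ?n"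
        using Y0 fin n by (intro mult_left_mono sum_power_le_power_sum) auto
      also have "(\<Sum>i\<in>?I. ?U (cell M 1 A i)) = ?U A"
        using fin by (subst cellsum_refine[OF M0, of 1 "Suc H", symmetric]) auto
      finally show ?thesis by (simp add: power_mult_distrib)
    qed
    have bilS: "(\<Sum>(i, j)\<in>S. mixed_moment \<Omega> h \<xi> (tri l) (?n - tri l) (cell M 1 A i) (cell M 1 A j)) \<le> real M ^ 2 * X ^ ?n"
    proof -
      have Ssub: "S \<subseteq> {0..<int M} \<times> {0..<int M}" using Ib by (auto simp: S_def)
      have "mixed_moment \<Omega> h \<xi> (tri l) (?n - tri l) (cell M 1 A i) (cell M 1 A j) \<le> X ^ ?n" if "(i, j) \<in> S" for i j
        unfolding X_def
      proof (rule broad[OF c])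
        have "i \<in> {0..<int M}" "j \<in> {0..<int M}" using that Ssub by blast+
        thus "0 \<le> i" "i < int M" "0 \<le> j" "j < int M" by auto
        show "\<bar>i - j\<bar> \<ge> 2" using that by (simp add: S_def)
      qed simp
      hence "(\<Sum>(i, j)\<in>S. mixed_moment \<Omega> h \<xi> (tri l) (?n - tri l) (cell M 1 A i) (cell M 1 A j)) \<le> real (card S) * X ^ ?n"
        by (intro sum_bounded_above) auto
      also have "card S \<le> M ^ 2"
        using card_mono[OF _ Ssub] by (simp add: power2_eq_square)
      hence "real (card S) * X ^ ?n \<le> real M ^ 2 * X ^ ?n"
        using X0 by (intro mult_right_mono) (simp_all flip: of_nat_power)
      finally show ?thesis .
    qed
    have "moment \<Omega> h ?n (expsum \<xi> A) \<le> 6 ^ (2 * ?n) * (Y * ?U A) ^ ?n + (2 * real M) ^ (2 * ?n) * (real M ^ 2 * X ^ ?n)"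
      using moment_broad_narrow[OF c M0 le_add_diff_inverse[OF tri_mono[of l k]] n] momI bilS l(2)
      unfolding S_def by (smt (verit) mult_left_mono zero_le_power of_nat_0_le_iff less_imp_le)
    also have "\<dots> \<le> (36 * (Y * ?U A)) ^ ?n + (4 * real M ^ 4 * X) ^ ?n"
    proof -
      have "real M ^ 2 * 1 \<le> (real M ^ 2) ^ ?n"
        using M1 n self_le_power[of "real M ^ 2" ?n] by (simp add: one_le_power)
      hence "(4 * real M ^ 2) ^ ?n * (real M ^ 2 * X ^ ?n) \<le> (4 * real M ^ 2) ^ ?n * ((real M ^ 2) ^ ?n * X ^ ?n)"
        using X0 by (intro mult_left_mono mult_right_mono) auto
      also have "\<dots> = (4 * real M ^ 4 * X) ^ ?n"
        unfolding power_mult_distrib[symmetric] by (simp add: power2_eq_square power4_eq_xxxx mult_ac)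
      finally show ?thesis by (simp add: power_mult power_mult_distrib)
    qed
    also have "\<dots> \<le> (36 * (Y * ?U A) + 4 * real M ^ 4 * X) ^ ?n"
    proof -
      have "(\<Sum>b\<in>{False, True}. (if b then 36 * (Y * ?U A) else 4 * real M ^ 4 * X) ^ ?n)
         \<le> (\<Sum>b\<in>{False, True}. if b then 36 * (Y * ?U A) else 4 * real M ^ 4 * X) ^ ?n"
        using n X0 Y0 by (intro sum_power_le_power_sum) auto
      thus ?thesis by (simp add: add.commute)
    qed
    finally have mm: "moment \<Omega> h ?n (expsum \<xi> A) \<le> (36 * (Y * ?U A) + 4 * real M ^ 4 * X) ^ ?n" .
    have "sqnorm \<Omega> h ?n (expsum \<xi> A) \<le> 36 * (Y * ?U A) + 4 * real M ^ 4 * X"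
      by (rule sqnorm_le[OF config_nonneg[OF c] n mm]) (use X0 Y0 in auto)
    also have "\<dots> \<le> C\<^sub>1 / 2 * real M powr ((\<eta> - \<kappa>) * real (Suc H)) * ?U A + C\<^sub>1 / 2 * real M powr ((\<eta> - \<kappa>) * real (Suc H)) * ?U A"
    proof (rule add_mono)
      \<comment> \<open>One more scale enlarges the target by at least 72, twice the narrow constant
        36, so that the narrow part takes up only half of it. For this \<open>M\<close> must be
        large in terms of \<open>\<epsilon>\<close>, and
        \<open>\<kappa> \<le> \<epsilon> / 2\<close>.\<close>
      have "72 \<le> real M powr (\<eta> - \<kappa>)"
        using M72 powr_mono[of "\<epsilon> / 2" "\<eta> - \<kappa>" "real M"] \<kappa> \<eta> M1 by linarith
      hence "72 * real M powr ((\<eta> - \<kappa>) * real H) \<le> real M powr (\<eta> - \<kappa>) * real M powr ((\<eta> - \<kappa>) * real H)"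
        by (intro mult_right_mono) auto
      also have "\<dots> = real M powr ((\<eta> - \<kappa>) * real (Suc H))"
        unfolding powr_add[symmetric] by (simp add: distrib_left)
      finally have "C\<^sub>1 / 2 * (72 * real M powr ((\<eta> - \<kappa>) * real H)) * ?U A \<le> C\<^sub>1 / 2 * real M powr ((\<eta> - \<kappa>) * real (Suc H)) * ?U A"
        using C1 by (intro mult_right_mono mult_left_mono) auto
      thus "36 * (Y * ?U A) \<le> C\<^sub>1 / 2 * real M powr ((\<eta> - \<kappa>) * real (Suc H)) * ?U A" 
        unfolding Y_def by (simp add: mult_ac)
      have "real M powr ((\<eta> - 2 * \<kappa>) * real (Suc H)) \<le> real M powr ((\<eta> - \<kappa>) * real (Suc H))"
        using M1 \<kappa>0 by (intro powr_mono mult_right_mono) auto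
      hence "4 * real M ^ 4 * (C\<^sub>2 * real M powr ((\<eta> - 2 * \<kappa>) * real (Suc H)) * ?U A)
        \<le> 4 * real M ^ 4 * (C\<^sub>2 * real M powr ((\<eta> - \<kappa>) * real (Suc H)) * ?U A)"
        using C2 by (intro mult_left_mono mult_right_mono) auto
      thus "4 * real M ^ 4 * X \<le> C\<^sub>1 / 2 * real M powr ((\<eta> - \<kappa>) * real (Suc H)) * ?U A"
        unfolding X_def C\<^sub>1_def by (simp add: mult_ac)
    qed
    also have "\<dots> = C\<^sub>1 * real M powr ((\<eta> - \<kappa>) * real (Suc H)) * ?U A" by simp
    finally show ?case .
  qed
  hence "decouples k \<Lambda> M (\<eta> - \<kappa>) C\<^sub>1" unfolding decouples_def by blast
  thus ?thesis using that C1 unfolding \<kappa>_def by blast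
qed

text \<open>Each improvement lowers the exponent by an amount depending only on \<open>k\<close> and
  \<open>\<epsilon>\<close>, so finitely many lead from the trivial 2 down to
  \<open>\<epsilon>\<close>, all with the same \<open>M\<close>. The statement is for all
  \<open>\<Lambda>\<close> and \<open>\<epsilon>\<close> because lower degrees are called with
  \<open>2^k \<Lambda>\<close> and the much smaller \<open>\<iota>\<close>, and for all large
  \<open>M\<close> because one base must serve every degree up to \<open>k\<close>.\<close>

theorem decoupling:
  assumes "k \<ge> 1" "\<Lambda> \<ge> 1" "\<epsilon> > 0"
  shows "\<exists>M\<^sub>0. \<forall>M\<ge>M\<^sub>0. \<exists>C\<ge>1. decouples k \<Lambda> M \<epsilon> C"
  using assms
proof (induction k arbitrary: \<Lambda> \<epsilon> rule: less_induct)
  case (less k)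
  show ?case
  proof (cases "k = 1")
    case True
    have "decouples 1 \<Lambda> M \<epsilon> 3" if "M \<ge> 1" for M
      using decouples_mono[OF decouples_one, of M \<epsilon> 3 \<Lambda>] that less.prems by simp
    thus ?thesis unfolding True by (intro exI[of _ 1] allI impI exI[of _ 3]) auto
  next
    case False
    hence k: "k \<ge> 2" using less.prems by simp
    define R where "R = nat \<lceil>4 * real k / \<epsilon>\<rceil>"
    have R: "real R \<ge> 4 * real k / \<epsilon>" unfolding R_def by linarith
    have "4 * real k / \<epsilon> > 0" using k less.prems by simp
    hence R0: "R > 0" using R by (cases R) auto
    let ?\<iota> = "1 / (2 * real R * real k ^ R)" and ?\<kappa> = "1 / (4 * real k ^ R)"
    have \<iota>: "?\<iota> > 0" using k R0 by simp
    have \<kappa>: "?\<kappa> > 0" using k by simp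
    have \<Lambda>': "2 ^ k * \<Lambda> \<ge> 1" using mult_mono[of 1 "2 ^ k" 1 \<Lambda>] less.prems(2) by simp
    have "\<forall>l\<in>{1..<k}. \<exists>M\<^sub>0. \<forall>M\<ge>M\<^sub>0. \<exists>C\<ge>1. decouples l (2 ^ k * \<Lambda>) M ?\<iota> C"
      using less.IH \<Lambda>' \<iota> by simp
    then obtain m where m: "\<And>l M. l \<in> {1..<k} \<Longrightarrow> m l \<le> M \<Longrightarrow> \<exists>C\<ge>1. decouples l (2 ^ k * \<Lambda>) M ?\<iota> C"
      by (metis (no_types, lifting))
    define M\<^sub>0 where "M\<^sub>0 = (\<Sum>l\<in>{1..<k}. m l) + nat \<lceil>1 + real (tri k) * \<Lambda>\<rceil> + nat \<lceil>72 powr (2 / \<epsilon>)\<rceil>"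
    have "\<exists>C\<ge>1. decouples k \<Lambda> M \<epsilon> C" if M: "M \<ge> M\<^sub>0" for M
    proof -
      have Ml: "m l \<le> M" if "l \<in> {1..<k}" for l
      proof -
        have "m l \<le> (\<Sum>l\<in>{1..<k}. m l)" using that by (intro member_le_sum) auto
        thus ?thesis using M by (simp add: M\<^sub>0_def)
      qed
      have M2: "real M \<ge> 1 + real (tri k) * \<Lambda>" and M3: "real M \<ge> 72 powr (2 / \<epsilon>)"
        using M unfolding M\<^sub>0_def by linarith+
      have M1: "real M \<ge> 1" using M2 less.prems(2) by (smt (verit) mult_nonneg_nonneg of_nat_0_le_iff)
      have M0: "M > 0" using M1 by (cases M) auto
      have M72: "real M powr (\<epsilon> / 2) \<ge> 72"
      proof -
        have "(72 powr (2 / \<epsilon>)) powr (\<epsilon> / 2) \<le> real M powr (\<epsilon> / 2)"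
          using M3 less.prems by (intro powr_mono2) auto
        thus ?thesis using less.prems by (simp add: powr_powr)
      qed
      obtain c where c: "\<And>l. l \<in> {1..<k} \<Longrightarrow> c l \<ge> 1 \<and> decouples l (2 ^ k * \<Lambda>) M ?\<iota> (c l)"
      proof -
        have "\<forall>l\<in>{1..<k}. \<exists>C\<ge>1. decouples l (2 ^ k * \<Lambda>) M ?\<iota> C" using m Ml by blast
        hence "\<exists>c. \<forall>l\<in>{1..<k}. c l \<ge> 1 \<and> decouples l (2 ^ k * \<Lambda>) M ?\<iota> (c l)" by (rule bchoice)
        thus ?thesis using that by blast
      qed
      define C where "C = 1 + (\<Sum>l\<in>{1..<k}. c l)"
      have cC: "c l \<le> C" if "l \<in> {1..<k}" for l
      proof -
        have "c l \<le> (\<Sum>l\<in>{1..<k}. c l)"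
          using that c by (intro member_le_sum) (auto intro: order_trans[OF zero_le_one])
        thus ?thesis by (simp add: C_def)
      qed
      have C1: "C \<ge> 1" 
      proof -
        have "0 \<le> (\<Sum>l\<in>{1..<k}. c l)" using c by (intro sum_nonneg) (meson order_trans zero_le_one)
        thus ?thesis by (simp add: C_def)
      qed
      have decl: "decouples l (2 ^ k * \<Lambda>) M ?\<iota> C" if "1 \<le> l" "l < k" for l
        using decouples_mono[of l "2 ^ k * \<Lambda>" M ?\<iota> "c l" ?\<iota> C] c[of l] cC[of l] that M0 by auto
      have step: "\<exists>C\<ge>1. decouples k \<Lambda> M (max \<epsilon> (2 - real j * ?\<kappa>)) C" for j
      proof (induction j)
        case 0
        have "decouples k \<Lambda> M (max \<epsilon> 2) 1"
          by (rule decouples_mono[OF decouples_trivial[OF M0]]) (use k M0 in auto)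
        thus ?case by auto
      next
        case (Suc j)
        then obtain C\<^sub>0 where C0: "C\<^sub>0 \<ge> 1" "decouples k \<Lambda> M (max \<epsilon> (2 - real j * ?\<kappa>)) C\<^sub>0" by blast
        obtain C\<^sub>1 where C1': "C\<^sub>1 \<ge> 1" "decouples k \<Lambda> M (max \<epsilon> (2 - real j * ?\<kappa>) - ?\<kappa>) C\<^sub>1"
          using decouples_improve[OF k less.prems(3) R max.cobounded1 decl C1 C0(2,1) M2 _ M72] less.prems(2) by force
        have "max \<epsilon> (2 - real j * ?\<kappa>) - ?\<kappa> \<le> max \<epsilon> (2 - real (Suc j) * ?\<kappa>)"
        proof -
          have "real (Suc j) * ?\<kappa> = real j * ?\<kappa> + ?\<kappa>" by (simp only: of_nat_Suc distrib_right mult_1_left add.commute)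
          moreover have "max \<epsilon> (2 - x) - y \<le> max \<epsilon> (2 - (x + y))" if "y > 0" for x y :: real
            using that by linarith
          ultimately show ?thesis using \<kappa> by presburger
        qed
        thus ?case using decouples_mono[OF C1'(2) _ order_refl _ M0] C1' by (meson order_trans zero_le_one)
      qed
      obtain j where j: "2 < real j * ?\<kappa>" using reals_Archimedean3[OF \<kappa>] by blast
      hence "max \<epsilon> (2 - real j * ?\<kappa>) = \<epsilon>" using less.prems by simp
      thus ?thesis using step[of j] by simp
    qed
    thus ?thesis by blast
  qed
qed

section \<open>Mean values of Vinogradov systems\<close>

text \<open>Extending by zero puts the vectors into an abelian group of functions, on which
  concatenation of words acts as addition; the sumset theorems then apply to them directly.\<close>

definition psums :: "nat \<Rightarrow> real list \<Rightarrow> nat \<Rightarrow> real" where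
  "psums k xs = (\<lambda>j. if j \<in> {1..k} then \<Sum>x\<leftarrow>xs. x ^ j else 0)"

definition solutions :: "nat \<Rightarrow> nat \<Rightarrow> real set \<Rightarrow> nat" where
  "solutions k n B = card {(xs, ys) \<in> words B n \<times> words B n. psums k xs = psums k ys}"

lemma psums_append: "psums k (xs @ ys) = psums k xs + psums k ys"
  by (auto simp: psums_def fun_eq_iff)

lemma psums_eq_iff: "psums k xs = psums k ys \<longleftrightarrow> (\<forall>j\<in>{1..k}. (\<Sum>x\<leftarrow>xs. x ^ j) = (\<Sum>y\<leftarrow>ys. y ^ j))"
  unfolding psums_def fun_eq_iff by (metis (no_types, lifting))

lemma sum_list_diff_le:
  fixes f g :: "real \<Rightarrow> real"
  assumes "\<And>x. x \<in> set xs \<Longrightarrow> \<bar>f x - g x\<bar> \<le> \<delta>"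
  shows "\<bar>sum_list (map f xs) - sum_list (map g xs)\<bar> \<le> real (length xs) * \<delta>"
  using assms
proof (induction xs)
  case (Cons x xs)
  have "\<bar>f x - g x\<bar> \<le> \<delta>" using Cons.prems by simp
  moreover have "\<bar>sum_list (map f xs) - sum_list (map g xs)\<bar> \<le> real (length xs) * \<delta>"
    using Cons by simp
  ultimately show ?case by (simp add: algebra_simps)
qed simp

section \<open>An exact finite model of the system\<close>

text \<open>A single weight encodes all \<open>k\<close> equations. Two words with different power
  sums give a non-zero polynomial in \<open>z\<close>, there are finitely many such pairs, and any
  \<open>z\<close> avoiding all the roots works.\<close>

lemma real_model:
  assumes B: "finite B"
  shows "\<exists>w :: real \<Rightarrow> real. \<forall>xs\<in>words B n. \<forall>ys\<in>words B n.
    (sum_list (map w xs) = sum_list (map w ys)) = (psums k xs = psums k ys)"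
proof -
  define P where "P = (\<lambda>xs ys. \<Sum>j=1..k. monom (psums k xs j - psums k ys j) j)"
  have c: "coeff (P xs ys) j = (if j \<in> {1..k} then psums k xs j - psums k ys j else 0)" for xs ys j
    by (simp add: P_def coeff_sum)
  have P0: "P xs ys \<noteq> 0" if ne: "psums k xs \<noteq> psums k ys" for xs ys
  proof
    assume "P xs ys = 0"
    hence "psums k xs j = psums k ys j" if "j \<in> {1..k}" for j using c[of xs ys j] that by simp
    hence "psums k xs = psums k ys" by (auto simp: psums_def fun_eq_iff)
    thus False using ne by simp
  qed
  define Z where "Z = (\<Union>(xs, ys)\<in>{(xs, ys) \<in> words B n \<times> words B n. psums k xs \<noteq> psums k ys}. {z. poly (P xs ys) z = 0})"
  have "finite {(xs, ys) \<in> words B n \<times> words B n. psums k xs \<noteq> psums k ys}"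
    by (rule finite_subset[of _ "words B n \<times> words B n"]) (auto simp: finite_words[OF B])
  hence "finite Z" unfolding Z_def using P0 by (intro finite_UN_I) (auto intro: poly_roots_finite)
  then obtain z where z: "z \<notin> Z" using ex_new_if_finite[OF infinite_UNIV_char_0] by blast
  define w where "w = (\<lambda>x::real. \<Sum>j=1..k. z ^ j * x ^ j)"
  have w: "sum_list (map w xs) = (\<Sum>j=1..k. z ^ j * psums k xs j)" for xs
  proof -
    have "sum_list (map w xs) = (\<Sum>j=1..k. z ^ j * (\<Sum>x\<leftarrow>xs. x ^ j))"
      by (induction xs) (simp_all add: w_def sum.distrib distrib_left)
    also have "\<dots> = (\<Sum>j=1..k. z ^ j * psums k xs j)" by (intro sum.cong) (auto simp: psums_def)
    finally show ?thesis .
  qed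
  have "poly (P xs ys) z = sum_list (map w xs) - sum_list (map w ys)" for xs ys
    unfolding w P_def poly_sum sum_subtractf[symmetric]
    by (intro sum.cong refl) (simp add: poly_monom algebra_simps)
  hence "sum_list (map w xs) = sum_list (map w ys) \<longleftrightarrow> psums k xs = psums k ys"
    if "xs \<in> words B n" "ys \<in> words B n" for xs ys
    using z w that unfolding Z_def by fastforce
  thus ?thesis by blast
qed

text \<open>Scaled by the smallest non-zero difference, the real weights of inequivalent words
  differ by at least 1. Multiplication by a common positive integer \<open>q\<close> keeps this and
  brings all weights close to integers. Rounding then neither creates nor destroys an
  equality.\<close>

lemma integer_model:
  assumes B: "finite B"
  shows "\<exists>m :: real \<Rightarrow> int. \<forall>xs\<in>words B n. \<forall>ys\<in>words B n.
    (sum_list (map m xs) = sum_list (map m ys)) = (psums k xs = psums k ys)"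
proof -
  obtain w :: "real \<Rightarrow> real" where w': "\<forall>xs\<in>words B n. \<forall>ys\<in>words B n.
    (sum_list (map w xs) = sum_list (map w ys)) = (psums k xs = psums k ys)"
    using real_model[OF B, where n = n and k = k] ..
  note w = w'[rule_format]
  define D where "D = insert 1 ((\<lambda>(xs, ys). \<bar>sum_list (map w xs) - sum_list (map w ys)\<bar>) `
     {(xs, ys) \<in> words B n \<times> words B n. psums k xs \<noteq> psums k ys})"
  have "finite {(xs, ys) \<in> words B n \<times> words B n. psums k xs \<noteq> psums k ys}"
    by (rule finite_subset[of _ "words B n \<times> words B n"]) (auto simp: finite_words[OF B])
  hence finD: "finite D" by (simp add: D_def)
  have Dpos: "d > 0" if d: "d \<in> D" for d
  proof (cases "d = 1")
    case False
    with d have "d \<in> (\<lambda>(xs, ys). \<bar>sum_list (map w xs) - sum_list (map w ys)\<bar>) `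
      {(xs, ys) \<in> words B n \<times> words B n. psums k xs \<noteq> psums k ys}" unfolding D_def by simp
    then obtain p where p: "p \<in> {(xs, ys) \<in> words B n \<times> words B n. psums k xs \<noteq> psums k ys}"
      "d = (case p of (xs, ys) \<Rightarrow> \<bar>sum_list (map w xs) - sum_list (map w ys)\<bar>)" by (rule imageE)
    obtain xs ys where "p = (xs, ys)" by (cases p)
    thus ?thesis using p w[of xs ys] by simp
  qed simp
  define \<mu> where "\<mu> = Min D"
  have \<mu>: "\<mu> > 0" using Dpos Min_in[OF finD] by (auto simp: \<mu>_def D_def)
  have \<mu>le: "\<mu> \<le> \<bar>sum_list (map w xs) - sum_list (map w ys)\<bar>"
    if "xs \<in> words B n" "ys \<in> words B n" "psums k xs \<noteq> psums k ys" for xs ys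
    unfolding \<mu>_def using that by (intro Min_le finD) (auto simp: D_def)
  obtain b where b: "bij_betw b {0..<card B} B" using ex_bij_betw_nat_finite[OF B] by blast
  \<comment> \<open>Larger than \<open>2 n\<close>, the number of letters in two words, so that the
    rounding errors together stay below 1.\<close>
  define N where "N = 2 * n + 1"
  have "N > 0" by (simp add: N_def)
  obtain q p where q: "0 < q" and qp: "\<And>i. i < card B \<Longrightarrow> \<bar>of_int q * (w (b i) / \<mu>) - of_int (p i)\<bar> < 1 / N"
    using Dirichlet_approx_simult[OF \<open>N > 0\<close>, of "card B" "\<lambda>i. w (b i) / \<mu>"] by metis
  define m where "m = (\<lambda>x. p (inv_into {0..<card B} b x))"
  have m: "\<bar>of_int q * (w x / \<mu>) - of_int (m x)\<bar> \<le> 1 / N" if "x \<in> B" for x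
  proof -
    have "inv_into {0..<card B} b x \<in> {0..<card B}" "b (inv_into {0..<card B} b x) = x"
      using b that inv_into_into[of x b "{0..<card B}"] f_inv_into_f[of x b "{0..<card B}"]
      by (simp_all add: bij_betw_def)
    thus ?thesis using qp[of "inv_into {0..<card B} b x"] by (simp add: m_def)
  qed
  define v where "v = (\<lambda>x. of_int q * (w x / \<mu>))"
  have vs: "sum_list (map v xs) = of_int q / \<mu> * sum_list (map w xs)" for xs
    by (induction xs) (simp_all add: v_def distrib_left)
  have ms: "sum_list (map (\<lambda>x. real_of_int (m x)) xs) = of_int (sum_list (map m xs))" for xs
    by (induction xs) simp_all
  have close: "\<bar>of_int q / \<mu> * sum_list (map w xs) - of_int (sum_list (map m xs))\<bar> \<le> real n * (1 / N)" if "xs \<in> words B n" for xs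
    using sum_list_diff_le[of xs v "\<lambda>x. of_int (m x)" "1 / N"] m that
    unfolding vs ms by (auto simp: v_def words_def)
  have "sum_list (map m xs) = sum_list (map m ys) \<longleftrightarrow> psums k xs = psums k ys"
    if xs: "xs \<in> words B n" and ys: "ys \<in> words B n" for xs ys
  proof -
    let ?d = "of_int q / \<mu> * (sum_list (map w xs) - sum_list (map w ys))"
    have "real n * (1 / N) + real n * (1 / N) = real (2 * n) / real N" by simp
    also have "\<dots> < 1" by (simp add: N_def)
    finally have N1: "real n * (1 / N) + real n * (1 / N) < 1" .
    have cl: "\<bar>?d - of_int (sum_list (map m xs) - sum_list (map m ys))\<bar> < 1"
      using close[OF xs] close[OF ys] N1 by (simp add: right_diff_distrib)
    show ?thesis
    proof (cases "psums k xs = psums k ys")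
      case True
      hence "?d = 0" using w[OF xs ys] by simp
      with cl have "\<bar>real_of_int (sum_list (map m xs) - sum_list (map m ys))\<bar> < 1" by linarith
      thus ?thesis using True by linarith
    next
      case False
      have "1 * 1 \<le> real_of_int q * (\<bar>sum_list (map w xs) - sum_list (map w ys)\<bar> / \<mu>)"
        using q \<mu> \<mu>le[OF xs ys False] by (intro mult_mono) auto
      also have "\<dots> = \<bar>?d\<bar>" using q \<mu> by (simp add: abs_mult)
      finally have "1 \<le> \<bar>?d\<bar>" by simp
      hence "sum_list (map m xs) \<noteq> sum_list (map m ys)" using cl by auto
      thus ?thesis using False by simp
    qed
  qed
  thus ?thesis by blast
qed

lemma sum_cis_zero:
  fixes d :: int
  assumes "d \<noteq> 0" "\<bar>d\<bar> < int Q"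
  shows "(\<Sum>\<omega><Q. cis (2 * pi * of_int d * real \<omega> / real Q)) = 0"
proof -
  have Q: "Q > 0" using assms by (cases Q) auto
  define z where "z = cis (2 * pi * of_int d / real Q)"
  have pw: "cis (2 * pi * of_int d * real \<omega> / real Q) = z ^ \<omega>" for \<omega>
    by (simp add: z_def Complex.DeMoivre mult_ac)
  have "z ^ Q = cis (2 * pi * of_int d)" using Q by (simp add: z_def Complex.DeMoivre)
  hence zQ: "z ^ Q = 1" by (simp add: cis_multiple_2pi)
  have "z \<noteq> 1"
  proof
    assume "z = 1"
    hence "cos (2 * pi * of_int d / real Q) = 1" by (metis z_def cis.sel(1) one_complex.sel(1))
    then obtain n :: int where n: "2 * pi * of_int d / real Q = of_int n * 2 * pi" using cos_one_2pi_int by auto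
    hence "real_of_int d = of_int n * real Q" using Q by (simp add: field_simps)
    hence e: "d = n * int Q" by (metis of_int_eq_iff of_int_mult of_int_of_nat_eq)
    hence "n \<noteq> 0" using assms by auto
    hence "1 * int Q \<le> \<bar>n\<bar> * int Q" by (intro mult_right_mono) auto
    thus False using e assms by (simp add: abs_mult)
  qed
  thus ?thesis unfolding pw using zQ by (simp add: sum_gp_strict)
qed

text \<open>The integer weights are reduced modulo a \<open>Q\<close> exceeding every difference of
  two word weights, so a congruence is an equality. An average over \<open>Q\<close> roots of unity
  thereby counts real solutions exactly.\<close>

lemma character_model:
  assumes B: "finite B"
  shows "\<exists>Q \<xi>. Q > 0 \<and> (\<forall>x \<omega>. cmod (\<xi> x \<omega>) = 1) \<and> (\<forall>xs\<in>words B n. \<forall>ys\<in>words B n.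
      word_corr {..<Q} (\<lambda>_. 1) \<xi> xs ys = (if psums k xs = psums k ys then of_nat Q else 0))"
proof -
  obtain m :: "real \<Rightarrow> int" where m': "\<forall>xs\<in>words B n. \<forall>ys\<in>words B n.
    (sum_list (map m xs) = sum_list (map m ys)) = (psums k xs = psums k ys)"
    using integer_model[OF B, where n = n and k = k] ..
  note m = m'[rule_format]
  define S where "S = (\<lambda>xs :: real list. sum_list (map m xs))"
  define Q where "Q = nat (1 + 2 * (\<Sum>xs\<in>words B n. \<bar>S xs\<bar>))"
  have S0: "(\<Sum>xs\<in>words B n. \<bar>S xs\<bar>) \<ge> 0" by (intro sum_nonneg) auto
  have Q: "Q > 0" using S0 unfolding Q_def zero_less_nat_eq by linarith
  have SQ: "\<bar>S xs - S ys\<bar> < int Q" if "xs \<in> words B n" "ys \<in> words B n" for xs ys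
  proof -
    have "\<bar>S xs\<bar> \<le> (\<Sum>xs\<in>words B n. \<bar>S xs\<bar>)" "\<bar>S ys\<bar> \<le> (\<Sum>xs\<in>words B n. \<bar>S xs\<bar>)"
      using that finite_words[OF B] by (auto intro!: member_le_sum)
    thus ?thesis using S0 unfolding Q_def by linarith
  qed
  define \<xi> where "\<xi> = (\<lambda>x \<omega>. cis (2 * pi * of_int (m x) * real \<omega> / real Q))"
  have pl: "prod_list (map (\<lambda>x. \<xi> x \<omega>) xs) = cis (2 * pi * of_int (S xs) * real \<omega> / real Q)" for xs \<omega>
    by (induction xs) (simp_all add: \<xi>_def S_def cis_mult distrib_left distrib_right add_divide_distrib)
  have "word_corr {..<Q} (\<lambda>_. 1) \<xi> xs ys = (if psums k xs = psums k ys then of_nat Q else 0)"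
    if xy: "xs \<in> words B n" "ys \<in> words B n" for xs ys
  proof -
    have "word_corr {..<Q} (\<lambda>_. 1) \<xi> xs ys = (\<Sum>\<omega><Q. cis (2 * pi * of_int (S xs - S ys) * real \<omega> / real Q))"
      unfolding word_corr_def pl
      by (intro sum.cong refl) (simp add: cis_cnj cis_mult left_diff_distrib right_diff_distrib diff_divide_distrib)
    also have "\<dots> = (if S xs = S ys then of_nat Q else 0)"
      using sum_cis_zero[of "S xs - S ys" Q] SQ[OF xy] by auto
    finally show ?thesis using m[OF xy] by (simp add: S_def)
  qed
  moreover have "cmod (\<xi> x \<omega>) = 1" for x \<omega> by (simp add: \<xi>_def)
  ultimately show ?thesis using Q by blast
qed

lemma moment_eq_solutions:
  assumes B: "finite B" and w: "\<And>xs ys. xs \<in> words B n \<Longrightarrow> ys \<in> words B n \<Longrightarrow>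
      word_corr {..<Q} (\<lambda>_. 1) \<xi> xs ys = (if psums k xs = psums k ys then of_nat Q else 0)"
  shows "moment {..<Q} (\<lambda>_. 1) n (expsum \<xi> B) = real Q * real (solutions k n B)"
proof -
  have "complex_of_real (moment {..<Q} (\<lambda>_. 1) n (expsum \<xi> B)) = word_corr {..<Q} (\<lambda>\<omega>. 1 * cmod (expsum \<xi> B \<omega>) ^ (2 * n)) \<xi> [] []"
    by (simp add: moment_def word_corr_def)
  also have "\<dots> = (\<Sum>xs\<in>words B n. \<Sum>ys\<in>words B n. if psums k xs = psums k ys then of_nat Q else 0)"
    unfolding word_corr_weight[OF B] using w by (intro sum.cong refl) simp
  also have "\<dots> = (\<Sum>p\<in>words B n \<times> words B n. if psums k (fst p) = psums k (snd p) then of_nat Q else 0)"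
    by (simp add: sum.cartesian_product case_prod_unfold)
  also have "\<dots> = of_nat (card {p \<in> words B n \<times> words B n. psums k (fst p) = psums k (snd p)}) * of_nat Q"
    using finite_words[OF B] by (simp add: sum.If_cases Int_def)
  also have "{p \<in> words B n \<times> words B n. psums k (fst p) = psums k (snd p)} = {(xs, ys) \<in> words B n \<times> words B n. psums k xs = psums k ys}"
    by auto
  finally have "complex_of_real (moment {..<Q} (\<lambda>_. 1) n (expsum \<xi> B)) = complex_of_real (real Q * real (solutions k n B))"
    by (simp add: solutions_def)
  thus ?thesis by (simp only: of_real_eq_iff)
qed

text \<open>Up to a constant, the potential is a polynomial of degree at most \<open>k\<close>
  without constant term; equal lengths take care of the constant. Exact solutions thus satisfy
  \<open>limited\<close> with every tolerance.\<close>

lemma sum_potential_eq: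
  fixes \<Psi> :: "real \<Rightarrow> real"
  assumes "length zs < k" "\<And>u. (\<Psi> has_real_derivative \<kappa> * prod_list (map (\<lambda>z. u - z) zs)) (at u)"
    and psums: "psums k xs = psums k ys" "length xs = length ys"
  shows "sum_list (map \<Psi> xs) = sum_list (map \<Psi> ys)"
proof -
  define q where "q = smult \<kappa> (prod_list (map (\<lambda>z. [:-z, 1:]) zs))"
  have pq: "poly q u = \<kappa> * prod_list (map (\<lambda>z. u - z) zs)" for u
  proof -
    have "poly (prod_list (map (\<lambda>z. [:-z, 1:]) zs)) u = prod_list (map (\<lambda>z. u - z) zs)"
      by (induction zs) (simp_all add: algebra_simps)
    thus ?thesis by (simp add: q_def)
  qed
  have "degree (prod_list (map (\<lambda>z. [:-z, 1 :: real:]) zs)) \<le> length zs"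
  proof (induction zs)
    case (Cons z zs)
    have "degree ([:-z, 1:] * prod_list (map (\<lambda>z. [:-z, 1 :: real:]) zs)) \<le> degree [:-z, 1::real:] + degree (prod_list (map (\<lambda>z. [:-z, 1 :: real:]) zs))"
      by (rule degree_mult_le)
    thus ?case using Cons by simp
  qed simp
  hence dq: "degree q < k" using assms(1) degree_smult_le[of \<kappa>] unfolding q_def by (metis le_less_trans le_trans)
  define P where "P = (\<lambda>u::real. \<Sum>i\<le>degree q. coeff q i / real (i + 1) * u ^ (i + 1))"
  have "(P has_real_derivative poly q u) (at u)" for u
  proof -
    have D: "(P has_real_derivative (\<Sum>i\<le>degree q. coeff q i / real (i + 1) * (real (i + 1) * u ^ i))) (at u)"
      unfolding P_def
    proof (intro DERIV_sum DERIV_cmult)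
      fix i show "((\<lambda>u. u ^ (i + 1)) has_real_derivative real (i + 1) * u ^ i) (at u)"
        using DERIV_pow[of "i + 1" u UNIV] by simp
    qed
    have e: "(\<Sum>i\<le>degree q. coeff q i / real (i + 1) * (real (i + 1) * u ^ i)) = poly q u"
      unfolding poly_altdef by (intro sum.cong refl) (simp del: of_nat_add)
    show ?thesis using D unfolding e .
  qed
  hence "((\<lambda>u. \<Psi> u - P u) has_real_derivative 0) (at u)" for u
    using assms(2)[of u] DERIV_diff unfolding pq by fastforce
  then obtain c where c: "\<And>u. \<Psi> u - P u = c" by (metis DERIV_isconst_all)
  have \<Psi>: "\<Psi> u = c + P u" for u using c[of u] by simp
  have S: "sum_list (map \<Psi> us) = real (length us) * c + (\<Sum>i\<le>degree q. coeff q i / real (i + 1) * (\<Sum>u\<leftarrow>us. u ^ (i + 1)))" for us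
    by (induction us) (simp_all add: \<Psi> P_def distrib_left distrib_right sum.distrib del: of_nat_add power_Suc)
  show ?thesis unfolding S psums(2)
  proof (intro arg_cong2[where f = "(+)"] refl sum.cong arg_cong2[where f = "(*)"])
    fix i assume "i \<in> {..degree q}"
    hence "i + 1 \<in> {1..k}" using dq by auto
    thus "(\<Sum>u\<leftarrow>xs. u ^ (i + 1)) = (\<Sum>u\<leftarrow>ys. u ^ (i + 1))" using psums(1) unfolding psums_eq_iff by blast
  qed
qed


text \<open>Decoupling down to unit intervals, where each sum has at most two terms. Apart from
  \<open>X powr \<epsilon>\<close> the bound depends on \<open>card B\<close> and not on the length
  of the interval, so it is as strong for sparse subsets; the cone argument needs it for
  these.\<close>

lemma mean_value:
  assumes k: "k \<ge> 1" and \<epsilon>: "\<epsilon> > 0"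
  obtains C where "C > 0"
    "\<And>B c X :: real. finite B \<Longrightarrow> X \<ge> 1 \<Longrightarrow> B \<subseteq> {c..<c + X} \<Longrightarrow> (\<And>y. card (B \<inter> {y..<y + 1}) \<le> 2) \<Longrightarrow>
       real (solutions k (tri k) B) \<le> C * X powr \<epsilon> * real (card B) ^ tri k"
proof -
  let ?n = "tri k"
  have n: "?n > 0" using k by (intro tri_pos) auto
  \<comment> \<open>The decoupling estimate is for squared norms and gets raised to the power
    \<open>tri k\<close>.\<close>
  define \<epsilon>' where "\<epsilon>' = \<epsilon> / real ?n"
  have \<epsilon>': "\<epsilon>' > 0" "\<epsilon>' * real ?n = \<epsilon>" using \<epsilon> n by (simp_all add: \<epsilon>'_def)
  obtain M\<^sub>0 where "\<And>M. M \<ge> M\<^sub>0 \<Longrightarrow> \<exists>C\<ge>1. decouples k 1 M \<epsilon>' C"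
    using decoupling[OF k order_refl \<epsilon>'(1)] by blast
  then obtain C where C: "C \<ge> 1" "decouples k 1 (M\<^sub>0 + 2) \<epsilon>' C" by (meson le_add1)
  define M where "M = M\<^sub>0 + 2"
  have M: "M \<ge> 2" "M > 0" by (simp_all add: M_def)
  note decouples = C(2)[folded M_def]
  define C' where "C' = (4 * C) ^ ?n * real M powr \<epsilon>"
  show ?thesis
  proof (rule that[of C'])
    show "C' > 0" using C M by (simp add: C'_def)
    fix B and c X :: real
    assume B: "finite B" and X: "X \<ge> 1" and BX: "B \<subseteq> {c..<c + X}"
      and sp: "\<And>y. card (B \<inter> {y..<y + 1}) \<le> 2"
    \<comment> \<open>The least number of scales with \<open>M^H \<ge> X\<close>. After division by
      \<open>M^H\<close> the cells of level \<open>H\<close> correspond to intervals of length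
      1.\<close>
    define H where "H = nat \<lceil>log M X\<rceil>"
    have log0: "log M X \<ge> 0" using X M by (simp add: zero_le_log_cancel_iff)
    have H1: "X \<le> real M ^ H"
    proof -
      have "X = real M powr log M X" using X M by simp
      also have "\<dots> \<le> real M powr real H" using M unfolding H_def by (intro powr_mono) linarith+
      finally show ?thesis using M by (simp add: powr_realpow)
    qed
    have H2: "real M ^ H \<le> real M * X"
    proof -
      have "real M powr real H \<le> real M powr (1 + log M X)" using M log0 unfolding H_def by (intro powr_mono) linarith+
      also have "\<dots> = real M * X" using X M by (simp add: powr_add)
      finally show ?thesis using M by (simp add: powr_realpow)
    qed
    obtain Q \<xi> where Q\<xi>: "Q > 0 \<and> (\<forall>x \<omega>. cmod (\<xi> x \<omega>) = 1) \<and> (\<forall>xs\<in>words B ?n. \<forall>ys\<in>words B ?n.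
      word_corr {..<Q} (\<lambda>_. 1) \<xi> xs ys = (if psums k xs = psums k ys then of_nat Q else 0))"
      using character_model[OF B, where n = ?n and k = k] by (elim exE)
    note Q = Q\<xi>[THEN conjunct1] and \<xi> = Q\<xi>[THEN conjunct2, THEN conjunct1, rule_format]
      and w = Q\<xi>[THEN conjunct2, THEN conjunct2, rule_format]
    define R where "R = real M ^ H"
    have R: "R > 0" using M by (simp add: R_def)
    define aff where "aff = (\<lambda>w. w * R + c)"
    define ffa where "ffa = (\<lambda>x. (x - c) / R)"
    have af: "aff (ffa x) = x" "ffa (aff x) = x" for x using R by (simp_all add: aff_def ffa_def)
    define A where "A = ffa ` B"
    let ?\<xi> = "\<lambda>w. \<xi> (aff w)"
    have es: "expsum ?\<xi> (ffa ` D) = expsum \<xi> D" for D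
    proof -
      have "inj_on ffa D" by (metis af(1) inj_onI)
      thus ?thesis by (auto simp: expsum_def sum.reindex af fun_eq_iff)
    qed
    have cfg: "config k 1 M H {..<Q} (\<lambda>_. 1) ?\<xi> (\<lambda>_. 1) A"
      unfolding config_def
    proof (intro conjI)
      show "A \<subseteq> {0..<1}"
      proof
        fix w assume "w \<in> A"
        then obtain x where x: "x \<in> B" "w = (x - c) / R" by (auto simp: A_def ffa_def)
        hence "0 \<le> x - c" "x - c < R" using BX H1 by (auto simp: R_def)
        thus "w \<in> {0..<1}" using R x by simp
      qed
      show "limited k (\<lambda>_. 1) (1 / real M ^ (k * H)) {..<Q} (\<lambda>_. 1) ?\<xi> A"
        unfolding limited_def
      proof (intro ballI impI allI)
        fix xs ys zs \<Phi>
        assume xs: "xs \<in> words A ?n" and ys: "ys \<in> words A ?n" and nz: "word_corr {..<Q} (\<lambda>_. 1) ?\<xi> xs ys \<noteq> 0"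
          and zs: "length zs < k" and \<Phi>: "\<forall>u. (\<Phi> has_real_derivative 1 * prod_list (map (\<lambda>z. u - z) zs)) (at u)"
        have W: "map aff us \<in> words B ?n" if "us \<in> words A ?n" for us
          using that af(1) by (fastforce simp: words_def A_def)
        have pvq: "psums k (map aff xs) = psums k (map aff ys)"
          using nz w[OF W[OF xs] W[OF ys]] unfolding word_corr_rescale by (simp split: if_splits)
        have D: "((\<lambda>u. 1 * \<Phi> (u * (1 / R) - c / R)) has_real_derivative
          (1 * (1 / R) ^ (1 + length zs)) * 1 * prod_list (map (\<lambda>z. u - z) (map (\<lambda>z. (z + c / R) / (1 / R)) zs))) (at u)" for u
          using deriv_rescale[of "1 / R" \<Phi> "\<lambda>_. 1" zs 1 "c / R" u] R \<Phi> by simp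
        have ff: "(\<lambda>u. 1 * \<Phi> (u * (1 / R) - c / R)) = (\<lambda>u. \<Phi> (ffa u))"
          by (simp add: ffa_def diff_divide_distrib)
        have "sum_list (map (\<lambda>u. \<Phi> (ffa u)) (map aff xs)) = sum_list (map (\<lambda>u. \<Phi> (ffa u)) (map aff ys))"
          by (rule sum_potential_eq[OF _ D[unfolded ff mult_1_right] pvq]) (use zs xs ys in \<open>auto simp: words_def\<close>)
        thus "\<bar>sum_list (map \<Phi> xs) - sum_list (map \<Phi> ys)\<bar> \<le> 1 / real M ^ (k * H)"
          by (simp add: o_def af)
      qed
    qed (use B in \<open>auto simp: A_def\<close>)
    have A: "finite A" "card A = card B"
      using B by (auto simp: A_def intro!: card_image inj_onI) (metis af(1))
    have cellb: "sqnorm {..<Q} (\<lambda>_. 1) ?n (expsum ?\<xi> (cell M H A i)) \<le> 4 * real Q powr (1 / real ?n)" for i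
    proof (rule sqnorm_le)
      have cardc: "card (cell M H A i) \<le> 2"
      proof -
        have "cell M H A i = ffa ` (B \<inter> {c + of_int i..<c + of_int i + 1})"
          using R by (auto simp: cell_def A_def idx_def ffa_def floor_eq_iff R_def[symmetric])
        hence "card (cell M H A i) \<le> card (B \<inter> {c + of_int i..<c + of_int i + 1})"
          using B by (simp add: card_image_le)
        thus ?thesis using sp le_trans by blast
      qed
      have "cmod (expsum ?\<xi> (cell M H A i) \<omega>) \<le> 2" for \<omega>
      proof -
        have "cmod (expsum ?\<xi> (cell M H A i) \<omega>) \<le> (\<Sum>x\<in>cell M H A i. cmod (\<xi> (aff x) \<omega>))"
          unfolding expsum_def by (rule norm_sum)
        thus ?thesis using \<xi> cardc by simp
      qed
      hence "moment {..<Q} (\<lambda>_. 1) ?n (expsum ?\<xi> (cell M H A i)) \<le> (\<Sum>\<omega><Q. 1 * 2 ^ (2 * ?n))"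
        unfolding moment_def by (intro sum_mono mult_left_mono power_mono) auto
      also have "\<dots> = (4 * real Q powr (1 / real ?n)) ^ ?n"
        using Q n by (simp add: power_mult power_mult_distrib powr_power)
      finally show "moment {..<Q} (\<lambda>_. 1) ?n (expsum ?\<xi> (cell M H A i)) \<le> (4 * real Q powr (1 / real ?n)) ^ ?n" .
    qed (use n in auto)
    have ds: "cellsum {..<Q} (\<lambda>_. 1) ?n ?\<xi> M H A \<le> real (card B) * (4 * real Q powr (1 / real ?n))"
    proof -
      have "cellsum {..<Q} (\<lambda>_. 1) ?n ?\<xi> M H A \<le> real (card (idx M H ` A)) * (4 * real Q powr (1 / real ?n))"
        unfolding cellsum_def using cellb by (rule sum_bounded_above)
      also have "\<dots> \<le> real (card B) * (4 * real Q powr (1 / real ?n))"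
        using card_image_le[OF A(1), of "idx M H"] A(2) by (intro mult_right_mono) auto
      finally show ?thesis .
    qed
    have "real Q * real (solutions k ?n B) = moment {..<Q} (\<lambda>_. 1) ?n (expsum ?\<xi> A)"
      unfolding A_def es by (rule moment_eq_solutions[OF B w, symmetric])
    also have "\<dots> = sqnorm {..<Q} (\<lambda>_. 1) ?n (expsum ?\<xi> A) ^ ?n" using n by (simp add: sqnorm_power)
    also have "\<dots> \<le> (C * real M powr (\<epsilon>' * real H) * (real (card B) * (4 * real Q powr (1 / real ?n)))) ^ ?n"
      using decouplesD[OF decouples cfg] ds C by (intro power_mono order_trans[OF decouplesD[OF decouples cfg]] mult_left_mono) auto
    also have "\<dots> = real Q * ((4 * C) ^ ?n * (real M ^ H) powr \<epsilon> * real (card B) ^ ?n)"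
    proof -
      have "(real Q powr (1 / real ?n)) ^ ?n = real Q" using Q n by (simp add: powr_power)
      moreover have "(real M powr (\<epsilon>' * real H)) ^ ?n = (real M ^ H) powr \<epsilon>"
        unfolding \<epsilon>'(2)[symmetric] using M by (simp add: powr_power powr_powr mult_ac flip: powr_realpow)
      ultimately show ?thesis by (simp add: power_mult_distrib mult_ac)
    qed
    finally have "real (solutions k ?n B) \<le> (4 * C) ^ ?n * (real M ^ H) powr \<epsilon> * real (card B) ^ ?n"
      using Q by (simp add: mult_le_cancel_left)
    also have "\<dots> \<le> (4 * C) ^ ?n * (real M * X) powr \<epsilon> * real (card B) ^ ?n"
      using C H2 \<epsilon> by (intro mult_right_mono mult_left_mono powr_mono2) auto
    also have "\<dots> = C' * X powr \<epsilon> * real (card B) ^ ?n"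
      using X by (simp add: C'_def powr_mult mult_ac)
    finally show "real (solutions k ?n B) \<le> C' * X powr \<epsilon> * real (card B) ^ ?n" .
  qed
qed

section \<open>From additive energy to small sumsets\<close>

lemma card_eq_sum_fibres:
  assumes "finite X"
  shows "card {(x, y) \<in> X \<times> X. f x = f y} = (\<Sum>v\<in>f ` X. card {x \<in> X. f x = v} ^ 2)"
proof -
  have "{(x, y) \<in> X \<times> X. f x = f y} = (SIGMA x:X. {y \<in> X. f y = f x})" by auto
  hence "card {(x, y) \<in> X \<times> X. f x = f y} = (\<Sum>x\<in>X. card {y \<in> X. f y = f x})"
    using assms by simp
  also have "\<dots> = (\<Sum>v\<in>f ` X. \<Sum>x\<in>{x \<in> X. f x = v}. card {y \<in> X. f y = f x})"
    by (rule sum.image_gen[OF assms])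
  also have "\<dots> = (\<Sum>v\<in>f ` X. card {x \<in> X. f x = v} ^ 2)"
    by (intro sum.cong refl) (simp add: power2_eq_square)
  finally show ?thesis .
qed

lemma card_sum_fibres:
  assumes "finite X"
  shows "card X = (\<Sum>v\<in>f ` X. card {x \<in> X. f x = v})"
  using sum.image_gen[OF assms, of "\<lambda>_. 1 :: nat" f] by simp

text \<open>Cauchy-Schwarz over the fibres of \<open>f\<close>. It turns energy bounds into lower
  bounds for images, first for sums and finally for ratios and products.\<close>

lemma card_square_le_collisions:
  assumes "finite X"
  shows "real (card X) ^ 2 \<le> real (card (f ` X)) * real (card {(x, y) \<in> X \<times> X. f x = f y})"
proof -
  have "(\<Sum>v\<in>f ` X. 1 * real (card {x \<in> X. f x = v})) ^ 2
    \<le> (\<Sum>v\<in>f ` X. 1 ^ 2) * (\<Sum>v\<in>f ` X. real (card {x \<in> X. f x = v}) ^ 2)"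
    by (rule Cauchy_Schwarz_ineq_sum)
  thus ?thesis unfolding card_eq_sum_fibres[OF assms] card_sum_fibres[OF assms, of f] by simp
qed

lemma sum_card_swap:
  assumes "finite X" "finite Y"
  shows "(\<Sum>x\<in>X. card {y \<in> Y. R x y}) = (\<Sum>y\<in>Y. card {x \<in> X. R x y})"
proof -
  have "(\<Sum>x\<in>X. card {y \<in> Y. R x y}) = (\<Sum>x\<in>X. \<Sum>y\<in>Y. if R x y then 1 else 0)"
    using assms by (intro sum.cong refl) (simp add: sum.If_cases Int_def)
  also have "\<dots> = (\<Sum>y\<in>Y. \<Sum>x\<in>X. if R x y then 1 else 0)" by (rule sum.swap)
  also have "\<dots> = (\<Sum>y\<in>Y. card {x \<in> X. R x y})"
    using assms by (intro sum.cong refl) (simp add: sum.If_cases Int_def)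
  finally show ?thesis .
qed

text \<open>Dependent random choice: the neighbourhood \<open>N y\<close> of a suitable vertex \<open>y\<close> contains few
  pairs with small codegree.\<close>

lemma many_paths:
  fixes R :: "'a \<Rightarrow> 'a \<Rightarrow> bool" and \<delta> :: real
  assumes W: "finite W" "W \<noteq> {}" and \<delta>: "0 < \<delta>" "\<delta> \<le> 1"
    and dense: "real (card {(x, y) \<in> W \<times> W. R x y}) \<ge> \<delta> * real (card W) ^ 2"
  obtains X Y where "X \<subseteq> W" "Y \<subseteq> W" "real (card X) \<ge> \<delta> / 8 * real (card W)" "real (card Y) \<ge> \<delta> / 4 * real (card W)"
    "\<And>x y. x \<in> X \<Longrightarrow> y \<in> Y \<Longrightarrow>
       real (card {(y', x') \<in> W \<times> W. R x y' \<and> R x' y' \<and> R x' y}) \<ge> \<delta> ^ 5 / 4096 * real (card W) ^ 2"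
proof -
  define w where "w = real (card W)"
  have w: "w > 0" using W by (simp add: w_def card_gt_0_iff)
  define deg where "deg = (\<lambda>x. card {y \<in> W. R x y})"
  define X\<^sub>0 where "X\<^sub>0 = {x \<in> W. real (deg x) \<ge> \<delta> / 2 * w}"
  have X0: "finite X\<^sub>0" "X\<^sub>0 \<subseteq> W" using W by (auto simp: X\<^sub>0_def)
  define codeg where "codeg = (\<lambda>x x'. card {y \<in> W. R x y \<and> R x' y})"
  \<comment> \<open>Chosen so that the penalty \<open>16 / \<delta>\<close> times
    \<open>\<kappa>\<close> equals \<open>\<delta>^2 / 8\<close>, half of the main term
    \<open>\<delta>^2 / 4\<close> of the average below.\<close>
  define \<kappa> where "\<kappa> = \<delta> ^ 3 / 128"
  define bad where "bad = (\<lambda>x x'. real (codeg x x') < \<kappa> * w)"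
  define N where "N = (\<lambda>y. {x \<in> X\<^sub>0. R x y})"
  have finN: "finite (N y)" for y using X0 by (simp add: N_def)
  define b where "b = (\<lambda>y. card {(x, x') \<in> N y \<times> N y. bad x x'})"
  have edges: "(\<Sum>y\<in>W. real (card (N y))) \<ge> \<delta> / 2 * w ^ 2"
  proof -
    have "{(x, y) \<in> W \<times> W. R x y} = (SIGMA x:W. {y \<in> W. R x y})" by auto
    hence "real (card {(x, y) \<in> W \<times> W. R x y}) = (\<Sum>x\<in>W. real (deg x))"
      using W by (simp add: deg_def)
    also have "\<dots> = (\<Sum>x\<in>W - X\<^sub>0. real (deg x)) + (\<Sum>x\<in>X\<^sub>0. real (deg x))"
      using X0 W by (intro sum.subset_diff) auto
    finally have e: "real (card {(x, y) \<in> W \<times> W. R x y}) = \<dots>" .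
    have "(\<Sum>x\<in>W - X\<^sub>0. real (deg x)) \<le> real (card (W - X\<^sub>0)) * (\<delta> / 2 * w)"
      by (intro sum_bounded_above) (auto simp: X\<^sub>0_def)
    also have "\<dots> \<le> w * (\<delta> / 2 * w)"
      using W w \<delta> card_mono[of W "W - X\<^sub>0"] by (intro mult_right_mono) (auto simp: w_def)
    finally have "(\<Sum>x\<in>W - X\<^sub>0. real (deg x)) \<le> w * (\<delta> / 2 * w)" .
    moreover have "(\<Sum>x\<in>X\<^sub>0. real (deg x)) = (\<Sum>y\<in>W. real (card (N y)))"
      unfolding deg_def N_def of_nat_sum[symmetric] using sum_card_swap[OF X0(1) W(1), of R] by (simp only:)
    ultimately have "real (card {(x, y) \<in> W \<times> W. R x y}) \<le> w * (\<delta> / 2 * w) + (\<Sum>y\<in>W. real (card (N y)))"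
      unfolding e by linarith
    thus ?thesis using dense by (simp add: w_def power2_eq_square algebra_simps)
  qed
  \<comment> \<open>Averaging over \<open>y\<close>. One vertex serves both purposes: the left-hand
    side forces a large neighbourhood and, through the penalty, few bad pairs in it.\<close>
  have "\<exists>y\<in>W. \<delta> ^ 2 / 8 * w ^ 2 \<le> real (card (N y)) ^ 2 - 16 / \<delta> * real (b y)"
  proof (rule ccontr)
    assume neg: "\<not> ?thesis"
    have "(\<delta> / 2 * w ^ 2) ^ 2 \<le> (\<Sum>y\<in>W. 1 * real (card (N y))) ^ 2"
      using edges \<delta> w by (intro power_mono) auto
    also have "\<dots> \<le> (\<Sum>y\<in>W. 1 ^ 2) * (\<Sum>y\<in>W. real (card (N y)) ^ 2)"
      by (rule Cauchy_Schwarz_ineq_sum)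
    finally have "(\<delta> / 2 * w ^ 2) ^ 2 \<le> w * (\<Sum>y\<in>W. real (card (N y)) ^ 2)" by (simp add: w_def)
    hence "w * (\<delta> ^ 2 / 4 * w ^ 3) \<le> w * (\<Sum>y\<in>W. real (card (N y)) ^ 2)"
      by (simp add: power2_eq_square power3_eq_cube mult_ac)
    hence sq: "\<delta> ^ 2 / 4 * w ^ 3 \<le> (\<Sum>y\<in>W. real (card (N y)) ^ 2)" using w by simp
    have bs: "(\<Sum>y\<in>W. real (b y)) \<le> \<kappa> * w ^ 3"
    proof -
      have "(\<Sum>y\<in>W. b y) = (\<Sum>y\<in>W. card {p \<in> X\<^sub>0 \<times> X\<^sub>0. bad (fst p) (snd p) \<and> R (fst p) y \<and> R (snd p) y})"
      proof (rule sum.cong)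
        fix y
        have "{(x, x') \<in> N y \<times> N y. bad x x'} = {p \<in> X\<^sub>0 \<times> X\<^sub>0. bad (fst p) (snd p) \<and> R (fst p) y \<and> R (snd p) y}"
          unfolding N_def by (auto simp: case_prod_unfold)
        thus "b y = card {p \<in> X\<^sub>0 \<times> X\<^sub>0. bad (fst p) (snd p) \<and> R (fst p) y \<and> R (snd p) y}"
          unfolding b_def by (simp only:)
      qed simp
      also have "\<dots> = (\<Sum>p\<in>X\<^sub>0 \<times> X\<^sub>0. card {y \<in> W. bad (fst p) (snd p) \<and> R (fst p) y \<and> R (snd p) y})"
        using sum_card_swap[OF W(1) finite_cartesian_product[OF X0(1) X0(1)]] .
      finally have "(\<Sum>y\<in>W. b y) = (\<Sum>p\<in>X\<^sub>0 \<times> X\<^sub>0. card {y \<in> W. bad (fst p) (snd p) \<and> R (fst p) y \<and> R (snd p) y})" .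
      hence "(\<Sum>y\<in>W. real (b y)) = (\<Sum>p\<in>X\<^sub>0 \<times> X\<^sub>0. real (card {y \<in> W. bad (fst p) (snd p) \<and> R (fst p) y \<and> R (snd p) y}))"
        unfolding of_nat_sum[symmetric] by (simp only:)
      also have "\<dots> \<le> real (card (X\<^sub>0 \<times> X\<^sub>0)) * (\<kappa> * w)"
      proof (rule sum_bounded_above)
        fix p
        show "real (card {y \<in> W. bad (fst p) (snd p) \<and> R (fst p) y \<and> R (snd p) y}) \<le> \<kappa> * w"
        proof (cases "bad (fst p) (snd p)")
          case True thus ?thesis by (simp add: bad_def codeg_def)
        next
          case False thus ?thesis using w \<delta> by (simp add: \<kappa>_def)
        qed
      qed
      also have "\<dots> \<le> (w * w) * (\<kappa> * w)"
        using card_mono[OF W(1) X0(2)] w \<delta>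
        by (intro mult_right_mono) (auto simp: card_cartesian_product w_def \<kappa>_def intro!: mult_mono)
      finally show ?thesis by (simp add: power3_eq_cube mult_ac)
    qed
    have "\<delta> ^ 2 / 4 * w ^ 3 - 16 / \<delta> * (\<kappa> * w ^ 3) \<le> (\<Sum>y\<in>W. real (card (N y)) ^ 2) - 16 / \<delta> * (\<Sum>y\<in>W. real (b y))"
      using sq bs \<delta> by (intro diff_mono mult_left_mono) auto
    also have "\<dots> = (\<Sum>y\<in>W. real (card (N y)) ^ 2 - 16 / \<delta> * real (b y))"
      by (simp add: sum_subtractf sum_distrib_left)
    also have "\<dots> < (\<Sum>y\<in>W. \<delta> ^ 2 / 8 * w ^ 2)"
      using neg W by (intro sum_strict_mono) (auto simp: not_le)
    also have "\<dots> = \<delta> ^ 2 / 8 * w ^ 3" by (simp add: w_def power2_eq_square power3_eq_cube)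
    finally show False using \<delta> by (simp add: \<kappa>_def power2_eq_square power3_eq_cube field_simps)
  qed
  then obtain y where y: "y \<in> W" "\<delta> ^ 2 / 8 * w ^ 2 \<le> real (card (N y)) ^ 2 - 16 / \<delta> * real (b y)" by blast
  define c where "c = real (card (N y))"
  have bpos: "16 / \<delta> * real (b y) \<ge> 0" using \<delta> by simp
  have c: "c \<ge> \<delta> / 4 * w"
  proof (rule power2_le_imp_le)
    have "(\<delta> / 4 * w) ^ 2 \<le> \<delta> ^ 2 / 8 * w ^ 2" using \<delta> w by (simp add: power2_eq_square)
    thus "(\<delta> / 4 * w) ^ 2 \<le> c ^ 2" using y(2) bpos unfolding c_def by linarith
  qed (simp add: c_def)
  have c0: "c > 0" using c \<delta> w by (smt (verit) divide_pos_pos mult_pos_pos)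
  have bsm: "real (b y) \<le> \<delta> / 16 * c ^ 2"
  proof -
    have "16 / \<delta> * real (b y) \<le> c ^ 2" using y(2) w \<delta> unfolding c_def
      by (smt (verit) divide_nonneg_nonneg mult_nonneg_nonneg zero_le_power2)
    thus ?thesis using \<delta> by (simp add: field_simps)
  qed
  define bc where "bc = (\<lambda>x. card {x' \<in> N y. bad x x'})"
  \<comment> \<open>Points of \<open>N y\<close> with few bad partners; \<open>Y\<close> consists of
    the points with many neighbours in \<open>N y\<close>. For a pair from the two sets the
    thresholds \<open>\<delta> / 8\<close> and \<open>\<delta> / 4\<close> leave at least
    \<open>\<delta> c / 8\<close> middle vertices that are good for both.\<close>
  define X where "X = {x \<in> N y. real (bc x) \<le> \<delta> / 8 * c}"
  define Y where "Y = {y' \<in> W. real (card {x \<in> N y. R x y'}) \<ge> \<delta> / 4 * c}"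
  have XN: "X \<subseteq> N y" by (auto simp: X_def)
  have NW: "N y \<subseteq> W" using X0 by (auto simp: N_def)
  have cX: "real (card X) \<ge> c / 2"
  proof -
    have "{(x, x') \<in> N y \<times> N y. bad x x'} = (SIGMA x:N y. {x' \<in> N y. bad x x'})" by auto
    hence "real (b y) = (\<Sum>x\<in>N y. real (bc x))" using finN by (simp add: b_def bc_def)
    also have "\<dots> \<ge> (\<Sum>x\<in>N y - X. real (bc x))" using finN by (intro sum_mono2) auto
    moreover have "(\<Sum>x\<in>N y - X. real (bc x)) \<ge> real (card (N y - X)) * (\<delta> / 8 * c)"
      by (intro sum_bounded_below) (auto simp: X_def)
    ultimately have "real (card (N y - X)) * (\<delta> / 8 * c) \<le> \<delta> / 16 * c ^ 2" using bsm by linarith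
    hence "(\<delta> * c) * (2 * real (card (N y - X))) \<le> (\<delta> * c) * c" by (simp add: power2_eq_square mult_ac)
    hence "2 * real (card (N y - X)) \<le> c" using \<delta> c0 by simp
    moreover have "real (card (N y - X)) = c - real (card X)"
      unfolding c_def using finN XN by (simp add: card_Diff_subset finite_subset of_nat_diff card_mono)
    ultimately show ?thesis by linarith
  qed
  have cY: "real (card Y) \<ge> \<delta> / 4 * w"
  proof -
    have "c * (\<delta> / 2 * w) \<le> (\<Sum>x\<in>N y. real (deg x))"
      unfolding c_def by (intro sum_bounded_below) (auto simp: N_def X\<^sub>0_def)
    also have "\<dots> = (\<Sum>y'\<in>W. real (card {x \<in> N y. R x y'}))"
      unfolding deg_def of_nat_sum[symmetric] using sum_card_swap[OF finN W(1), of R y] by (simp only:)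
    also have "\<dots> = (\<Sum>y'\<in>W - Y. real (card {x \<in> N y. R x y'})) + (\<Sum>y'\<in>Y. real (card {x \<in> N y. R x y'}))"
      using W by (intro sum.subset_diff) (auto simp: Y_def)
    also have "\<dots> \<le> real (card (W - Y)) * (\<delta> / 4 * c) + real (card Y) * c"
      using finN by (intro add_mono sum_bounded_above) (auto simp: Y_def c_def intro!: card_mono)
    also have "\<dots> \<le> w * (\<delta> / 4 * c) + real (card Y) * c"
      using W w \<delta> c0 card_mono[of W "W - Y"] by (intro add_mono mult_right_mono) (auto simp: w_def)
    finally have "c * (\<delta> / 4 * w) \<le> c * real (card Y)" by (simp add: algebra_simps)
    thus ?thesis using c0 by simp
  qed
  show ?thesis
  proof (rule that)
    show "X \<subseteq> W" "Y \<subseteq> W" using XN NW by (auto simp: Y_def)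
    show "real (card X) \<ge> \<delta> / 8 * real (card W)" using cX c by (simp add: w_def)
    show "real (card Y) \<ge> \<delta> / 4 * real (card W)" using cY by (simp add: w_def)
  next
    fix x y' assume x: "x \<in> X" and y': "y' \<in> Y"
    define G where "G = {x' \<in> N y. R x' y' \<and> \<not> bad x x'}"
    have fG: "finite G" using finN by (simp add: G_def)
    have cG: "real (card G) \<ge> \<delta> / 8 * c"
    proof -
      have "{x' \<in> N y. R x' y'} \<subseteq> G \<union> {x' \<in> N y. bad x x'}" by (auto simp: G_def)
      hence "card {x' \<in> N y. R x' y'} \<le> card (G \<union> {x' \<in> N y. bad x x'})"
        using fG finN by (intro card_mono) auto
      also have "\<dots> \<le> card G + bc x" unfolding bc_def by (rule card_Un_le)
      finally have "real (card {x' \<in> N y. R x' y'}) \<le> real (card G) + real (bc x)" by linarith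
      moreover have "real (bc x) \<le> \<delta> / 8 * c" using x by (simp add: X_def)
      moreover have "real (card {x' \<in> N y. R x' y'}) \<ge> \<delta> / 4 * c" using y' by (simp add: Y_def)
      ultimately show ?thesis by linarith
    qed
    have "\<delta> ^ 5 / 4096 * w ^ 2 = (\<delta> / 8 * (\<delta> / 4 * w)) * (\<kappa> * w)"
      by (simp add: \<kappa>_def power2_eq_square power3_eq_cube eval_nat_numeral)
    also have "\<dots> \<le> (\<delta> / 8 * c) * (\<kappa> * w)"
      using c \<delta> w by (intro mult_right_mono mult_left_mono) (auto simp: \<kappa>_def)
    also have "\<dots> \<le> real (card G) * (\<kappa> * w)"
      using cG \<delta> w by (intro mult_right_mono) (auto simp: \<kappa>_def)
    also have "\<dots> \<le> (\<Sum>x'\<in>G. real (codeg x x'))"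
      by (intro sum_bounded_below) (auto simp: G_def bad_def)
    also have "\<dots> = real (card (SIGMA x':G. {z \<in> W. R x z \<and> R x' z}))"
      using fG W by (simp add: codeg_def)
    also have "\<dots> = real (card ((\<lambda>(x', z). (z, x')) ` (SIGMA x':G. {z \<in> W. R x z \<and> R x' z})))"
      by (subst card_image) (auto simp: inj_on_def)
    also have "\<dots> \<le> real (card {(z, x') \<in> W \<times> W. R x z \<and> R x' z \<and> R x' y'})"
    proof -
      have "finite {(z, x') \<in> W \<times> W. R x z \<and> R x' z \<and> R x' y'}"
        by (rule finite_subset[of _ "W \<times> W"]) (use W in auto)
      thus ?thesis using NW by (intro of_nat_mono card_mono) (auto simp: G_def)
    qed
    finally show "real (card {(z, x') \<in> W \<times> W. R x z \<and> R x' z \<and> R x' y'}) \<ge> \<delta> ^ 5 / 4096 * real (card W) ^ 2"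
      by (simp add: w_def)
  qed
qed

section \<open>Sumset growth\<close>

lemma finite_set_plus: "finite A \<Longrightarrow> finite B \<Longrightarrow> finite (A + B :: 'a::plus set)"
  unfolding set_plus_def by (rule finite_subset[of _ "(\<lambda>(a, b). a + b) ` (A \<times> B)"]) auto

lemma card_translate: "card ({c} + A) = card (A :: 'a::ab_group_add set)"
proof -
  have "{c} + A = (\<lambda>a. c + a) ` A" by (auto simp: set_plus_def)
  thus ?thesis by (simp add: card_image)
qed

text \<open>Petridis: the extremal set \<open>X\<close> in the Pluennecke inequality minimises \<open>|A + X| / |X|\<close>.\<close>

lemma Pluennecke_Petridis:
  fixes A Y :: "'a::ab_group_add set" and K :: real
  assumes fin: "finite A" "finite Y" "Y \<noteq> {}" and K: "real (card (A + Y)) \<le> K * real (card Y)"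
  obtains X where "X \<subseteq> Y" "X \<noteq> {}" "\<And>C. finite C \<Longrightarrow> real (card (A + (X + C))) \<le> K * real (card (X + C))"
proof -
  define \<rho> where "\<rho> = (\<lambda>X. real (card (A + X)) / real (card X))"
  define \<X> where "\<X> = Pow Y - {{}}"
  have "finite \<X>" "\<X> \<noteq> {}" using fin by (auto simp: \<X>_def)
  hence "Min (\<rho> ` \<X>) \<in> \<rho> ` \<X>" by (intro Min_in) auto
  then obtain X where X: "X \<in> \<X>" "Min (\<rho> ` \<X>) = \<rho> X" by auto
  have min: "\<rho> X \<le> \<rho> Z" if "Z \<in> \<X>" for Z
    unfolding X(2)[symmetric] using \<open>finite \<X>\<close> that by (intro Min_le) auto
  have XY: "X \<subseteq> Y" "X \<noteq> {}" "finite X" using X(1) fin finite_subset by (auto simp: \<X>_def)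
  define k where "k = \<rho> X"
  have cX: "card X > 0" using XY by (simp add: card_gt_0_iff)
  have kX: "real (card (A + X)) = k * real (card X)" using cX by (simp add: k_def \<rho>_def)
  have k0: "k \<ge> 0" by (simp add: k_def \<rho>_def)
  have kK: "k \<le> K"
  proof -
    have "k \<le> \<rho> Y" unfolding k_def using fin by (intro min) (auto simp: \<X>_def)
    also have "\<dots> \<le> K" using K fin by (simp add: \<rho>_def divide_le_eq card_gt_0_iff)
    finally show ?thesis .
  qed
  have kZ: "k * real (card Z) \<le> real (card (A + Z))" if "Z \<subseteq> X" for Z
  proof (cases "Z = {}")
    case True thus ?thesis by simp
  next
    case False
    hence "k \<le> \<rho> Z" unfolding k_def using that XY by (intro min) (auto simp: \<X>_def)
    moreover have "card Z > 0" using False that XY finite_subset by (auto simp: card_gt_0_iff)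
    ultimately show ?thesis by (simp add: \<rho>_def le_divide_eq)
  qed
  have main: "real (card (A + (X + C))) \<le> k * real (card (X + C))" if "finite C" for C
    using that
  proof (induction C rule: finite_induct)
    case empty thus ?case by (simp add: set_plus_def)
  next
    case (insert c C)
    \<comment> \<open>Those \<open>x\<close> whose translate adds nothing new to the sumset. Their
      part \<open>A + Z\<close> need not be counted, and minimality of \<open>X\<close> shows that
      it has at least \<open>k\<close> times \<open>card Z\<close> elements.\<close>
    define Z where "Z = {x \<in> X. {x + c} + A \<subseteq> A + (X + C)}"
    have ZX: "Z \<subseteq> X" by (auto simp: Z_def)
    have f1: "finite (A + (X + C))" "finite (X + C)" using fin XY insert by (auto intro!: finite_set_plus)
    have f2: "finite (A + X)" "finite (A + Z)" using fin XY ZX finite_subset by (auto intro!: finite_set_plus)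
    have "A + (X + insert c C) \<subseteq> (A + (X + C)) \<union> ({c} + ((A + X) - (A + Z)))"
    proof
      fix v assume "v \<in> A + (X + insert c C)"
      then obtain a x c' where v: "a \<in> A" "x \<in> X" "c' \<in> insert c C" "v = a + (x + c')"
        by (auto simp: set_plus_def)
      show "v \<in> (A + (X + C)) \<union> ({c} + ((A + X) - (A + Z)))"
      proof (cases "v \<in> A + (X + C)")
        case False
        hence c': "c' = c" using v by (auto simp: set_plus_def)
        have "a + x \<notin> A + Z"
        proof
          assume "a + x \<in> A + Z"
          then obtain a' z where z: "a' \<in> A" "z \<in> Z" "a + x = a' + z" by (auto simp: set_plus_def)
          hence "v = (z + c) + a'" using v c' by (simp add: algebra_simps)
          hence "v \<in> A + (X + C)" using z by (auto simp: Z_def set_plus_def)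
          thus False using False by simp
        qed
        moreover have "a + x \<in> A + X" using v by (auto simp: set_plus_def)
        moreover have "v = c + (a + x)" using v c' by (simp add: algebra_simps)
        ultimately show ?thesis by (auto simp: set_plus_def)
      qed simp
    qed
    hence "card (A + (X + insert c C)) \<le> card ((A + (X + C)) \<union> ({c} + ((A + X) - (A + Z))))"
      using f1 f2 by (intro card_mono) (auto intro!: finite_set_plus)
    also have "\<dots> \<le> card (A + (X + C)) + card ({c} + ((A + X) - (A + Z)))" by (rule card_Un_le)
    also have "card ({c} + ((A + X) - (A + Z))) = card (A + X) - card (A + Z)"
    proof -
      have "A + Z \<subseteq> A + X" using ZX by (auto simp: set_plus_def)
      thus ?thesis unfolding card_translate using f2 by (simp add: card_Diff_subset)
    qed
    finally have "real (card (A + (X + insert c C))) \<le> real (card (A + (X + C))) + (real (card (A + X)) - real (card (A + Z)))"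
    proof -
      assume le: "card (A + (X + insert c C)) \<le> card (A + (X + C)) + (card (A + X) - card (A + Z))"
      have "card (A + Z) \<le> card (A + X)" using f2 ZX by (intro card_mono) (auto simp: set_plus_def)
      thus ?thesis using le by linarith
    qed
    also have "\<dots> \<le> k * real (card (X + C)) + (k * real (card X) - k * real (card Z))"
      using insert.IH kX kZ[OF ZX] by linarith
    also have "\<dots> = k * (real (card (X + C)) + (real (card X) - real (card Z)))" by (simp add: algebra_simps)
    also have "\<dots> \<le> k * real (card (X + insert c C))"
    proof (intro mult_left_mono k0)
      \<comment> \<open>Those \<open>x\<close> for which \<open>x + c\<close> is not a new element
        of the sum of \<open>X\<close> and \<open>C\<close>. They all lie in \<open>Z\<close>, hence
        at least \<open>card X - card Z\<close> elements are new.\<close>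
      define Z' where "Z' = {x \<in> X. x + c \<in> X + C}"
      have "Z' \<subseteq> Z"
      proof
        fix x assume x: "x \<in> Z'"
        have "v \<in> A + (X + C)" if "v \<in> {x + c} + A" for v
        proof -
          obtain a where "a \<in> A" "v = (x + c) + a" using \<open>v \<in> {x + c} + A\<close> by (auto simp: set_plus_def)
          thus ?thesis using x by (auto simp: Z'_def set_plus_def add.commute)
        qed
        thus "x \<in> Z" using x by (auto simp: Z_def Z'_def)
      qed
      hence cZ: "card Z' \<le> card Z" using \<open>Z' \<subseteq> Z\<close> ZX XY(3) by (meson card_mono rev_finite_subset)
      have "(X + C) \<union> (\<lambda>x. x + c) ` (X - Z') \<subseteq> X + insert c C" by (auto simp: set_plus_def)
      moreover have "finite (X + insert c C)" using XY insert by (intro finite_set_plus) auto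
      ultimately have "card ((X + C) \<union> (\<lambda>x. x + c) ` (X - Z')) \<le> card (X + insert c C)" by (intro card_mono)
      moreover have "card ((X + C) \<union> (\<lambda>x. x + c) ` (X - Z')) = card (X + C) + card (X - Z')"
        using XY f1 by (subst card_Un_disjoint) (auto simp: Z'_def card_image)
      moreover have "card (X - Z') = card X - card Z'" 
        using XY by (intro card_Diff_subset) (auto simp: Z'_def)
      moreover have "card Z' \<le> card X" using XY by (intro card_mono) (auto simp: Z'_def)
      ultimately show "real (card (X + C)) + (real (card X) - real (card Z)) \<le> real (card (X + insert c C))"
        using cZ by linarith
    qed
    finally show ?case .
  qed
  show ?thesis
  proof (rule that[OF XY(1,2)])
    fix C :: "'a set" assume C: "finite C"
    have "k * real (card (X + C)) \<le> K * real (card (X + C))" using kK by (intro mult_right_mono) auto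
    thus "real (card (A + (X + C))) \<le> K * real (card (X + C))" using main[OF C] by linarith
  qed
qed

lemma card_collisions_inj:
  assumes "inj_on h X"
  shows "card {(x, y) \<in> h ` X \<times> h ` X. F x = F y} = card {(p, q) \<in> X \<times> X. F (h p) = F (h q)}"
proof -
  have "{(x, y) \<in> h ` X \<times> h ` X. F x = F y} = map_prod h h ` {(p, q) \<in> X \<times> X. F (h p) = F (h q)}" by auto
  moreover have "inj_on (map_prod h h) {(p, q) \<in> X \<times> X. F (h p) = F (h q)}"
    using assms by (auto simp: inj_on_def)
  ultimately show ?thesis by (simp add: card_image)
qed

lemma words_add: "words A (m + n) = (\<lambda>p. fst p @ snd p) ` (words A m \<times> words A n)"
proof (intro equalityI subsetI)
  fix xs assume xs: "xs \<in> words A (m + n)"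
  have "set (take m xs) \<subseteq> set xs" "set (drop m xs) \<subseteq> set xs" by (rule set_take_subset, rule set_drop_subset)
  hence "(take m xs, drop m xs) \<in> words A m \<times> words A n" using xs by (auto simp: words_def)
  moreover have "xs = fst (take m xs, drop m xs) @ snd (take m xs, drop m xs)" by simp
  ultimately show "xs \<in> (\<lambda>p. fst p @ snd p) ` (words A m \<times> words A n)" by (rule rev_image_eqI)
qed (auto simp: words_def)

lemma inj_on_append_words: "inj_on (\<lambda>p. fst p @ snd p) (words A m \<times> words A n)"
  by (auto simp: inj_on_def words_def)

text \<open>The inequality \<open>2 a b \<le> a^2 + b^2\<close> for the fibre sizes. In particular,
  an equation with a prescribed shift has no more solutions than the unshifted one.\<close>

lemma card_match_le:
  assumes X: "finite X" and Y: "finite Y"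
  shows "2 * card {(x, y) \<in> X \<times> Y. f x = g y}
    \<le> card {(x, y) \<in> X \<times> X. f x = f y} + card {(x, y) \<in> Y \<times> Y. g x = g y}"
proof -
  define a where "a = (\<lambda>v. card {x \<in> X. f x = v})"
  define b where "b = (\<lambda>v. card {y \<in> Y. g y = v})"
  have "{(x, y) \<in> X \<times> Y. f x = g y} = (SIGMA x:X. {y \<in> Y. g y = f x})" by auto
  hence "card {(x, y) \<in> X \<times> Y. f x = g y} = (\<Sum>x\<in>X. b (f x))" using X Y by (simp add: b_def)
  also have "\<dots> = (\<Sum>v\<in>f ` X. \<Sum>x\<in>{x \<in> X. f x = v}. b (f x))" by (rule sum.image_gen[OF X])
  also have "\<dots> = (\<Sum>v\<in>f ` X. a v * b v)" by (intro sum.cong refl) (simp add: a_def)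
  finally have "2 * card {(x, y) \<in> X \<times> Y. f x = g y} = (\<Sum>v\<in>f ` X. 2 * (a v * b v))"
    by (simp add: sum_distrib_left)
  also have "\<dots> \<le> (\<Sum>v\<in>f ` X. a v ^ 2 + b v ^ 2)"
  proof (rule sum_mono)
    fix v
    have "2 * real (a v) * real (b v) \<le> real (a v) ^ 2 + real (b v) ^ 2" by (rule sum_squares_bound)
    hence "real (2 * (a v * b v)) \<le> real (a v ^ 2 + b v ^ 2)" by simp
    thus "2 * (a v * b v) \<le> a v ^ 2 + b v ^ 2" by (simp only: of_nat_le_iff)
  qed
  also have "\<dots> = card {(x, y) \<in> X \<times> X. f x = f y} + (\<Sum>v\<in>f ` X. b v ^ 2)"
    unfolding sum.distrib card_eq_sum_fibres[OF X] a_def by (rule refl)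
  also have "(\<Sum>v\<in>f ` X. b v ^ 2) = (\<Sum>v\<in>f ` X \<inter> g ` Y. b v ^ 2)"
  proof (rule sum.mono_neutral_right)
    have "b v = 0" if "v \<notin> g ` Y" for v
    proof -
      have "{y \<in> Y. g y = v} = {}" using that by auto
      thus ?thesis by (simp only: b_def card.empty)
    qed
    thus "\<forall>v\<in>f ` X - f ` X \<inter> g ` Y. b v ^ 2 = 0" by auto
  qed (use X in auto)
  also have "\<dots> \<le> (\<Sum>v\<in>g ` Y. b v ^ 2)" using Y by (intro sum_mono2) auto
  also have "\<dots> = card {(x, y) \<in> Y \<times> Y. g x = g y}" unfolding card_eq_sum_fibres[OF Y] b_def by (rule refl)
  finally show ?thesis by simp
qed

text \<open>Popular sums of two words form a dense graph on \<open>words A D\<close>, to which the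
  Balog--Szemeredi--Gowers argument applies; fixing all but one letter then yields a subset of \<open>A\<close>.\<close>

lemma popular_graph:
  fixes K :: real
  assumes W: "finite W" "W \<noteq> {}" and K: "K \<ge> 1"
    and J1: "real (card {(x, y) \<in> W \<times> W. f x = f y}) \<le> K * real (card W)"
    and J2: "real (card {(p, q) \<in> (W \<times> W) \<times> (W \<times> W). f (fst p) + f (snd p) = f (fst q) + f (snd q)}) \<ge> real (card W) ^ 3 / K"
  obtains P :: "'a::ab_group_add set" where "finite P" "real (card P) \<le> 2 * K * real (card W)"
    "real (card {(x, y) \<in> W \<times> W. f x + f y \<in> P}) \<ge> 1 / (2 * K ^ 2) * real (card W) ^ 2"
proof -
  define w where "w = real (card W)"
  have w: "w > 0" using W by (simp add: w_def card_gt_0_iff)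
  let ?X = "W \<times> W"
  define g where "g = (\<lambda>p. f (fst p) + f (snd p))"
  define r where "r = (\<lambda>v. card {p \<in> ?X. g p = v})"
  have finX: "finite ?X" using W by simp
  have sum_r: "(\<Sum>v\<in>g ` ?X. real (r v)) = w ^ 2"
    using card_sum_fibres[OF finX, of g] by (simp add: r_def w_def power2_eq_square card_cartesian_product flip: of_nat_mult of_nat_sum)
  have sum_r2: "(\<Sum>v\<in>g ` ?X. real (r v) ^ 2) \<ge> w ^ 3 / K"
  proof -
    have "real (card {(p, q) \<in> ?X \<times> ?X. g p = g q}) = (\<Sum>v\<in>g ` ?X. real (r v) ^ 2)"
      unfolding card_eq_sum_fibres[OF finX] r_def by simp
    thus ?thesis using J2 by (simp add: g_def w_def)
  qed
  have r_max: "real (r v) \<le> K * w" for v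
  proof -
    have "{p \<in> ?X. g p = v} = {(x, y) \<in> W \<times> W. f x = v - f y}" by (auto simp: g_def algebra_simps)
    moreover have "{(x, y) \<in> W \<times> W. v - f x = v - f y} = {(x, y) \<in> W \<times> W. f x = f y}" by auto
    ultimately have "2 * r v \<le> 2 * card {(x, y) \<in> W \<times> W. f x = f y}"
      using card_match_le[OF W(1) W(1), of f "\<lambda>y. v - f y"] by (simp add: r_def)
    thus ?thesis using J1 by (simp add: w_def)
  qed
  define P where "P = {v \<in> g ` ?X. real (r v) \<ge> w / (2 * K)}"
  have P: "finite P" "P \<subseteq> g ` ?X" using W by (auto simp: P_def)
  have cP: "real (card P) \<le> 2 * K * w"
  proof -
    have "real (card P) * (w / (2 * K)) \<le> (\<Sum>v\<in>P. real (r v))" by (intro sum_bounded_below) (auto simp: P_def)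
    also have "\<dots> \<le> w ^ 2" unfolding sum_r[symmetric] using P W by (intro sum_mono2) auto
    finally have "real (card P) * w \<le> (2 * K * w) * w" using K by (simp add: field_simps power2_eq_square)
    thus ?thesis using w by simp
  qed
  have SP: "w ^ 3 / (2 * K) \<le> K * w * (\<Sum>v\<in>P. real (r v))"
  proof -
    have "(\<Sum>v\<in>g ` ?X. real (r v) ^ 2) = (\<Sum>v\<in>g ` ?X - P. real (r v) ^ 2) + (\<Sum>v\<in>P. real (r v) ^ 2)"
      using W P by (intro sum.subset_diff) auto
    moreover have "(\<Sum>v\<in>g ` ?X - P. real (r v) ^ 2) \<le> (\<Sum>v\<in>g ` ?X - P. w / (2 * K) * real (r v))"
    proof (rule sum_mono)
      fix v assume "v \<in> g ` ?X - P"
      hence "real (r v) \<le> w / (2 * K)" by (auto simp: P_def)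
      thus "real (r v) ^ 2 \<le> w / (2 * K) * real (r v)"
        unfolding power2_eq_square by (intro mult_right_mono) auto
    qed
    moreover have "\<dots> \<le> w / (2 * K) * (\<Sum>v\<in>g ` ?X. real (r v))"
      unfolding sum_distrib_left[symmetric] using W w K by (intro mult_left_mono sum_mono2) auto
    moreover have "\<dots> = w ^ 3 / (2 * K)" unfolding sum_r by (simp add: power2_eq_square power3_eq_cube)
    moreover have "(\<Sum>v\<in>P. real (r v) ^ 2) \<le> (\<Sum>v\<in>P. K * w * real (r v))"
      using r_max by (intro sum_mono) (auto simp: power2_eq_square intro!: mult_right_mono)
    moreover have "\<dots> = K * w * (\<Sum>v\<in>P. real (r v))" by (simp add: sum_distrib_left)
    moreover have "w ^ 3 / K = w ^ 3 / (2 * K) + w ^ 3 / (2 * K)" using K by (simp add: field_simps)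
    ultimately show ?thesis using sum_r2 by linarith
  qed
  have "(\<Sum>v\<in>P. real (r v)) = real (card {(x, y) \<in> W \<times> W. f x + f y \<in> P})"
  proof -
    have "(\<Sum>v\<in>P. r v) = card (\<Union>v\<in>P. {p \<in> ?X. g p = v})"
      unfolding r_def using P finX by (intro card_UN_disjoint[symmetric]) auto
    also have "(\<Union>v\<in>P. {p \<in> ?X. g p = v}) = {(x, y) \<in> W \<times> W. f x + f y \<in> P}" by (auto simp: g_def)
    finally show ?thesis by (simp flip: of_nat_sum)
  qed
  with SP have "w ^ 3 / (2 * K) \<le> K * w * real (card {(x, y) \<in> W \<times> W. f x + f y \<in> P})" by simp
  hence "w * (1 / (2 * K ^ 2) * w ^ 2) \<le> w * real (card {(x, y) \<in> W \<times> W. f x + f y \<in> P})"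
    using K w by (simp add: field_simps power2_eq_square power3_eq_cube)
  hence "1 / (2 * K ^ 2) * w ^ 2 \<le> real (card {(x, y) \<in> W \<times> W. f x + f y \<in> P})"
    by (rule mult_left_le_imp_le) (use w in simp)
  thus ?thesis using that P(1) cP by (simp add: w_def)
qed

text \<open>Along a path \<open>x\<close>, \<open>y'\<close>, \<open>x'\<close>, \<open>y\<close> of
  popular pairs, \<open>f x + f y\<close> is the first popular sum minus the second plus the third.
  Many paths give many representations in terms of the small set \<open>P\<close>, so few sums can
  occur. As \<open>f\<close> is not injective, \<open>W\<close> acts as a set with multiplicities,
  and \<open>J1\<close> controls how many paths give the same triple.\<close>

lemma Balog_Szemeredi_Gowers:
  fixes K :: real and f :: "'b \<Rightarrow> 'a::ab_group_add"
  assumes W: "finite W" "W \<noteq> {}" and K: "K \<ge> 1"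
    and J1: "real (card {(x, y) \<in> W \<times> W. f x = f y}) \<le> K * real (card W)"
    and J2: "real (card {(p, q) \<in> (W \<times> W) \<times> (W \<times> W). f (fst p) + f (snd p) = f (fst q) + f (snd q)}) \<ge> real (card W) ^ 3 / K"
  obtains X Y where "X \<subseteq> W" "Y \<subseteq> W" "real (card X) \<ge> real (card W) / (16 * K ^ 2)" "Y \<noteq> {}"
    "real (card (f ` X + f ` Y)) \<le> 2 ^ 43 * K ^ 30 * real (card (f ` Y))"
proof -
  define w where "w = real (card W)"
  have w: "w > 0" using W by (simp add: w_def card_gt_0_iff)
  define \<delta> where "\<delta> = 1 / (2 * K ^ 2)"
  have "K ^ 2 \<ge> 1" using K by (rule one_le_power)
  hence \<delta>: "0 < \<delta>" "\<delta> \<le> 1" by (auto simp: \<delta>_def divide_le_eq)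
  obtain P where P: "finite P" "real (card P) \<le> 2 * K * w" "real (card {(x, y) \<in> W \<times> W. f x + f y \<in> P}) \<ge> \<delta> * w ^ 2"
    unfolding w_def \<delta>_def using popular_graph[OF W K J1 J2] by blast
  obtain X Y where X: "X \<subseteq> W" and Y: "Y \<subseteq> W" and cX: "real (card X) \<ge> \<delta> / 8 * w" and cY: "real (card Y) \<ge> \<delta> / 4 * w"
    and paths: "\<And>x y. x \<in> X \<Longrightarrow> y \<in> Y \<Longrightarrow> real (card {(y', x') \<in> W \<times> W. f x + f y' \<in> P \<and> f x' + f y' \<in> P \<and> f x' + f y \<in> P})
      \<ge> \<delta> ^ 5 / 4096 * w ^ 2"
    using many_paths[of W \<delta> "\<lambda>x y. f x + f y \<in> P", OF W \<delta> P(3)[unfolded w_def]] unfolding w_def by blast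
  have fin: "finite X" "finite Y" using X Y W finite_subset by blast+
  let ?Q = "{(x, y) \<in> W \<times> W. f x = f y}"
  have finQ: "finite ?Q" by (rule finite_subset[of _ "W \<times> W"]) (use W in auto)
  \<comment> \<open>The square of the number of paths divided by the bound \<open>(K w)^2\<close>
    for coinciding triples; \<open>2^24\<close> is the square of 4096.\<close>
  define \<tau> where "\<tau> = \<delta> ^ 10 / (2 ^ 24 * K ^ 2) * w ^ 2"
  have \<tau>: "\<tau> > 0" using \<delta> K w by (simp add: \<tau>_def)
  define T where "T = (\<lambda>s. {(p, q, t). p \<in> P \<and> q \<in> P \<and> t \<in> P \<and> p - q + t = s})"
  have finT: "finite (T s)" for s
    by (rule finite_subset[of _ "P \<times> P \<times> P"]) (use P in \<open>auto simp: T_def\<close>)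
  have cT: "\<tau> \<le> real (card (T s))" if s: "s \<in> f ` X + f ` Y" for s
  proof -
    obtain x y where xy: "x \<in> X" "y \<in> Y" "s = f x + f y" using s by (auto simp: set_plus_def)
    define Pth where "Pth = {(y', x') \<in> W \<times> W. f x + f y' \<in> P \<and> f x' + f y' \<in> P \<and> f x' + f y \<in> P}"
    have finPth: "finite Pth" by (rule finite_subset[of _ "W \<times> W"]) (use W in \<open>auto simp: Pth_def\<close>)
    define \<phi> where "\<phi> = (\<lambda>(y', x'). (f x + f y', f x' + f y', f x' + f y))"
    have sub: "\<phi> ` Pth \<subseteq> T s" by (auto simp: \<phi>_def Pth_def T_def xy(3))
    have "{(p, q) \<in> Pth \<times> Pth. \<phi> p = \<phi> q} \<subseteq> (\<lambda>((a, a'), (b, b')). ((a, b), (a', b'))) ` (?Q \<times> ?Q)"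
      by (auto simp: \<phi>_def Pth_def image_iff)
    hence "card {(p, q) \<in> Pth \<times> Pth. \<phi> p = \<phi> q} \<le> card (?Q \<times> ?Q)"
      using finQ by (meson card_image_le card_mono finite_SigmaI finite_imageI le_trans)
    hence "real (card {(p, q) \<in> Pth \<times> Pth. \<phi> p = \<phi> q}) \<le> real (card ?Q) * real (card ?Q)"
      by (simp add: card_cartesian_product flip: of_nat_mult)
    also have "\<dots> \<le> (K * w) * (K * w)" using J1 by (intro mult_mono) (auto simp: w_def)
    finally have coll: "real (card {(p, q) \<in> Pth \<times> Pth. \<phi> p = \<phi> q}) \<le> (K * w) ^ 2" by (simp add: power2_eq_square)
    have "(\<delta> ^ 5 / 4096 * w ^ 2) ^ 2 \<le> real (card Pth) ^ 2"
      using paths[OF xy(1,2)] \<delta> w unfolding Pth_def by (intro power_mono) auto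
    also have "\<dots> \<le> real (card (\<phi> ` Pth)) * real (card {(p, q) \<in> Pth \<times> Pth. \<phi> p = \<phi> q})"
      by (rule card_square_le_collisions[OF finPth])
    also have "\<dots> \<le> real (card (T s)) * (K * w) ^ 2"
      using sub finT coll by (intro mult_mono of_nat_mono card_mono) auto
    finally have "(\<delta> ^ 5 / 4096 * w ^ 2) ^ 2 \<le> real (card (T s)) * (K * w) ^ 2" .
    moreover have "(\<delta> ^ 5 / 4096 * w ^ 2) ^ 2 = \<tau> * (K * w) ^ 2"
      using K by (simp add: \<tau>_def power2_eq_square eval_nat_numeral field_simps)
    ultimately show ?thesis using K w by simp
  qed
  let ?S = "f ` X + f ` Y"
  have finS: "finite ?S" using fin by (intro finite_set_plus) auto
  have "real (card ?S) * \<tau> \<le> (\<Sum>s\<in>?S. real (card (T s)))" using cT by (rule sum_bounded_below)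
  also have "\<dots> = real (card (\<Union>s\<in>?S. T s))"
    using finS finT by (subst card_UN_disjoint) (auto simp: T_def)
  also have "\<dots> \<le> real (card (P \<times> P \<times> P))"
    using P by (intro of_nat_mono card_mono) (auto simp: T_def)
  also have "\<dots> = real (card P) ^ 3" by (simp add: card_cartesian_product power3_eq_cube)
  also have "\<dots> \<le> (2 * K * w) ^ 3" using P by (intro power_mono) auto
  also have "\<dots> = (2 ^ 37 * K ^ 25 * w) * \<tau>"
    using K by (simp add: \<tau>_def \<delta>_def eval_nat_numeral field_simps)
  finally have S: "real (card ?S) \<le> 2 ^ 37 * K ^ 25 * w" using \<tau> by simp
  have fY: "w / (64 * K ^ 5) \<le> real (card (f ` Y))"
  proof -
    have "(\<delta> / 4 * w) ^ 2 \<le> real (card Y) ^ 2" using cY \<delta> w by (intro power_mono) auto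
    also have "\<dots> \<le> real (card (f ` Y)) * real (card {(x, y) \<in> Y \<times> Y. f x = f y})"
      by (rule card_square_le_collisions[OF fin(2)])
    also have "\<dots> \<le> real (card (f ` Y)) * (K * w)"
    proof (intro mult_left_mono)
      have "card {(x, y) \<in> Y \<times> Y. f x = f y} \<le> card ?Q" using finQ Y by (intro card_mono) auto
      thus "real (card {(x, y) \<in> Y \<times> Y. f x = f y}) \<le> K * w" using J1 by (simp add: w_def)
    qed simp
    finally have "(w / (64 * K ^ 5)) * (K * w) \<le> real (card (f ` Y)) * (K * w)"
      using K by (simp add: \<delta>_def eval_nat_numeral field_simps)
    thus ?thesis by (rule mult_right_le_imp_le) (use K w in simp)
  qed
  show ?thesis
  proof (rule that[OF X Y])
    show "real (card X) \<ge> real (card W) / (16 * K ^ 2)" using cX by (simp add: \<delta>_def w_def)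
    have "real (card Y) > 0" using cY \<delta> w by (smt (verit) divide_pos_pos mult_pos_pos)
    thus "Y \<noteq> {}" by auto
    have "2 ^ 37 * K ^ 25 * w = 2 ^ 43 * K ^ 30 * (w / (64 * K ^ 5))"
      using K by (simp add: eval_nat_numeral)
    also have "\<dots> \<le> 2 ^ 43 * K ^ 30 * real (card (f ` Y))" using fY K by (intro mult_left_mono) auto
    finally show "real (card ?S) \<le> 2 ^ 43 * K ^ 30 * real (card (f ` Y))" using S by linarith
  qed
qed

text \<open>The set \<open>Z\<close> of Petridis' inequality does not depend on the added set, so
  the inequality can be iterated with the sums already formed. Each further letter costs only a
  constant factor, and \<open>|A|^D\<close>, the trivial bound for \<open>Z\<close>, persists for
  every number \<open>n\<close> of letters.\<close>

lemma small_sumset_subset: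
  fixes K :: real
  assumes A: "finite A" "A \<noteq> {}" and D: "D > 0" and K: "K \<ge> 1"
    and J1: "real (solutions k D A) \<le> K * real (card A) ^ D"
    and J2: "real (solutions k (2 * D) A) \<ge> real (card A) ^ (3 * D) / K"
  obtains A' where "A' \<subseteq> A" "real (card A') \<ge> real (card A) / (16 * K ^ 2)"
    "\<And>n. real (card (psums k ` words A' n)) \<le> (2 ^ 43 * K ^ 30) ^ n * real (card A) ^ D"
proof -
  define W where "W = words A D"
  have cW: "card W = card A ^ D" by (simp add: W_def card_words A)
  have cA: "card A > 0" using A by (simp add: card_gt_0_iff)
  have W: "finite W" by (simp add: W_def finite_words A)
  have W': "W \<noteq> {}" using cW cA by auto
  have J1': "real (card {(x, y) \<in> W \<times> W. psums k x = psums k y}) \<le> K * real (card W)"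
    using J1 by (simp add: solutions_def W_def cW[unfolded W_def])
  have "solutions k (2 * D) A = card {(p, q) \<in> (W \<times> W) \<times> (W \<times> W). psums k (fst p @ snd p) = psums k (fst q @ snd q)}"
    unfolding solutions_def mult_2 words_add W_def by (rule card_collisions_inj[OF inj_on_append_words])
  hence J2': "real (card {(p, q) \<in> (W \<times> W) \<times> (W \<times> W). psums k (fst p) + psums k (snd p) = psums k (fst q) + psums k (snd q)}) \<ge> real (card W) ^ 3 / K"
    using J2 unfolding psums_append by (simp add: cW power_mult mult.commute[of 3])
  obtain X Y where X: "X \<subseteq> W" and Y: "Y \<subseteq> W" "Y \<noteq> {}" and cX: "real (card X) \<ge> real (card W) / (16 * K ^ 2)"
    and XY: "real (card (psums k ` X + psums k ` Y)) \<le> 2 ^ 43 * K ^ 30 * real (card (psums k ` Y))"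
    by (rule Balog_Szemeredi_Gowers[OF W W' K J1' J2'])
  define K2 where "K2 = 2 ^ 43 * K ^ 30"
  have K2: "K2 \<ge> 0" using K by (simp add: K2_def)
  obtain d where d: "D = Suc d" using D by (cases D) auto
  \<comment> \<open>Pigeonhole over the tails: some tail \<open>t\<close> has as large a proportion
    of admissible first letters as \<open>X\<close> has in all words.\<close>
  have "\<exists>t\<in>words A d. real (card {a \<in> A. a # t \<in> X}) \<ge> real (card A) / (16 * K ^ 2)"
  proof (rule ccontr)
    assume neg: "\<not> ?thesis"
    have finX: "finite X" using X W finite_subset by blast
    define T where "T = (SIGMA t:words A d. {a \<in> A. a # t \<in> X})"
    have finT: "finite T" unfolding T_def using A finite_words[of A d] by (intro finite_SigmaI) auto
    have "X = (\<lambda>(t, a). a # t) ` T" unfolding T_def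
    proof (intro equalityI subsetI)
      fix xs assume xs: "xs \<in> X"
      then obtain a t where "xs = a # t" "a \<in> A" "t \<in> words A d"
        using X by (auto simp: W_def d words_Suc)
      thus "xs \<in> (\<lambda>(t, a). a # t) ` (SIGMA t:words A d. {a \<in> A. a # t \<in> X})" using xs by force
    qed auto
    hence "card X = card ((\<lambda>(t, a). a # t) ` T)" by (rule arg_cong)
    also have "\<dots> \<le> card T" by (rule card_image_le[OF finT])
    also have "card T = (\<Sum>t\<in>words A d. card {a \<in> A. a # t \<in> X})"
      unfolding T_def using A finite_words[of A d] by simp
    finally have "real (card X) \<le> (\<Sum>t\<in>words A d. real (card {a \<in> A. a # t \<in> X}))" by (simp flip: of_nat_sum)
    also have "\<dots> < (\<Sum>t\<in>words A d. real (card A) / (16 * K ^ 2))"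
    proof (rule sum_strict_mono)
      show "words A d \<noteq> {}" using card_words[OF A(1), of d] cA by auto
    qed (use neg A finite_words[of A d] in \<open>auto simp: not_le\<close>)
    also have "\<dots> = real (card W) / (16 * K ^ 2)" by (simp add: card_words A cW d)
    finally show False using cX by simp
  qed
  then obtain t where t: "t \<in> words A d" "real (card {a \<in> A. a # t \<in> X}) \<ge> real (card A) / (16 * K ^ 2)" by blast
  define A' where "A' = {a \<in> A. a # t \<in> X}"
  have finA': "finite A'" using A by (simp add: A'_def)
  define V where "V = (\<lambda>a. psums k [a]) ` A'"
  have cons: "psums k (a # xs) = psums k [a] + psums k xs" for a xs using psums_append[of k "[a]" xs] by simp
  have "{psums k t} + (V + psums k ` Y) \<subseteq> psums k ` X + psums k ` Y"
  proof
    fix v assume "v \<in> {psums k t} + (V + psums k ` Y)"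
    then obtain a y where ay: "a \<in> A'" "y \<in> Y" "v = psums k t + (psums k [a] + psums k y)" by (auto simp: set_plus_def V_def)
    hence v: "v = psums k (a # t) + psums k y" unfolding cons[of a t] by (simp add: add_ac)
    have "a # t \<in> X" using ay by (simp add: A'_def)
    thus "v \<in> psums k ` X + psums k ` Y" unfolding v using ay by (intro set_plus_intro imageI)
  qed
  moreover have finY: "finite Y" "finite X" using X Y W finite_subset by blast+
  ultimately have "card ({psums k t} + (V + psums k ` Y)) \<le> card (psums k ` X + psums k ` Y)"
    by (intro card_mono finite_set_plus) auto
  hence VY: "real (card (V + psums k ` Y)) \<le> K2 * real (card (psums k ` Y))"
    using XY unfolding card_translate K2_def by linarith
  have finV: "finite V" using finA' by (simp add: V_def)
  have Y': "finite (psums k ` Y)" "psums k ` Y \<noteq> {}" using finY Y by auto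
  obtain Z where Z: "Z \<subseteq> psums k ` Y" "Z \<noteq> {}"
    and pet: "\<And>C. finite C \<Longrightarrow> real (card (V + (Z + C))) \<le> K2 * real (card (Z + C))"
    using Pluennecke_Petridis[OF finV Y' VY] by blast
  have finZ: "finite Z" using Z Y' finite_subset by blast
  have cZ: "real (card Z) \<le> real (card A) ^ D"
  proof -
    have "card Z \<le> card (psums k ` Y)" using Z Y' by (intro card_mono) auto
    also have "\<dots> \<le> card Y" using finY by (intro card_image_le)
    also have "\<dots> \<le> card W" using Y W by (intro card_mono)
    finally show ?thesis unfolding cW by (simp flip: of_nat_power)
  qed
  show ?thesis
  proof (rule that[of A'])
    show "A' \<subseteq> A" by (auto simp: A'_def)
    show "real (card A') \<ge> real (card A) / (16 * K ^ 2)" using t by (simp add: A'_def)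
    fix n
    let ?P = "\<lambda>n. psums k ` words A' n"
    have finP: "finite (?P n)" for n using finA' by (simp add: finite_words)
    have iter: "real (card (Z + ?P n)) \<le> K2 ^ n * real (card Z)" for n
    proof (induction n)
      case 0
      have "Z + {psums k []} = {psums k []} + Z" by (rule add.commute)
      thus ?case by (simp add: card_translate)
    next
      case (Suc n)
      have "?P (Suc n) = V + ?P n"
        unfolding words_Suc V_def set_plus_def by (auto simp: image_iff cons[symmetric])
      hence "Z + ?P (Suc n) = V + (Z + ?P n)" by (simp add: add_ac)
      hence "real (card (Z + ?P (Suc n))) \<le> K2 * real (card (Z + ?P n))" using pet[OF finP] by simp
      also have "\<dots> \<le> K2 * (K2 ^ n * real (card Z))" using Suc K2 by (intro mult_left_mono)
      finally show ?case by (simp add: mult_ac)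
    qed
    obtain z where z: "z \<in> Z" using Z by auto
    have "card (?P n) = card ({z} + ?P n)" by (rule card_translate[symmetric])
    also have "\<dots> \<le> card (Z + ?P n)" using z finZ finP by (intro card_mono finite_set_plus) (auto simp: set_plus_def)
    finally have "real (card (?P n)) \<le> K2 ^ n * real (card Z)" using iter[of n] by linarith
    also have "\<dots> \<le> K2 ^ n * real (card A) ^ D" using cZ K2 by (intro mult_left_mono) auto
    finally show "real (card (?P n)) \<le> (2 ^ 43 * K ^ 30) ^ n * real (card A) ^ D" unfolding K2_def .
  qed
qed

section \<open>Multiplicative energy\<close>

text \<open>The action on power sum vectors of multiplying all points by \<open>\<rho>\<close>. On
  coordinate 1 it is plain multiplication by \<open>\<rho>\<close>, which is why slopes are compared
  there.\<close>

definition dilate :: "real \<Rightarrow> (nat \<Rightarrow> real) \<Rightarrow> nat \<Rightarrow> real" where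
  "dilate \<rho> v = (\<lambda>j. \<rho> ^ j * v j)"

lemma psums_dilate: "psums k (map ((*) \<rho>) xs) = dilate \<rho> (psums k xs)"
proof
  fix j
  have "(\<Sum>x\<leftarrow>map ((*) \<rho>) xs. x ^ j) = \<rho> ^ j * (\<Sum>x\<leftarrow>xs. x ^ j)"
    by (induction xs) (simp_all add: power_mult_distrib distrib_left)
  thus "psums k (map ((*) \<rho>) xs) j = dilate \<rho> (psums k xs) j" by (simp add: psums_def dilate_def)
qed

text \<open>Cauchy-Schwarz: a mean value bound of diagonal size forces the sums of \<open>n\<close>
  letters to be almost as numerous as the words.\<close>

lemma card_words_le_sums:
  assumes "finite B" and sol: "real (solutions k n B) \<le> V * real (card B) ^ n" and "card B > 0"
  shows "real (card B) ^ n \<le> V * real (card (psums k ` words B n))"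
proof -
  have "(real (card B) ^ n) ^ 2 \<le> real (card (psums k ` words B n)) * real (solutions k n B)"
    using card_square_le_collisions[OF finite_words[OF assms(1), of n], of "psums k"]
    by (simp add: card_words[OF assms(1)] solutions_def)
  also have "\<dots> \<le> real (card (psums k ` words B n)) * (V * real (card B) ^ n)"
    using sol by (intro mult_left_mono) auto
  finally have "real (card B) ^ n * real (card B) ^ n \<le> real (card B) ^ n * (V * real (card (psums k ` words B n)))"
    by (simp add: power2_eq_square mult_ac)
  thus ?thesis by (rule mult_left_le_imp_le) (use assms(3) in simp)
qed

definition ratios :: "real set \<Rightarrow> real set" where
  "ratios B = (\<lambda>p. fst p / snd p) ` (B \<times> B)"

definition mult_rep :: "real set \<Rightarrow> real \<Rightarrow> nat" where
  "mult_rep B \<rho> = card {b \<in> B. \<rho> * b \<in> B}"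

text \<open>Solymosi's argument: for consecutive rich ratios \<open>\<rho> < \<mu>\<close> the vectors
  \<open>(u + v, dilate \<rho> u + dilate \<mu> v)\<close> lie, in the first coordinates, in disjoint open cones.\<close>

lemma rich_ratios:
  fixes V :: real
  assumes B: "finite B" "\<And>b. b \<in> B \<Longrightarrow> b > 0" and k: "k \<ge> 1" and n: "n \<ge> 1" and V: "V > 0"
    and sol: "\<And>C. C \<subseteq> B \<Longrightarrow> real (solutions k n C) \<le> V * real (card C) ^ n" and t: "t \<ge> 1"
  shows "real (card {\<rho> \<in> ratios B. mult_rep B \<rho> \<ge> t}) * real t ^ (2 * n)
     \<le> 2 * V ^ 2 * real (card (psums k ` words B (2 * n))) ^ 2"
proof -
  define \<Lambda> where "\<Lambda> = {\<rho> \<in> ratios B. mult_rep B \<rho> \<ge> t}"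
  \<comment> \<open>Sums of \<open>n\<close> elements that remain in \<open>B\<close> after
    multiplication by \<open>\<rho>\<close>. For such a sum \<open>u\<close>, both \<open>u\<close>
    and \<open>dilate \<rho> u\<close> are sums of \<open>n\<close> elements of
    \<open>B\<close>.\<close>
  define S where "S = (\<lambda>\<rho>. psums k ` words {b \<in> B. \<rho> * b \<in> B} n)"
  define P where "P = psums k ` words B (2 * n)"
  have finL: "finite \<Lambda>" using B by (simp add: \<Lambda>_def ratios_def)
  have Lpos: "\<rho> > 0" if "\<rho> \<in> \<Lambda>" for \<rho> using that B(2) by (auto simp: \<Lambda>_def ratios_def)
  have finP: "finite P" using finite_words[OF B(1)] by (simp add: P_def)
  have finS: "finite (S \<rho>)" for \<rho> using finite_words[of "{b \<in> B. \<rho> * b \<in> B}" n] B(1) by (simp add: S_def)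
  define \<tau> where "\<tau> = real t ^ n / V"
  have \<tau>: "\<tau> > 0" using t V by (simp add: \<tau>_def)
  have S_card: "\<tau> \<le> real (card (S \<rho>))" if "\<rho> \<in> \<Lambda>" for \<rho>
  proof -
    let ?B = "{b \<in> B. \<rho> * b \<in> B}"
    have ct: "card ?B \<ge> t" using that by (simp add: \<Lambda>_def mult_rep_def)
    have "real t ^ n \<le> real (card ?B) ^ n" using ct by (intro power_mono) auto
    also have "\<dots> \<le> V * real (card (S \<rho>))"
      unfolding S_def using B(1) ct t by (intro card_words_le_sums sol) auto
    finally show ?thesis using V by (simp add: \<tau>_def field_simps)
  qed
  have pos1: "u 1 > 0" if u: "u \<in> S \<rho>" for u \<rho>
  proof -
    obtain xs where xs: "xs \<in> words {b \<in> B. \<rho> * b \<in> B} n" "u = psums k xs" using u by (auto simp: S_def)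
    have "(\<Sum>x\<leftarrow>xs. x) > 0" if "xs \<noteq> []" "\<forall>x\<in>set xs. x > 0" for xs :: "real list"
      using that by (induction xs rule: list_nonempty_induct) (auto intro: add_pos_pos)
    moreover have "xs \<noteq> []" "\<forall>x\<in>set xs. x > 0" using xs n B(2) by (auto simp: words_def)
    ultimately show ?thesis using xs k by (simp add: psums_def)
  qed
  have outside: "u j = 0" if "u \<in> S \<rho>" "j \<notin> {1..k}" for u \<rho> j using that by (auto simp: S_def psums_def)
  have main: "real (card \<Lambda>) * \<tau> ^ 2 \<le> 2 * real (card P) ^ 2"
  proof (cases "card \<Lambda> \<le> 1")
    case True
    show ?thesis
    proof (cases "\<Lambda> = {}")
      case False
      then obtain \<rho> where \<rho>: "\<rho> \<in> \<Lambda>" by blast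
      have "card {b \<in> B. \<rho> * b \<in> B} \<ge> 1" using \<rho> t by (simp add: \<Lambda>_def mult_rep_def)
      then obtain b where b: "b \<in> B" by (auto simp: card_gt_0_iff Suc_le_eq)
      \<comment> \<open>A single ratio has no neighbour to pair with; adding a fixed word of length
        \<open>n\<close> places a translate of its sums inside \<open>P\<close>.\<close>
      have "{psums k (replicate n b)} + S \<rho> \<subseteq> P"
      proof
        fix v assume "v \<in> {psums k (replicate n b)} + S \<rho>"
        then obtain xs where xs: "xs \<in> words {b \<in> B. \<rho> * b \<in> B} n" "v = psums k (replicate n b) + psums k xs"
          by (auto simp: set_plus_def S_def)
        hence "replicate n b @ xs \<in> words B (2 * n)" using b by (auto simp: words_def)
        thus "v \<in> P" unfolding P_def xs(2) psums_append[symmetric] by (rule imageI)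
      qed
      hence "card (S \<rho>) \<le> card P" using finP card_mono card_translate by metis
      hence "\<tau> \<le> real (card P)" using S_card[OF \<rho>] by linarith
      hence "\<tau> ^ 2 \<le> real (card P) ^ 2" using \<tau> by (intro power_mono) auto
      moreover have "real (card \<Lambda>) * \<tau> ^ 2 \<le> 1 * \<tau> ^ 2" using True by (intro mult_right_mono) auto
      moreover have "0 \<le> real (card P) ^ 2" by simp
      ultimately show ?thesis by linarith
    qed simp
  next
    case False
    \<comment> \<open>The largest ratio has no successor and is dropped. There are at least two
      ratios, so this costs a factor of at most 2.\<close>
    define \<Lambda>' where "\<Lambda>' = \<Lambda> - {Max \<Lambda>}"
    have ne: "\<Lambda> \<noteq> {}" using False by auto
    have finL': "finite \<Lambda>'" "\<Lambda>' \<subseteq> \<Lambda>" using finL by (auto simp: \<Lambda>'_def)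
    have cL': "card \<Lambda>' = card \<Lambda> - 1" using finL ne by (simp add: \<Lambda>'_def)
    define succ where "succ = (\<lambda>\<rho>. Min {\<mu> \<in> \<Lambda>. \<mu> > \<rho>})"
    have succ: "succ \<rho> \<in> \<Lambda>" "succ \<rho> > \<rho>" if "\<rho> \<in> \<Lambda>'" for \<rho>
    proof -
      have "\<rho> \<noteq> Max \<Lambda>" "\<rho> \<le> Max \<Lambda>" using that finL by (auto simp: \<Lambda>'_def)
      hence "Max \<Lambda> \<in> {\<mu> \<in> \<Lambda>. \<mu> > \<rho>}" using Max_in[OF finL ne] by auto
      hence "succ \<rho> \<in> {\<mu> \<in> \<Lambda>. \<mu> > \<rho>}" unfolding succ_def using finL by (intro Min_in) auto
      thus "succ \<rho> \<in> \<Lambda>" "succ \<rho> > \<rho>" by auto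
    qed
    have succ_le: "succ \<rho> \<le> \<mu>" if "\<mu> \<in> \<Lambda>" "\<mu> > \<rho>" for \<rho> \<mu>
      unfolding succ_def using finL that by (intro Min_le) auto
    define D where "D = (SIGMA \<rho>:\<Lambda>'. S \<rho> \<times> S (succ \<rho>))"
    define \<Phi> where "\<Phi> = (\<lambda>(\<rho>, u, v). (u + v, dilate \<rho> u + dilate (succ \<rho>) v))"
    have cone: "\<rho> * (u 1 + v 1) < dilate \<rho> u 1 + dilate (succ \<rho>) v 1 \<and> dilate \<rho> u 1 + dilate (succ \<rho>) v 1 < succ \<rho> * (u 1 + v 1)"
      if d: "(\<rho>, u, v) \<in> D" for \<rho> u v
    proof -
      have uv: "u 1 > 0" "v 1 > 0" "succ \<rho> > \<rho>" using d pos1 succ by (auto simp: D_def)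
      have "\<rho> * v 1 < succ \<rho> * v 1" "\<rho> * u 1 < succ \<rho> * u 1" using uv by auto
      thus ?thesis by (simp add: dilate_def distrib_left)
    qed
    have order: "\<not> \<rho> < \<rho>'" if d: "(\<rho>, u, v) \<in> D" "(\<rho>', u', v') \<in> D" and eq: "\<Phi> (\<rho>, u, v) = \<Phi> (\<rho>', u', v')" for \<rho> u v \<rho>' u' v'
    proof
      assume lt: "\<rho> < \<rho>'"
      have e: "u + v = u' + v'" "dilate \<rho> u + dilate (succ \<rho>) v = dilate \<rho>' u' + dilate (succ \<rho>') v'" using eq by (auto simp: \<Phi>_def)
      have e1: "u 1 + v 1 = u' 1 + v' 1" "dilate \<rho> u 1 + dilate (succ \<rho>) v 1 = dilate \<rho>' u' 1 + dilate (succ \<rho>') v' 1"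
        using e[THEN fun_cong, of 1] by auto
      have "\<rho>' \<in> \<Lambda>" using d finL' by (auto simp: D_def)
      hence "succ \<rho> \<le> \<rho>'" using lt by (rule succ_le)
      moreover have "u 1 + v 1 > 0" using d(1) pos1 by (auto simp: D_def intro: add_pos_pos)
      ultimately have "succ \<rho> * (u 1 + v 1) \<le> \<rho>' * (u 1 + v 1)" by (intro mult_right_mono) auto
      thus False using cone[OF d(1)] cone[OF d(2)] e1 by auto
    qed
    have inj: "inj_on \<Phi> D"
    proof (rule inj_onI)
      fix p q assume p: "p \<in> D" and q: "q \<in> D" and eq: "\<Phi> p = \<Phi> q"
      obtain \<rho> u v where pp: "p = (\<rho>, u, v)" by (cases p) auto
      obtain \<rho>' u' v' where qq: "q = (\<rho>', u', v')" by (cases q) auto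
      have "\<rho> = \<rho>'"
        using order[of \<rho> u v \<rho>' u' v'] order[of \<rho>' u' v' \<rho> u v] p q eq unfolding pp qq by force
      have d: "(\<rho>, u, v) \<in> D" "(\<rho>, u', v') \<in> D" using p q pp qq \<open>\<rho> = \<rho>'\<close> by auto
      have e: "u + v = u' + v'" "dilate \<rho> u + dilate (succ \<rho>) v = dilate \<rho> u' + dilate (succ \<rho>) v'"
        using eq pp qq \<open>\<rho> = \<rho>'\<close> by (auto simp: \<Phi>_def)
      have \<rho>: "0 < \<rho>" "\<rho> < succ \<rho>" using d(1) Lpos finL' succ by (auto simp: D_def)
      have "u j = u' j \<and> v j = v' j" for j
      proof (cases "j \<in> {1..k}")
        case False
        have "u \<in> S \<rho>" "u' \<in> S \<rho>" "v \<in> S (succ \<rho>)" "v' \<in> S (succ \<rho>)" using d by (auto simp: D_def)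
        thus ?thesis using outside[OF _ False] by metis
      next
        case True
        have s: "u j + v j = u' j + v' j" "\<rho> ^ j * u j + succ \<rho> ^ j * v j = \<rho> ^ j * u' j + succ \<rho> ^ j * v' j"
          using e[THEN fun_cong, of j] by (auto simp: dilate_def)
        \<comment> \<open>In coordinate \<open>j\<close> the two vectors form a linear system with
          determinant \<open>succ \<rho> ^ j - \<rho> ^ j\<close>, which is non-zero because
          \<open>j \<ge> 1\<close> and \<open>0 < \<rho> < succ \<rho>\<close>.\<close>
        have "(succ \<rho> ^ j - \<rho> ^ j) * (v j - v' j) = (\<rho> ^ j * u j + succ \<rho> ^ j * v j) - (\<rho> ^ j * u' j + succ \<rho> ^ j * v' j)
            - \<rho> ^ j * ((u j + v j) - (u' j + v' j))" by (simp add: algebra_simps)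
        also have "\<dots> = 0" using s by simp
        finally have "v j = v' j" using power_strict_mono[OF \<rho>(2), of j] \<rho> True by auto
        thus ?thesis using s by simp
      qed
      hence "u = u'" "v = v'" by auto
      thus "p = q" using pp qq \<open>\<rho> = \<rho>'\<close> by simp
    qed
    have "\<Phi> ` D \<subseteq> P \<times> P"
    proof
      fix z assume "z \<in> \<Phi> ` D"
      then obtain \<rho> u v where d: "(\<rho>, u, v) \<in> D" "z = \<Phi> (\<rho>, u, v)" by auto
      obtain xs ys where xs: "xs \<in> words {b \<in> B. \<rho> * b \<in> B} n" "u = psums k xs"
        and ys: "ys \<in> words {b \<in> B. succ \<rho> * b \<in> B} n" "v = psums k ys"
        using d(1) by (auto simp: D_def S_def)
      have "xs @ ys \<in> words B (2 * n)" "map ((*) \<rho>) xs @ map ((*) (succ \<rho>)) ys \<in> words B (2 * n)"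
        using xs ys by (auto simp: words_def)
      moreover have "z = (psums k (xs @ ys), psums k (map ((*) \<rho>) xs @ map ((*) (succ \<rho>)) ys))"
        by (simp add: d \<Phi>_def psums_append psums_dilate xs ys)
      ultimately show "z \<in> P \<times> P" unfolding P_def by blast
    qed
    hence "card (\<Phi> ` D) \<le> card (P \<times> P)" using finP by (intro card_mono) auto
    hence "card D \<le> card P * card P" using inj by (simp add: card_image card_cartesian_product)
    hence cD: "real (card D) \<le> real (card P) ^ 2" by (simp add: power2_eq_square flip: of_nat_mult)
    have "real (card \<Lambda>') * \<tau> ^ 2 \<le> (\<Sum>\<rho>\<in>\<Lambda>'. real (card (S \<rho>)) * real (card (S (succ \<rho>))))"
    proof (rule sum_bounded_below)
      fix \<rho> assume "\<rho> \<in> \<Lambda>'"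
      thus "\<tau> ^ 2 \<le> real (card (S \<rho>)) * real (card (S (succ \<rho>)))"
        unfolding power2_eq_square using S_card succ finL' \<tau> by (intro mult_mono) auto
    qed
    also have "\<dots> = real (card D)" unfolding D_def using finL' finS by (simp add: card_cartesian_product)
    finally have "real (card \<Lambda>') * \<tau> ^ 2 \<le> real (card P) ^ 2" using cD by linarith
    moreover have "real (card \<Lambda>) \<le> 2 * real (card \<Lambda>')" using cL' False by linarith
    hence "real (card \<Lambda>) * \<tau> ^ 2 \<le> 2 * real (card \<Lambda>') * \<tau> ^ 2" by (intro mult_right_mono) auto
    ultimately show ?thesis by linarith
  qed
  have "real (card \<Lambda>) * real t ^ (2 * n) = V ^ 2 * (real (card \<Lambda>) * \<tau> ^ 2)"
    using V by (simp add: \<tau>_def power_divide mult.commute flip: power_mult)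
  also have "\<dots> \<le> V ^ 2 * (2 * real (card P) ^ 2)" using main by (intro mult_left_mono) auto
  finally show ?thesis unfolding \<Lambda>_def P_def by (simp add: mult_ac)
qed

lemma fibre_ratio:
  assumes "\<And>b. b \<in> B \<Longrightarrow> b > 0"
  shows "card {p \<in> B \<times> B. fst p / snd p = \<rho>} = mult_rep B \<rho>"
proof -
  have "{p \<in> B \<times> B. fst p / snd p = \<rho>} = (\<lambda>b. (\<rho> * b, b)) ` {b \<in> B. \<rho> * b \<in> B}"
  proof (intro equalityI subsetI)
    fix p assume "p \<in> {p \<in> B \<times> B. fst p / snd p = \<rho>}"
    then obtain a b where p: "p = (a, b)" "a \<in> B" "b \<in> B" "a / b = \<rho>" by auto
    hence "a = \<rho> * b" using assms[of b] by auto
    thus "p \<in> (\<lambda>b. (\<rho> * b, b)) ` {b \<in> B. \<rho> * b \<in> B}" using p by auto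
  next
    fix p assume "p \<in> (\<lambda>b. (\<rho> * b, b)) ` {b \<in> B. \<rho> * b \<in> B}"
    then obtain b where b: "p = (\<rho> * b, b)" "b \<in> B" "\<rho> * b \<in> B" by auto
    thus "p \<in> {p \<in> B \<times> B. fst p / snd p = \<rho>}" using assms[of b] by auto
  qed
  moreover have "inj_on (\<lambda>b. (\<rho> * b, b)) {b \<in> B. \<rho> * b \<in> B}" by (auto simp: inj_on_def)
  ultimately show ?thesis by (simp add: mult_rep_def card_image)
qed

text \<open>The energy is a weighted sum over \<open>t\<close> of the number of ratios with at least
  \<open>t\<close> representations, which has a trivial bound and the bound from the cones. Their
  weighted geometric mean decays like \<open>t^(-2)\<close>, the borderline at which the sum over
  \<open>t\<close> is harmonic.\<close>

lemma multiplicative_energy_le: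
  fixes V :: real
  assumes B: "finite B" "\<And>b. b \<in> B \<Longrightarrow> b > 0" "B \<noteq> {}" and k: "k \<ge> 1" and n: "n \<ge> 1" and V: "V > 0"
    and sol: "\<And>C. C \<subseteq> B \<Longrightarrow> real (solutions k n C) \<le> V * real (card C) ^ n"
  defines "\<delta> \<equiv> 1 / (2 * real n - 1)"
  shows "(\<Sum>\<rho>\<in>ratios B. real (mult_rep B \<rho>) ^ 2) \<le>
     2 * ((real (card B) ^ 2) powr (1 - \<delta>) * (2 * V ^ 2 * real (card (psums k ` words B (2 * n))) ^ 2) powr \<delta>) * (1 + ln (real (card B)))"
proof -
  define N where "N = card B"
  have N: "N > 0" using B by (simp add: N_def card_gt_0_iff)
  define Z where "Z = 2 * V ^ 2 * real (card (psums k ` words B (2 * n))) ^ 2"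
  define X where "X = (real N ^ 2) powr (1 - \<delta>) * Z powr \<delta>"
  have X0: "X \<ge> 0" by (simp add: X_def)
  have \<delta>: "0 < \<delta>" "\<delta> \<le> 1" "2 * real n * \<delta> = 1 + \<delta>" using n by (auto simp: \<delta>_def field_simps)
  define r where "r = (\<lambda>t. card {\<rho> \<in> ratios B. mult_rep B \<rho> \<ge> t})"
  have finR: "finite (ratios B)" using B by (simp add: ratios_def)
  have mN: "mult_rep B \<rho> \<le> N" for \<rho> unfolding mult_rep_def N_def using B by (intro card_mono) auto
  have sum_m: "(\<Sum>\<rho>\<in>ratios B. real (mult_rep B \<rho>)) = real N ^ 2"
  proof -
    have "card (B \<times> B) = (\<Sum>\<rho>\<in>ratios B. card {p \<in> B \<times> B. fst p / snd p = \<rho>})"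
      unfolding ratios_def using B by (intro card_sum_fibres) auto
    also have "\<dots> = (\<Sum>\<rho>\<in>ratios B. mult_rep B \<rho>)" using fibre_ratio[OF B(2)] by (intro sum.cong) auto
    finally show ?thesis by (simp add: N_def card_cartesian_product power2_eq_square flip: of_nat_sum of_nat_mult)
  qed
  have r_bound: "real t * real (r t) \<le> X * inverse (real t)" if t: "t \<in> {1..N}" for t
  proof -
    have t0: "real t > 0" using t by simp
    have "real (r t) * real t \<le> (\<Sum>\<rho>\<in>{\<rho> \<in> ratios B. mult_rep B \<rho> \<ge> t}. real (mult_rep B \<rho>))"
      unfolding r_def by (intro sum_bounded_below) auto
    also have "\<dots> \<le> real N ^ 2" unfolding sum_m[symmetric] using finR by (intro sum_mono2) auto
    finally have 1: "real (r t) \<le> real N ^ 2 / real t" using t0 by (simp add: field_simps)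
    have "real (r t) * real t ^ (2 * n) \<le> Z"
      unfolding r_def Z_def using t by (intro rich_ratios[OF B(1,2) k n V sol]) auto
    hence 2: "real (r t) \<le> Z / real t ^ (2 * n)" using t0 by (simp add: field_simps)
    have "real (r t) = real (r t) powr (1 - \<delta>) * real (r t) powr \<delta>"
      by (cases "r t = 0") (auto simp flip: powr_add)
    also have "\<dots> \<le> (real N ^ 2 / real t) powr (1 - \<delta>) * (Z / real t ^ (2 * n)) powr \<delta>"
      using 1 2 \<delta> by (intro mult_mono powr_mono2) auto
    also have "\<dots> = X / (real t powr (1 - \<delta>) * (real t ^ (2 * n)) powr \<delta>)"
      using t0 V by (simp add: X_def powr_divide Z_def)
    also have "real t powr (1 - \<delta>) * (real t ^ (2 * n)) powr \<delta> = real t powr 2"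
    proof -
      have "(real t ^ (2 * n)) powr \<delta> = real t powr (2 * real n * \<delta>)"
        using t0 by (simp add: powr_powr flip: powr_realpow)
      thus ?thesis unfolding \<delta>(3) by (simp flip: powr_add)
    qed
    finally have "real (r t) \<le> X / real t ^ 2" using t0 by (simp add: powr_numeral)
    hence "real t * real (r t) \<le> real t * (X / real t ^ 2)" by (intro mult_left_mono) auto
    thus ?thesis using t0 by (simp add: power2_eq_square field_simps)
  qed
  have "(\<Sum>\<rho>\<in>ratios B. real (mult_rep B \<rho>) ^ 2) \<le> (\<Sum>\<rho>\<in>ratios B. \<Sum>t\<in>{1..N}. if t \<le> mult_rep B \<rho> then 2 * real t else 0)"
  proof (rule sum_mono)
    fix \<rho>
    let ?m = "mult_rep B \<rho>"
    \<comment> \<open>Layers: a square is at most the sum of \<open>2 t\<close> over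
      \<open>t\<close> up to \<open>m\<close>, so the energy is controlled by the counts of rich
      ratios.\<close>
    have "real ?m ^ 2 \<le> real ?m * (real ?m + 1)"
      unfolding power2_eq_square by (intro mult_left_mono) auto
    also have "\<dots> = (\<Sum>t\<in>{1..?m}. 2 * real t)"
    proof -
      have "(\<Sum>t\<in>{1..m}. 2 * real t) = real m * (real m + 1)" for m
        by (induction m) (simp_all add: algebra_simps)
      thus ?thesis by simp
    qed
    also have "\<dots> = (\<Sum>t\<in>{1..N}. if t \<le> ?m then 2 * real t else 0)"
      using mN[of \<rho>] by (intro sum.mono_neutral_cong_left) auto
    finally show "real ?m ^ 2 \<le> (\<Sum>t\<in>{1..N}. if t \<le> ?m then 2 * real t else 0)" .
  qed
  also have "\<dots> = (\<Sum>t\<in>{1..N}. \<Sum>\<rho>\<in>ratios B. if t \<le> mult_rep B \<rho> then 2 * real t else 0)" by (rule sum.swap)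
  also have "\<dots> = (\<Sum>t\<in>{1..N}. 2 * (real t * real (r t)))"
    using finR by (intro sum.cong refl) (simp add: sum.If_cases r_def Int_def)
  also have "\<dots> \<le> (\<Sum>t\<in>{1..N}. 2 * (X * inverse (real t)))"
    using r_bound by (intro sum_mono mult_left_mono) auto
  also have "\<dots> = 2 * X * harm N" by (simp add: harm_def sum_distrib_left mult.assoc)
  also have "\<dots> \<le> 2 * X * (1 + ln (real N))"
  proof (intro mult_left_mono)
    show "harm N \<le> 1 + ln (real N)" using euler_mascheroni_sequence_decreasing[of 1 N] N by (simp add: harm_def)
  qed (use X0 in simp)
  finally show ?thesis unfolding X_def Z_def N_def .
qed

text \<open>For positive numbers, \<open>a b = c d\<close> is the same as
  \<open>a / c = d / b\<close>. Products and ratios thus have the same energy, and one upper bound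
  for it serves both sets.\<close>

lemma card_ratios_energy:
  assumes "finite B" "\<And>b. b \<in> B \<Longrightarrow> b > 0"
  shows "real (card B) ^ 4 \<le> real (card (ratios B)) * (\<Sum>\<rho>\<in>ratios B. real (mult_rep B \<rho>) ^ 2)"
    and "real (card B) ^ 4 \<le> real (card (B * B)) * (\<Sum>\<rho>\<in>ratios B. real (mult_rep B \<rho>) ^ 2)"
proof -
  let ?X = "B \<times> B"
  have finX: "finite ?X" using assms by simp
  have sq: "real (card ?X) ^ 2 = real (card B) ^ 4"
    by (simp add: card_cartesian_product power2_eq_square power4_eq_xxxx)
  have E: "real (card {(p, q) \<in> ?X \<times> ?X. fst p / snd p = fst q / snd q}) = (\<Sum>\<rho>\<in>ratios B. real (mult_rep B \<rho>) ^ 2)"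
    unfolding card_eq_sum_fibres[OF finX] ratios_def using fibre_ratio[OF assms(2)] by simp
  show "real (card B) ^ 4 \<le> real (card (ratios B)) * (\<Sum>\<rho>\<in>ratios B. real (mult_rep B \<rho>) ^ 2)"
    using card_square_le_collisions[OF finX, of "\<lambda>p. fst p / snd p"] unfolding E sq ratios_def[symmetric] .
  have "{(p, q) \<in> ?X \<times> ?X. fst p * snd p = fst q * snd q}
     \<subseteq> (\<lambda>((a, c), (d, b)). ((a, b), (c, d))) ` {(p, q) \<in> ?X \<times> ?X. fst p / snd p = fst q / snd q}"
  proof
    fix z assume "z \<in> {(p, q) \<in> ?X \<times> ?X. fst p * snd p = fst q * snd q}"
    then obtain a b c d where z: "z = ((a, b), (c, d))" "a \<in> B" "b \<in> B" "c \<in> B" "d \<in> B" "a * b = c * d" by auto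
    have "b > 0" "c > 0" using assms(2) z by auto
    hence "a / c = d / b" using z(6) by (simp add: field_simps)
    hence "((a, c), (d, b)) \<in> {(p, q) \<in> ?X \<times> ?X. fst p / snd p = fst q / snd q}" using z by simp
    thus "z \<in> (\<lambda>((a, c), (d, b)). ((a, b), (c, d))) ` {(p, q) \<in> ?X \<times> ?X. fst p / snd p = fst q / snd q}"
      unfolding z(1) by (rule rev_image_eqI) simp
  qed
  moreover have fE: "finite {(p, q) \<in> ?X \<times> ?X. fst p / snd p = fst q / snd q}"
    by (rule finite_subset[of _ "?X \<times> ?X"]) (use finX in auto)
  ultimately have le: "card {(p, q) \<in> ?X \<times> ?X. fst p * snd p = fst q * snd q} \<le> card {(p, q) \<in> ?X \<times> ?X. fst p / snd p = fst q / snd q}"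
    by (meson card_image_le card_mono finite_imageI le_trans)
  have "(\<lambda>p. fst p * snd p) ` ?X = B * B" unfolding set_times_def by force
  hence "real (card B) ^ 4 \<le> real (card (B * B)) * real (card {(p, q) \<in> ?X \<times> ?X. fst p * snd p = fst q * snd q})"
    using card_square_le_collisions[OF finX, of "\<lambda>p. fst p * snd p"] unfolding sq by simp
  also have "\<dots> \<le> real (card (B * B)) * (\<Sum>\<rho>\<in>ratios B. real (mult_rep B \<rho>) ^ 2)"
    unfolding E[symmetric] using le by (intro mult_left_mono) auto
  finally show "real (card B) ^ 4 \<le> real (card (B * B)) * (\<Sum>\<rho>\<in>ratios B. real (mult_rep B \<rho>) ^ 2)" .
qed

section \<open>Sets with many solutions\<close>

lemma vinogradov_J_eq: "vinogradov_J s k A = solutions k s A"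
proof -
  define h where "h = (\<lambda>x :: nat \<Rightarrow> real. map x [1..<Suc s])"
  have sum_h: "(\<Sum>x\<leftarrow>h x. x ^ j) = (\<Sum>i=1..s. x i ^ j)" for x j
  proof -
    have "(\<Sum>x\<leftarrow>h x. x ^ j) = (\<Sum>i\<leftarrow>[1..<Suc s]. x i ^ j)" by (simp add: h_def o_def)
    also have "\<dots> = (\<Sum>i\<in>set [1..<Suc s]. x i ^ j)" by (rule sum_list_distinct_conv_sum_set) simp
    also have "set [1..<Suc s] = {1..s}" by auto
    finally show ?thesis .
  qed
  have inj: "inj_on h ({1..s} \<rightarrow>\<^sub>E A)"
  proof (rule inj_onI)
    fix x y assume xy: "x \<in> {1..s} \<rightarrow>\<^sub>E A" "y \<in> {1..s} \<rightarrow>\<^sub>E A" "h x = h y"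
    show "x = y"
    proof
      fix i show "x i = y i"
      proof (cases "i \<in> {1..s}")
        case True thus ?thesis using xy(3) by (auto simp: h_def)
      next
        case False thus ?thesis using xy(1,2) PiE_arb[of _ "{1..s}" "\<lambda>_. A" i] by metis
      qed
    qed
  qed
  have img: "h ` ({1..s} \<rightarrow>\<^sub>E A) = words A s"
  proof (intro equalityI subsetI)
    fix xs assume "xs \<in> h ` ({1..s} \<rightarrow>\<^sub>E A)"
    thus "xs \<in> words A s" by (auto simp: h_def words_def PiE_def Pi_def)
  next
    fix xs assume xs: "xs \<in> words A s"
    define x where "x = (\<lambda>i. if i \<in> {1..s} then xs ! (i - 1) else undefined)"
    have "x \<in> {1..s} \<rightarrow>\<^sub>E A"
    proof (intro PiE_I)
      fix i assume "i \<in> {1..s}"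
      hence "xs ! (i - 1) \<in> set xs" using xs by (intro nth_mem) (auto simp: words_def)
      thus "x i \<in> A" using xs \<open>i \<in> {1..s}\<close> by (auto simp: x_def words_def)
    qed (auto simp: x_def)
    moreover have "h x = xs"
      using xs by (intro nth_equalityI) (auto simp: h_def x_def words_def nth_append simp del: upt_Suc)
    ultimately show "xs \<in> h ` ({1..s} \<rightarrow>\<^sub>E A)" by blast
  qed
  have "solutions k s A = card {(x, y) \<in> ({1..s} \<rightarrow>\<^sub>E A) \<times> ({1..s} \<rightarrow>\<^sub>E A). psums k (h x) = psums k (h y)}"
    unfolding solutions_def img[symmetric] by (rule card_collisions_inj[OF inj])
  also have "\<dots> = vinogradov_J s k A"
    unfolding vinogradov_J_def psums_eq_iff sum_h by (intro arg_cong[where f = card]) auto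
  finally show ?thesis by simp
qed

text \<open>Fixing the first letter on either side shifts the remaining system, and a shifted system
  has at most as many solutions as the homogeneous one.\<close>

lemma solutions_Suc:
  assumes "finite A"
  shows "solutions k (Suc n) A \<le> card A ^ 2 * solutions k n A"
proof -
  let ?W = "words A n"
  have W: "finite ?W" by (rule finite_words[OF assms])
  have cancel: "psums k (a # x) = psums k (a # y) \<longleftrightarrow> psums k x = psums k y" for a x y
    using psums_append[of k "[a]" x] psums_append[of k "[a]" y] by simp
  let ?T = "\<lambda>a b. {(xs, ys) \<in> ?W \<times> ?W. psums k (a # xs) = psums k (b # ys)}"
  have T: "card (?T a b) \<le> solutions k n A" for a b
  proof -
    show ?thesis
      using card_match_le[OF W W, of "\<lambda>x. psums k (a # x)" "\<lambda>y. psums k (b # y)"]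
      unfolding cancel solutions_def by linarith
  qed
  have finT: "finite (?T a b)" for a b by (rule finite_subset[of _ "?W \<times> ?W"]) (use W in auto)
  have "{(xs, ys) \<in> words A (Suc n) \<times> words A (Suc n). psums k xs = psums k ys}
    = (\<lambda>((a, b), (xs, ys)). (a # xs, b # ys)) ` (SIGMA p:A \<times> A. ?T (fst p) (snd p))" (is "?L = ?R")
  proof (intro equalityI subsetI)
    fix z assume "z \<in> ?L"
    then obtain a xs b ys where "z = (a # xs, b # ys)" "a \<in> A" "b \<in> A" "xs \<in> ?W" "ys \<in> ?W" "psums k (a # xs) = psums k (b # ys)"
      by (auto simp: words_Suc)
    thus "z \<in> ?R" by (intro image_eqI[of _ _ "((a, b), (xs, ys))"]) auto
  qed (auto simp: words_Suc)
  hence "solutions k (Suc n) A = card ?R" unfolding solutions_def by (rule arg_cong)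
  also have "\<dots> \<le> card (SIGMA p:A \<times> A. ?T (fst p) (snd p))"
    using assms finT by (intro card_image_le finite_SigmaI) auto
  also have "\<dots> = (\<Sum>p\<in>A \<times> A. card (?T (fst p) (snd p)))" using assms finT by (intro card_SigmaI) auto
  also have "\<dots> \<le> (\<Sum>p\<in>A \<times> A. solutions k n A)" using T by (intro sum_mono)
  also have "\<dots> = card A ^ 2 * solutions k n A" by (simp add: card_cartesian_product power2_eq_square)
  finally show ?thesis .
qed

text \<open>Near maximality of the count for \<open>s\<close> variables descends, with the same
  \<alpha>, to the critical number \<open>k (k + 1)\<close>.\<close>

lemma solutions_add:
  assumes "finite A"
  shows "solutions k (n + d) A \<le> card A ^ (2 * d) * solutions k n A"
proof (induction d)
  case (Suc d)
  have "solutions k (n + Suc d) A \<le> card A ^ 2 * solutions k (n + d) A" using solutions_Suc[OF assms] by simp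
  also have "\<dots> \<le> card A ^ 2 * (card A ^ (2 * d) * solutions k n A)" using Suc by (intro mult_left_mono) auto
  finally show ?case by (simp add: power_add power2_eq_square mult_ac)
qed simp

lemma words_scale: "words ((*) \<sigma> ` B) n = map ((*) \<sigma>) ` words B n"
proof (intro equalityI subsetI)
  fix xs assume xs: "xs \<in> words ((*) \<sigma> ` B) n"
  hence "xs \<in> lists ((*) \<sigma> ` B)" by (auto simp: words_def)
  then obtain ys where "xs = map ((*) \<sigma>) ys" "ys \<in> lists B" unfolding lists_image by auto
  moreover from this have "ys \<in> words B n" using xs by (auto simp: words_def)
  ultimately show "xs \<in> map ((*) \<sigma>) ` words B n" by blast
qed (fastforce simp: words_def image_iff)

text \<open>With \<sigma> = -1 it allows a set of negative numbers to be replaced by positive ones,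
  which the cone argument requires.\<close>

lemma scale_invariance:
  fixes \<sigma> :: real
  assumes \<sigma>: "\<sigma> \<noteq> 0"
  shows "solutions k n ((*) \<sigma> ` B) = solutions k n B"
    and "card (psums k ` words ((*) \<sigma> ` B) n) = card (psums k ` words B n)"
proof -
  have inj: "inj (dilate \<sigma>)" using \<sigma> by (auto simp: inj_def dilate_def fun_eq_iff)
  have "inj_on (map ((*) \<sigma>)) (words B n)" using \<sigma> by (intro inj_on_subset[OF inj_mapI]) (auto simp: inj_def)
  thus "solutions k n ((*) \<sigma> ` B) = solutions k n B"
    unfolding solutions_def words_scale by (subst card_collisions_inj) (simp_all add: psums_dilate inj_eq[OF inj])
  have "psums k ` words ((*) \<sigma> ` B) n = dilate \<sigma> ` psums k ` words B n" unfolding words_scale by (auto simp: psums_dilate image_iff)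
  thus "card (psums k ` words ((*) \<sigma> ` B) n) = card (psums k ` words B n)"
    using inj by (simp add: card_image inj_on_subset)
qed

text \<open>An arbitrary interval of length 1 meets at most two of the intervals between consecutive
  integers. The definition restricts \<open>j\<close> to a range, but an interval outside that range
  contains no point of \<open>A\<close>.\<close>

lemma well_spaced_unit_interval:
  assumes ws: "well_spaced A"
  shows "card (A \<inter> {y..<y + 1}) \<le> 2"
proof -
  have fin: "finite A" using ws by (simp add: well_spaced_def)
  have one: "card (A \<inter> {of_int j<..of_int j + 1}) \<le> 1" for j :: int
  proof (cases "A \<inter> {of_int j<..of_int j + 1} = {}")
    case False
    then obtain x where x: "x \<in> A" "of_int j < x" "x \<le> of_int j + 1" by auto
    have "Inf A \<le> x" "x \<le> Sup A" using fin x(1) by (auto intro: cInf_lower cSup_upper bdd_below_finite bdd_above_finite)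
    hence "Inf A - 1 \<le> of_int j" "of_int j \<le> Sup A" using x by linarith+
    thus ?thesis using ws unfolding well_spaced_def by blast
  qed simp
  define j where "j = \<lceil>y\<rceil> - 1"
  have j: "of_int j < y" "y \<le> of_int j + 1" unfolding j_def by linarith+
  have "A \<inter> {y..<y + 1} \<subseteq> (A \<inter> {of_int j<..of_int j + 1}) \<union> (A \<inter> {of_int (j + 1)<..of_int (j + 1) + 1})"
    using j by auto
  hence "card (A \<inter> {y..<y + 1}) \<le> card ((A \<inter> {of_int j<..of_int j + 1}) \<union> (A \<inter> {of_int (j + 1)<..of_int (j + 1) + 1}))"
    using fin by (intro card_mono) auto
  also have "\<dots> \<le> 1 + 1" using one[of j] one[of "j + 1"] by (intro order_trans[OF card_Un_le add_mono])
  finally show ?thesis by simp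
qed

text \<open>The loss factor \<open>K = N powr \<eta>\<close> absorbs every constant, and the exponent \<open>2 D \<delta> = 1 + \<delta>\<close> is what
  turns the energy bound into \<open>n\<^sup>4 / E \<ge> N powr (1 + \<delta>)\<close> up to powers of \<open>K\<close>.\<close>

lemma growth_of_products:
  fixes \<eta> :: real
  assumes A: "finite A" "0 \<notin> A" "A \<noteq> {}" and k: "k \<ge> 1" and D: "D \<ge> 3" and \<eta>: "\<eta> > 0"
  defines "N \<equiv> real (card A)"
  defines "K \<equiv> N powr \<eta>" and "\<delta> \<equiv> 1 / (2 * real D - 1)"
  assumes sol: "\<And>C. C \<subseteq> A \<Longrightarrow> real (solutions k D C) \<le> K * real (card C) ^ D"
    and J: "real (solutions k (2 * D) A) \<ge> N ^ (3 * D) / K"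
    and big: "K \<ge> 2 ^ 43" "K \<ge> 1 + ln N"
  shows "N powr (1 + \<delta> - 90 * \<eta>) \<le> real (card (quotient_set A))"
    and "N powr (1 + \<delta> - 90 * \<eta>) \<le> real (card (A * A))"
proof -
  have N1: "N \<ge> 1" using A by (simp add: N_def card_gt_0_iff Suc_le_eq)
  have "(1 :: real) \<le> 2 ^ 43" by simp
  hence K1: "K \<ge> 1" using big(1) by (rule order_trans)
  have \<delta>: "0 < \<delta>" "\<delta> \<le> 1 / 5" "2 * real D * \<delta> = 1 + \<delta>" using D by (auto simp: \<delta>_def field_simps)
  obtain A' where A': "A' \<subseteq> A" "real (card A') \<ge> N / (16 * K ^ 2)"
    and sums: "\<And>n. real (card (psums k ` words A' n)) \<le> (2 ^ 43 * K ^ 30) ^ n * N ^ D"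
    unfolding N_def
    by (rule small_sumset_subset[OF A(1,3) _ K1 sol[OF order_refl] J[unfolded N_def]]) (use D in \<open>simp, blast\<close>)
  have finA': "finite A'" using A A' finite_subset by blast
  \<comment> \<open>The larger of the two sign classes keeps at least half of \<open>A'\<close>.
    Changing its sign affects neither ratios nor products of two elements.\<close>
  define B1 where "B1 = {a \<in> A'. a > 0}"
  define B2 where "B2 = {a \<in> A'. a < 0}"
  have "A' = B1 \<union> B2" using A' A(2) by (auto simp: B1_def B2_def) (metis linorder_neqE_linordered_idom subsetD)
  hence "card A' \<le> card B1 + card B2" using card_Un_le[of B1 B2] by simp
  hence "card A' \<le> 2 * card B1 \<or> card A' \<le> 2 * card B2" by linarith
  then obtain \<sigma> :: real and B' where \<sigma>: "\<sigma> = 1 \<or> \<sigma> = -1" and B': "B' \<subseteq> A'" "card A' \<le> 2 * card B'"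
    and pos': "\<And>b. b \<in> B' \<Longrightarrow> \<sigma> * b > 0"
  proof
    assume "card A' \<le> 2 * card B1"
    thus ?thesis using that[of 1 B1] by (auto simp: B1_def)
  next
    assume "card A' \<le> 2 * card B2"
    thus ?thesis using that[of "-1" B2] by (auto simp: B2_def)
  qed
  define B where "B = (*) \<sigma> ` B'"
  have \<sigma>0: "\<sigma> \<noteq> 0" and \<sigma>2: "\<sigma> * \<sigma> = 1" using \<sigma> by auto
  have finB: "finite B" using finA' B' finite_subset by (auto simp: B_def)
  have pos: "b > 0" if "b \<in> B" for b using that pos' by (auto simp: B_def)
  have cB: "card B = card B'" unfolding B_def using \<sigma>0 by (intro card_image) (auto simp: inj_on_def)
  have B'A: "B' \<subseteq> A" using B' A' by blast
  have solB: "real (solutions k D C) \<le> K * real (card C) ^ D" if C: "C \<subseteq> B" for C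
  proof -
    obtain C' where C': "C' \<subseteq> B'" "C = (*) \<sigma> ` C'" using C unfolding B_def by (auto simp: subset_image_iff)
    have "card C = card C'" unfolding C' using \<sigma>0 by (intro card_image) (auto simp: inj_on_def)
    thus ?thesis using sol[of C'] C' B'A unfolding C'(2) scale_invariance(1)[OF \<sigma>0] by auto
  qed
  define n where "n = real (card B)"
  have K43: "2 ^ 43 * K ^ 30 \<le> K ^ 31" using big(1) K1 mult_right_mono[of "2 ^ 43" K "K ^ 30"] by (simp flip: power_Suc)
  have n: "n \<ge> N / K ^ 3"
  proof -
    have "N / (16 * K ^ 2) \<le> 2 * n" using A'(2) B'(2) unfolding n_def cB by linarith
    hence "N / (32 * K ^ 2) \<le> n" by (simp add: field_simps)
    moreover have "N / K ^ 3 \<le> N / (32 * K ^ 2)"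
    proof (intro divide_left_mono)
      show "32 * K ^ 2 \<le> K ^ 3" using big(1) mult_right_mono[of 32 K "K ^ 2"] by (simp add: power3_eq_cube power2_eq_square)
    qed (use N1 K1 in auto)
    ultimately show ?thesis by linarith
  qed
  have npos: "n > 0" using n N1 K1 by (smt (verit) divide_pos_pos zero_less_power)
  hence Bne: "B \<noteq> {}" by (auto simp: n_def)
  define Q where "Q = real (card (psums k ` words B (2 * D)))"
  have Q: "Q \<le> K ^ (62 * D) * N ^ D"
  proof -
    have "card (psums k ` words B (2 * D)) = card (psums k ` words B' (2 * D))" unfolding B_def by (rule scale_invariance(2)[OF \<sigma>0])
    also have "\<dots> \<le> card (psums k ` words A' (2 * D))"
      using words_mono[OF B'(1)] finite_words[OF finA'] by (intro card_mono image_mono) auto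
    finally have "Q \<le> real (card (psums k ` words A' (2 * D)))" by (simp add: Q_def)
    also have "\<dots> \<le> (2 ^ 43 * K ^ 30) ^ (2 * D) * N ^ D" by (rule sums)
    also have "\<dots> \<le> (K ^ 31) ^ (2 * D) * N ^ D" using K43 K1 N1 by (intro mult_right_mono power_mono) auto
    finally show ?thesis by (simp flip: power_mult)
  qed
  define E where "E = (\<Sum>\<rho>\<in>ratios B. real (mult_rep B \<rho>) ^ 2)"
  define Z where "Z = 2 * K ^ 2 * Q ^ 2"
  have Q0: "Q \<ge> 0" by (simp add: Q_def)
  have E: "E \<le> 2 * ((n ^ 2) powr (1 - \<delta>) * Z powr \<delta>) * (1 + ln n)"
    unfolding E_def n_def Z_def Q_def \<delta>_def
    by (rule multiplicative_energy_le[OF finB pos Bne k _ _ solB]) (use D K1 in auto)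
  have nN: "n \<le> N"
    unfolding n_def cB N_def using card_mono[OF A(1) B'A] by simp
  have n1: "n \<ge> 1" using npos unfolding n_def by simp
  have Zle: "Z \<le> N powr (2 * real D + (3 + 124 * real D) * \<eta>)"
  proof -
    have Kp: "K ^ j = N powr (\<eta> * real j)" for j using N1 by (simp add: K_def powr_power mult.commute)
    have Np: "N ^ j = N powr real j" for j using N1 by (simp add: powr_realpow)
    have "Z \<le> K * K ^ 2 * (K ^ (62 * D) * N ^ D) ^ 2"
      unfolding Z_def using big(1) K1 Q Q0 by (intro mult_mono power_mono) auto
    also have "\<dots> = K ^ (3 + 124 * D) * N ^ (2 * D)"
    proof -
      have "(K ^ (62 * D) * N ^ D) ^ 2 = K ^ (124 * D) * N ^ (2 * D)"
        by (simp add: power_mult_distrib mult.commute[of _ 2] flip: power_mult)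
      moreover have "K * K ^ 2 = K ^ 3" by (simp add: power3_eq_cube power2_eq_square)
      ultimately show ?thesis by (simp add: power_add)
    qed
    also have "\<dots> = N powr (\<eta> * real (3 + 124 * D) + real (2 * D))" unfolding Kp Np powr_add ..
    finally show ?thesis by (simp add: algebra_simps)
  qed
  have gen: "N powr (1 + \<delta> - 90 * \<eta>) \<le> q" if q: "n ^ 4 \<le> q * E" "q \<ge> 0" for q
  proof -
    have "1 + ln n \<le> 1 + ln N" using n1 nN by simp
    hence ln: "1 + ln n \<le> K" using big(2) by linarith
    have X0: "(n ^ 2) powr (1 - \<delta>) * Z powr \<delta> \<ge> 0" by simp
    have "n ^ 4 \<le> q * (2 * ((n ^ 2) powr (1 - \<delta>) * Z powr \<delta>) * (1 + ln n))"
      using q E by (meson mult_left_mono order_trans)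
    also have "\<dots> \<le> q * (K * ((n ^ 2) powr (1 - \<delta>) * Z powr \<delta>) * K)"
      using q(2) ln X0 big(1) n1 by (intro mult_left_mono mult_mono mult_right_mono) auto
    also have "\<dots> = (q * K ^ 2 * Z powr \<delta>) * n powr (2 - 2 * \<delta>)"
    proof -
      have "(n ^ 2) powr (1 - \<delta>) = n powr (2 - 2 * \<delta>)"
        using npos by (simp add: powr_powr algebra_simps flip: powr_numeral)
      thus ?thesis by (simp add: power2_eq_square mult_ac)
    qed
    \<comment> \<open>The part \<open>2 - 2 \<delta>\<close> cancels against the trivial factor in
      the energy bound; what remains is compared with \<open>Z powr \<delta>\<close> alone.\<close>
    also have "n ^ 4 = n powr (2 + 2 * \<delta>) * n powr (2 - 2 * \<delta>)"
      using npos by (simp add: powr_numeral flip: powr_add)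
    finally have "n powr (2 + 2 * \<delta>) * n powr (2 - 2 * \<delta>) \<le> (q * K ^ 2 * Z powr \<delta>) * n powr (2 - 2 * \<delta>)" .
    hence main: "n powr (2 + 2 * \<delta>) \<le> q * K ^ 2 * Z powr \<delta>"
      by (rule mult_right_le_imp_le) (use npos in simp)
    have "N powr ((1 - 3 * \<eta>) * (2 + 2 * \<delta>)) = (N / K ^ 3) powr (2 + 2 * \<delta>)"
    proof -
      have "N / K ^ 3 = N powr (1 - 3 * \<eta>)" using N1 by (simp add: K_def powr_diff powr_power)
      thus ?thesis by (simp add: powr_powr)
    qed
    also have "\<dots> \<le> n powr (2 + 2 * \<delta>)" using n \<delta> N1 K1 by (intro powr_mono2) auto
    also have "\<dots> \<le> q * K ^ 2 * Z powr \<delta>" by (rule main)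
    also have "\<dots> \<le> q * K ^ 2 * (N powr (2 * real D + (3 + 124 * real D) * \<eta>)) powr \<delta>"
      using Zle \<delta> q(2) K1 by (intro mult_left_mono powr_mono2) (auto simp: Z_def Q0)
    also have "\<dots> = q * N powr (2 * \<eta> + (2 * real D + (3 + 124 * real D) * \<eta>) * \<delta>)"
    proof -
      have "K ^ 2 = N powr (2 * \<eta>)" using N1 by (simp add: K_def powr_power)
      thus ?thesis unfolding powr_powr by (simp only: powr_add mult.assoc)
    qed
    finally have "N powr ((1 - 3 * \<eta>) * (2 + 2 * \<delta>)) \<le> q * N powr (2 * \<eta> + (2 * real D + (3 + 124 * real D) * \<eta>) * \<delta>)" .
    hence "N powr ((1 - 3 * \<eta>) * (2 + 2 * \<delta>)) / N powr (2 * \<eta> + (2 * real D + (3 + 124 * real D) * \<eta>) * \<delta>) \<le> q"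
      using N1 by (simp add: divide_le_eq)
    hence le: "N powr ((1 - 3 * \<eta>) * (2 + 2 * \<delta>) - (2 * \<eta> + (2 * real D + (3 + 124 * real D) * \<eta>) * \<delta>)) \<le> q"
      by (simp add: powr_diff)
    have "(2 * real D + (3 + 124 * real D) * \<eta>) * \<delta> = 2 * real D * \<delta> + 3 * \<delta> * \<eta> + 62 * (2 * real D * \<delta>) * \<eta>"
      by (simp add: algebra_simps)
    also have "\<dots> = 1 + \<delta> + 3 * \<delta> * \<eta> + 62 * (1 + \<delta>) * \<eta>" unfolding \<delta>(3) by simp
    finally have e: "(1 - 3 * \<eta>) * (2 + 2 * \<delta>) - (2 * \<eta> + (2 * real D + (3 + 124 * real D) * \<eta>) * \<delta>) = 1 + \<delta> - (70 + 71 * \<delta>) * \<eta>"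
      by (simp add: algebra_simps)
    \<comment> \<open>The losses in units of \<open>\<eta>\<close> are \<open>6 + 6 \<delta>\<close>
      from \<open>n \<ge> N / K^3\<close>, 2 from the constant and the logarithm, and
      \<open>62 + 65 \<delta>\<close> from \<open>Z\<close>. With
      \<open>\<delta> \<le> 1 / 5\<close> the total is below 90.\<close>
    have "(70 + 71 * \<delta>) * \<eta> \<le> 90 * \<eta>" using \<delta> \<eta> by (intro mult_right_mono) auto
    hence "N powr (1 + \<delta> - 90 * \<eta>) \<le> N powr (1 + \<delta> - (70 + 71 * \<delta>) * \<eta>)" using N1 by (intro powr_mono) auto
    thus ?thesis using le unfolding e by linarith
  qed
  have "ratios B \<subseteq> quotient_set A"
  proof
    fix x assume "x \<in> ratios B"
    then obtain a b where ab: "a \<in> B'" "b \<in> B'" "x = \<sigma> * a / (\<sigma> * b)" by (auto simp: ratios_def B_def)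
    hence "x = a / b" using \<sigma>0 by simp
    thus "x \<in> quotient_set A" using ab B'A by (auto simp: quotient_set_def)
  qed
  moreover have "finite (quotient_set A)"
    unfolding quotient_set_def by (rule finite_subset[of _ "(\<lambda>(a, b). b / a) ` (A \<times> A)"]) (use A in auto)
  ultimately have r: "card (ratios B) \<le> card (quotient_set A)" by (intro card_mono)
  have "B * B \<subseteq> A * A"
  proof
    fix x assume "x \<in> B * B"
    then obtain a b where ab: "a \<in> B'" "b \<in> B'" "x = \<sigma> * a * (\<sigma> * b)" by (auto simp: set_times_def B_def)
    have "\<sigma> * a * (\<sigma> * b) = (\<sigma> * \<sigma>) * (a * b)" by (simp add: mult_ac)
    hence x: "x = a * b" using ab(3) \<sigma>2 by simp
    show "x \<in> A * A" unfolding x using ab B'A by (intro set_times_intro) blast+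
  qed
  moreover have "finite (A * A)"
    unfolding set_times_def by (rule finite_subset[of _ "(\<lambda>(a, b). a * b) ` (A \<times> A)"]) (use A in auto)
  ultimately have p: "card (B * B) \<le> card (A * A)" by (intro card_mono)
  show "N powr (1 + \<delta> - 90 * \<eta>) \<le> real (card (quotient_set A))"
    using gen[of "real (card (ratios B))"] card_ratios_energy(1)[OF finB pos] r unfolding E_def n_def by linarith
  show "N powr (1 + \<delta> - 90 * \<eta>) \<le> real (card (A * A))"
    using gen[of "real (card (B * B))"] card_ratios_energy(2)[OF finB pos] p unfolding E_def n_def by linarith
qed

theorem theorem1p3:
  fixes m :: real
  assumes "m \<ge> 1"
  shows "\<exists>\<epsilon>\<^sub>0>0. \<forall>\<epsilon>::real. 0 < \<epsilon> \<and> \<epsilon> < \<epsilon>\<^sub>0 \<longrightarrow>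
    (\<forall>s k :: nat. s \<ge> k * (k + 1) \<and> k \<ge> 2 \<longrightarrow>
      (\<exists>C::real. C > 0 \<and> (\<exists>N\<^sub>0::nat. \<forall>(A::real set) (\<alpha>::real).
        finite A \<and> well_spaced A \<and> 0 \<notin> A \<and> card A \<ge> N\<^sub>0 \<and>
        diam A \<le> real (card A) powr m \<and>
        0 < \<alpha> \<and> \<alpha> \<le> 1 \<and>
        ln (inverse \<alpha>) \<le> \<epsilon> * real k * (real k + 1) / 43200 * ln (real (card A)) \<and>
        real (vinogradov_J s k A) =
          \<alpha> * real (card A) powr (2 * real s - real k * (real k + 1) / 2) \<longrightarrow>
        (let \<delta> = 1 / (real k * (real k + 1) - 1) in
          real (card A) powr (1 + \<delta> - \<epsilon> * real k ^ 2) \<le> C * real (card (quotient_set A)) \<and>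
          real (card A) powr (1 + \<delta> / 2 - 4 * \<epsilon> * real k ^ 2) \<le> C * real (card (A * A))))))"
proof (rule exI[of _ 1], intro conjI allI impI)
  fix \<epsilon> :: real and s k :: nat
  assume \<epsilon>: "0 < \<epsilon> \<and> \<epsilon> < 1" and sk: "s \<ge> k * (k + 1) \<and> k \<ge> 2"
  have k: "k \<ge> 2" using sk by simp
  define D where "D = tri k"
  have D2: "2 * D = k * (k + 1)" by (simp add: D_def tri_def)
  have "2 * 3 \<le> k * (k + 1)" using k by (intro mult_le_mono) auto
  hence D3: "D \<ge> 3" using D2 by linarith
  have "real (2 * D) = real (k * (k + 1))" using D2 by (rule arg_cong)
  hence rD: "2 * real D = real k * (real k + 1)" by (simp add: algebra_simps)
  \<comment> \<open>\<open>N powr \<eta>\<close> is the common size of all losses: it bounds the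
    inverse of \<alpha>, the loss of the mean value theorem and all absolute constants. As
    everything is absorbed into it, the implied constant can be 1.\<close>
  define \<eta> where "\<eta> = \<epsilon> * real k * (real k + 1) / 43200"
  have \<eta>: "\<eta> > 0" using \<epsilon> k by (simp add: \<eta>_def)
  have m: "m > 0" using assms by simp
  have k1: "k \<ge> 1" using k by simp
  \<comment> \<open>The diameter is at most \<open>N powr m\<close>, so this exponent yields
    \<open>N powr (\<eta> / 2)\<close>; the other half of \<open>\<eta>\<close> absorbs the constant
    of the mean value theorem.\<close>
  have \<eta>m: "\<eta> / (2 * m) > 0" using \<eta> m by simp
  obtain C\<^sub>0 where C0: "C\<^sub>0 > 0" and mv: "\<And>B c X :: real. finite B \<Longrightarrow> X \<ge> 1 \<Longrightarrow> B \<subseteq> {c..<c + X} \<Longrightarrow> (\<And>y. card (B \<inter> {y..<y + 1}) \<le> 2) \<Longrightarrow>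
       real (solutions k (tri k) B) \<le> C\<^sub>0 * X powr (\<eta> / (2 * m)) * real (card B) ^ tri k"
    by (rule mean_value[OF k1 \<eta>m]) (rule that; blast)
  have "eventually (\<lambda>n::nat. real n powr \<eta> \<ge> 2 ^ 43 \<and> real n powr \<eta> \<ge> 1 + ln (real n) \<and>
      C\<^sub>0 * 2 powr (\<eta> / (2 * m)) * real n powr (\<eta> / 2) \<le> real n powr \<eta>) sequentially"
    using \<eta> by (intro eventually_conj; real_asymp)
  then obtain N\<^sub>0 where N0: "\<And>n. n \<ge> N\<^sub>0 \<Longrightarrow> real n powr \<eta> \<ge> 2 ^ 43 \<and> real n powr \<eta> \<ge> 1 + ln (real n) \<and>
      C\<^sub>0 * 2 powr (\<eta> / (2 * m)) * real n powr (\<eta> / 2) \<le> real n powr \<eta>"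
    unfolding eventually_sequentially by blast
  let ?concl = "\<lambda>A. let \<delta> = 1 / (real k * (real k + 1) - 1) in
          real (card A) powr (1 + \<delta> - \<epsilon> * real k ^ 2) \<le> 1 * real (card (quotient_set A)) \<and>
          real (card A) powr (1 + \<delta> / 2 - 4 * \<epsilon> * real k ^ 2) \<le> 1 * real (card (A * A))"
  have main: "?concl A" if h: "finite A \<and> well_spaced A \<and> 0 \<notin> A \<and> card A \<ge> max 1 N\<^sub>0 \<and>
        diam A \<le> real (card A) powr m \<and> 0 < \<alpha> \<and> \<alpha> \<le> 1 \<and>
        ln (inverse \<alpha>) \<le> \<epsilon> * real k * (real k + 1) / 43200 * ln (real (card A)) \<and>
        real (vinogradov_J s k A) = \<alpha> * real (card A) powr (2 * real s - real k * (real k + 1) / 2)" for A \<alpha>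
  proof -
    have A: "finite A" "0 \<notin> A" "A \<noteq> {}" and ws: "well_spaced A" using h by auto
    define N where "N = real (card A)"
    define K where "K = N powr \<eta>"
    have N1: "N \<ge> 1" using h by (simp add: N_def)
    have big: "K \<ge> 2 ^ 43" "K \<ge> 1 + ln N" "C\<^sub>0 * 2 powr (\<eta> / (2 * m)) * N powr (\<eta> / 2) \<le> K"
      using N0[of "card A"] h by (simp_all add: N_def K_def)
    have K0: "K > 0" using N1 by (simp add: K_def)
    \<comment> \<open>The factor 2 makes room for the supremum in a half-open interval.\<close>
    define X where "X = 2 * N powr m"
    have Nm: "N powr m \<ge> 1" using N1 m by (intro ge_one_powr_ge_zero) auto
    have X1: "X \<ge> 1" using Nm by (simp add: X_def)
    have AX: "A \<subseteq> {Inf A..<Inf A + X}"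
    proof
      fix x assume x: "x \<in> A"
      have "Inf A \<le> x" "x \<le> Sup A"
        using A x by (auto intro: cInf_lower cSup_upper bdd_below_finite bdd_above_finite)
      moreover have "Sup A - Inf A \<le> N powr m" using h unfolding diam_def N_def by linarith
      ultimately show "x \<in> {Inf A..<Inf A + X}" using Nm by (simp add: X_def)
    qed
    have sol: "real (solutions k D C) \<le> K * real (card C) ^ D" if C: "C \<subseteq> A" for C
    proof -
      have "card (C \<inter> {y..<y + 1}) \<le> 2" for y
        using card_mono[of "A \<inter> {y..<y + 1}" "C \<inter> {y..<y + 1}"] A(1) C well_spaced_unit_interval[OF ws, of y] by force
      hence "real (solutions k D C) \<le> C\<^sub>0 * X powr (\<eta> / (2 * m)) * real (card C) ^ D"
        unfolding D_def using mv[of C X "Inf A"] X1 AX C A(1) finite_subset by blast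
      also have "X powr (\<eta> / (2 * m)) = 2 powr (\<eta> / (2 * m)) * N powr (\<eta> / 2)"
        using m N1 by (simp add: X_def powr_mult powr_powr)
      also have "C\<^sub>0 * (2 powr (\<eta> / (2 * m)) * N powr (\<eta> / 2)) * real (card C) ^ D \<le> K * real (card C) ^ D"
        using big(3) by (intro mult_right_mono) (auto simp: mult.assoc)
      finally show ?thesis .
    qed
    have J: "real (solutions k (2 * D) A) \<ge> N ^ (3 * D) / K"
    proof -
      have \<alpha>: "\<alpha> > 0" using h by simp
      have "inverse \<alpha> = exp (ln (inverse \<alpha>))" using \<alpha> by simp
      also have "\<dots> \<le> exp (\<eta> * ln N)"
        unfolding exp_le_cancel_iff \<eta>_def N_def using h by blast
      also have "\<dots> = K" using N1 by (simp add: K_def powr_def)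
      finally have \<alpha>K: "1 / K \<le> \<alpha>" using \<alpha> K0 by (simp add: field_simps)
      \<comment> \<open>The number of variables on each side to be removed to reach
        \<open>2 D = k (k + 1)\<close>.\<close>
      define d where "d = s - 2 * D"
      have s: "s = 2 * D + d" using sk D2 by (simp add: d_def)
      have "N ^ (2 * d) * (N ^ (3 * D) / K) = 1 / K * N powr (real (2 * d + 3 * D))"
      proof -
        have "N powr (real (2 * d + 3 * D)) = N ^ (2 * d + 3 * D)" using N1 by (intro powr_realpow) simp
        thus ?thesis by (simp add: power_add)
      qed
      also have "real (2 * d + 3 * D) = 2 * real s - real k * (real k + 1) / 2"
        unfolding s using rD by simp
      also have "1 / K * N powr \<dots> \<le> \<alpha> * N powr (2 * real s - real k * (real k + 1) / 2)"
        using \<alpha>K by (intro mult_right_mono) auto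
      also have "\<dots> = real (solutions k s A)" using h by (simp add: N_def vinogradov_J_eq)
      also have "\<dots> \<le> real (card A ^ (2 * d) * solutions k (2 * D) A)"
        unfolding s by (intro of_nat_mono solutions_add A)
      also have "\<dots> = N ^ (2 * d) * real (solutions k (2 * D) A)" by (simp add: N_def)
      finally show ?thesis by (rule mult_left_le_imp_le) (use N1 in simp)
    qed
    define \<delta> where "\<delta> = 1 / (2 * real D - 1)"
    have \<delta>0: "\<delta> > 0" using D3 by (simp add: \<delta>_def)
    have g1: "N powr (1 + \<delta> - 90 * \<eta>) \<le> real (card (quotient_set A))"
      and g2: "N powr (1 + \<delta> - 90 * \<eta>) \<le> real (card (A * A))"
      using growth_of_products[OF A k1 D3 \<eta> sol[unfolded K_def N_def] J[unfolded K_def N_def] big(1,2)[unfolded K_def N_def]]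
      unfolding N_def \<delta>_def by blast+
    have e: "90 * \<eta> \<le> \<epsilon> * real k ^ 2"
    proof -
      have "real k * (real k + 1) \<le> 2 * real k ^ 2" using k by (simp add: power2_eq_square)
      hence "\<epsilon> * (real k * (real k + 1)) \<le> \<epsilon> * (2 * real k ^ 2)" using \<epsilon> by (intro mult_left_mono) auto
      moreover have "0 \<le> \<epsilon> * real k ^ 2" using \<epsilon> by simp
      ultimately show ?thesis by (simp add: \<eta>_def mult.assoc)
    qed
    have \<epsilon>k: "0 \<le> \<epsilon> * real k ^ 2" using \<epsilon> by simp
    have "N powr (1 + \<delta> - \<epsilon> * real k ^ 2) \<le> N powr (1 + \<delta> - 90 * \<eta>)"
      using e N1 by (intro powr_mono) auto
    \<comment> \<open>Products share the energy bound of the ratios and therefore grow with the same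
      exponent; the stated one follows by monotonicity.\<close>
    moreover have "N powr (1 + \<delta> / 2 - 4 * \<epsilon> * real k ^ 2) \<le> N powr (1 + \<delta> - 90 * \<eta>)"
      using e N1 \<delta>0 \<epsilon>k by (intro powr_mono) auto
    ultimately show ?thesis
      using g1 g2 unfolding Let_def rD[symmetric] \<delta>_def[symmetric] N_def[symmetric] by simp
  qed
  show "\<exists>C>0. \<exists>N\<^sub>0. \<forall>A \<alpha>. finite A \<and> well_spaced A \<and> 0 \<notin> A \<and> card A \<ge> N\<^sub>0 \<and>
        diam A \<le> real (card A) powr m \<and> 0 < \<alpha> \<and> \<alpha> \<le> 1 \<and>
        ln (inverse \<alpha>) \<le> \<epsilon> * real k * (real k + 1) / 43200 * ln (real (card A)) \<and>
        real (vinogradov_J s k A) = \<alpha> * real (card A) powr (2 * real s - real k * (real k + 1) / 2) \<longrightarrow>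
        (let \<delta> = 1 / (real k * (real k + 1) - 1) in
          real (card A) powr (1 + \<delta> - \<epsilon> * real k ^ 2) \<le> C * real (card (quotient_set A)) \<and>
          real (card A) powr (1 + \<delta> / 2 - 4 * \<epsilon> * real k ^ 2) \<le> C * real (card (A * A)))"
    by (rule exI[of _ 1], rule conjI, simp, rule exI[of _ "max 1 N\<^sub>0"], intro allI impI, rule main)
qed simp

end
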